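(* There is an absolute constant $C>0$ such that for every $f\in \mathrm{B}^1_{\infty,1}(\mathbb{R}^2)$ (the inhomogeneous Besov class), the function $f_\sharp(s,t)=(1-\mathrm{i}t)^{-1}f(s,t)$, $(s,t)\in\mathbb{R}^2$, belongs to the Haagerup tensor product $\mathscr{B}^\infty\otimes_{\rm h}\mathscr{B}^\infty$ and $$ \|f_\sharp\|_{\mathscr{B}^\infty\otimes_{\rm h}\mathscr{B}^\infty}\le C\,\|f\|_{\mathrm{B}^1_{\infty,1}(\mathbb{R}^2)}. $$
   Context: Inhomogeneous Besov class $\mathrm{B}^1_{\infty,1}(\mathbb{R}^2)$: fix $w\in C^\infty(\mathbb{R})$, $w\ge0$, $\operatorname{supp}w\subset[1/2,2]$, $w(s)=1-w(s/2)$ for $s\in[1,2]$. For a tempered distribution $f$ on $\mathbb{R}^2$ with Fourier transform $\mathcal{F}f$, let $\mathcal{F}f_n=w(2^{-n}\|\cdot\|_2)\,\mathcal{F}f$ for $n\ge1$ and $f_0=f-\sum_{n\ge1}f_n$ (i.e. $\mathcal{F}f_0=(1-\sum_{n\ge1}w(2^{-n}\|\cdot\|_2))\mathcal{F}f$). Then $f\in \mathrm{B}^1_{\infty,1}(\mathbb{R}^2)$ iff $\|f\|_{\mathrm{B}^1_{\infty,1}}=\sum_{n\ge0}2^n\|f_n\|_{L^\infty(\mathbb{R}^2)}<\infty$. Such $f$ are identified with their continuous (indeed bounded $C^1$) representatives. Haagerup tensor product: $\mathscr{B}^\infty$ is the space of bounded (complex-valued) Borel functions on $\mathbb{R}$.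 A function $\Phi$ on $\mathbb{R}^2$ is in $\mathscr{B}^\infty\otimes_{\rm h}\mathscr{B}^\infty$ if $\Phi(x,y)=\sum_n\varphi_n(x)\psi_n(y)$ with $\varphi_n,\psi_n\in\mathscr{B}^\infty$ and $\big(\sup_x\sum_n|\varphi_n(x)|^2\cdot\sup_y\sum_n|\psi_n(y)|^2\big)^{1/2}<\infty$; its norm is the infimum of this quantity over all such representations. *)

theory Defs
  imports "HOL-Probability.Essential_Supremum"
begin

section \<open>Schwartz functions and tempered distributions on the plane\<close>

text \<open>
  The plane is the type \<^typ>\<open>real \<times> real\<close>, whose library norm is the Euclidean one.
  The library has no notion of \<open>C\<^sup>\<infinity>\<close> function of several variables.
  A function is \<open>C\<^sup>\<infinity>\<close> iff all its iterated partial derivatives exist and are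
  (Frechet) differentiable everywhere; the list records the coordinate directions.
\<close>

fun iter_deriv :: "'a::euclidean_space list \<Rightarrow> ('a \<Rightarrow> complex) \<Rightarrow> 'a \<Rightarrow> complex" where
  "iter_deriv [] \<phi> = \<phi>"
| "iter_deriv (b # bs) \<phi> = (\<lambda>x. frechet_derivative (iter_deriv bs \<phi>) (at x) b)"

definition smooth :: "('a::euclidean_space \<Rightarrow> complex) \<Rightarrow> bool" where
  "smooth \<phi> \<longleftrightarrow> (\<forall>bs \<in> lists Basis. \<forall>x. iter_deriv bs \<phi> differentiable (at x))"

definition schwartz :: "('a::euclidean_space \<Rightarrow> complex) set" where
  "schwartz = {\<phi>. smooth \<phi> \<and>
     (\<forall>bs \<in> lists Basis. \<forall>k::nat. bounded (range (\<lambda>x. (1 + norm x) ^ k *\<^sub>R iter_deriv bs \<phi> x)))}"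

text \<open>
  An increasing sequence of norms defining the usual topology of the Schwartz space.
\<close>

definition schwartz_norm :: "nat \<Rightarrow> ('a::euclidean_space \<Rightarrow> complex) \<Rightarrow> real" where
  "schwartz_norm N \<phi> =
     (SUP (bs, x) \<in> {bs \<in> lists Basis. length bs \<le> N} \<times> UNIV.
        (1 + norm x) ^ N * norm (iter_deriv bs \<phi> x))"

text \<open>
  A distribution is a functional on functions of which only the values on
  \<^const>\<open>schwartz\<close> are relevant: no notion below depends on the other values.
\<close>

type_synonym dist2 = "(real \<times> real \<Rightarrow> complex) \<Rightarrow> complex"

definition tempered :: "dist2 \<Rightarrow> bool" where
  "tempered u \<longleftrightarrow>
     (\<forall>\<phi>\<in>schwartz. \<forall>\<psi>\<in>schwartz. u (\<lambda>x. \<phi> x + \<psi> x) = u \<phi> + u \<psi>) \<and>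
     (\<forall>\<phi>\<in>schwartz. \<forall>c. u (\<lambda>x. c * \<phi> x) = c * u \<phi>) \<and>
     (\<exists>N K. \<forall>\<phi>\<in>schwartz. norm (u \<phi>) \<le> K * schwartz_norm N \<phi>)"

definition represents :: "(real \<times> real \<Rightarrow> complex) \<Rightarrow> dist2 \<Rightarrow> bool" where
  "represents g u \<longleftrightarrow>
     g \<in> borel_measurable lborel \<and>
     (\<forall>\<phi>\<in>schwartz. integrable lborel (\<lambda>x. g x * \<phi> x) \<and> u \<phi> = (LINT x|lborel. g x * \<phi> x))"

text \<open>
  The infimum ranges over a single almost-everywhere class of functions, or over the
  empty set, in which case the value is \<open>\<infinity>\<close>.
\<close>

definition dist_Linf_norm :: "dist2 \<Rightarrow> ennreal" where
  "dist_Linf_norm u = (INF g \<in> {g. represents g u}. esssup lborel (\<lambda>x. ennreal (norm (g x))))"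


section \<open>Fourier transform\<close>

text \<open>
  Convention: \<open>(F \<phi>)(\<xi>) = \<integral> \<phi>(x) exp(-i x\<bullet>\<xi>) dx\<close>, hence the factor \<open>(2\<pi>)\<^sup>-\<^sup>2\<close> in the
  inverse; on distributions both are defined by duality.
\<close>

definition fourier :: "(real \<times> real \<Rightarrow> complex) \<Rightarrow> real \<times> real \<Rightarrow> complex" where
  "fourier \<phi> \<xi> = (LINT x|lborel. cis (- (x \<bullet> \<xi>)) * \<phi> x)"

definition fourier_inv :: "(real \<times> real \<Rightarrow> complex) \<Rightarrow> real \<times> real \<Rightarrow> complex" where
  "fourier_inv \<phi> x = complex_of_real (1 / (2 * pi)\<^sup>2) * (LINT \<xi>|lborel. cis (x \<bullet> \<xi>) * \<phi> \<xi>)"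

definition dist_fourier :: "dist2 \<Rightarrow> dist2" where
  "dist_fourier u \<phi> = u (fourier \<phi>)"

definition dist_fourier_inv :: "dist2 \<Rightarrow> dist2" where
  "dist_fourier_inv u \<phi> = u (fourier_inv \<phi>)"

definition dist_mult :: "(real \<times> real \<Rightarrow> real) \<Rightarrow> dist2 \<Rightarrow> dist2" where
  "dist_mult m u \<phi> = u (\<lambda>\<xi>. complex_of_real (m \<xi>) * \<phi> \<xi>)"


section \<open>The Besov class\<close>

definition lp_window :: "(real \<Rightarrow> real) \<Rightarrow> bool" where
  "lp_window w \<longleftrightarrow>
     (\<forall>n s. (deriv ^^ n) w differentiable (at s)) \<and>
     (\<forall>s. 0 \<le> w s) \<and>
     closure {s. w s \<noteq> 0} \<subseteq> {1/2..2} \<and>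
     (\<forall>s\<in>{1..2}. w s = 1 - w (s / 2))"

text \<open>The series below has at most two nonzero terms at each point.\<close>

definition lp_multiplier :: "(real \<Rightarrow> real) \<Rightarrow> nat \<Rightarrow> real \<times> real \<Rightarrow> real" where
  "lp_multiplier w n \<xi> =
     (if n = 0 then 1 - (\<Sum>k. w (norm \<xi> / 2 ^ Suc k)) else w (norm \<xi> / 2 ^ n))"

definition lp_block :: "(real \<Rightarrow> real) \<Rightarrow> dist2 \<Rightarrow> nat \<Rightarrow> dist2" where
  "lp_block w f n = dist_fourier_inv (dist_mult (lp_multiplier w n) (dist_fourier f))"

definition besov_norm :: "(real \<Rightarrow> real) \<Rightarrow> dist2 \<Rightarrow> ennreal" where
  "besov_norm w f = (\<Sum>n. 2 ^ n * dist_Linf_norm (lp_block w f n))"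

definition besov :: "(real \<Rightarrow> real) \<Rightarrow> dist2 set" where
  "besov w = {f. tempered f \<and> besov_norm w f < \<infinity>}"


section \<open>The Haagerup tensor product\<close>

definition bounded_borel :: "(real \<Rightarrow> complex) set" where
  "bounded_borel = {\<phi>. \<phi> \<in> borel_measurable borel \<and> bounded (range \<phi>)}"

definition sup_sq_sum :: "(nat \<Rightarrow> real \<Rightarrow> complex) \<Rightarrow> ennreal" where
  "sup_sq_sum \<phi> = (SUP x. \<Sum>n. ennreal ((norm (\<phi> n x))\<^sup>2))"

text \<open>
  Both suprema are required to be finite, not just their product, which excludes only
  \<open>0 * \<infinity>\<close> representations of the zero function.
\<close>

definition haagerup_rep ::
  "(nat \<Rightarrow> real \<Rightarrow> complex) \<Rightarrow> (nat \<Rightarrow> real \<Rightarrow> complex) \<Rightarrow> (real \<times> real \<Rightarrow> complex) \<Rightarrow> bool" where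
  "haagerup_rep \<phi> \<psi> \<Phi> \<longleftrightarrow>
     (\<forall>n. \<phi> n \<in> bounded_borel \<and> \<psi> n \<in> bounded_borel) \<and>
     sup_sq_sum \<phi> < \<infinity> \<and> sup_sq_sum \<psi> < \<infinity> \<and>
     (\<forall>x y. (\<lambda>n. \<phi> n x * \<psi> n y) sums \<Phi> (x, y))"

definition haagerup :: "(real \<times> real \<Rightarrow> complex) set" where
  "haagerup = {\<Phi>. \<exists>\<phi> \<psi>. haagerup_rep \<phi> \<psi> \<Phi>}"

text \<open>Meaningful on \<^const>\<open>haagerup\<close> only: elsewhere it is the infimum of the empty set of reals.\<close>

definition haagerup_norm :: "(real \<times> real \<Rightarrow> complex) \<Rightarrow> real" where
  "haagerup_norm \<Phi> =
     Inf {sqrt (enn2real (sup_sq_sum \<phi> * sup_sq_sum \<psi>)) | \<phi> \<psi>. haagerup_rep \<phi> \<psi> \<Phi>}"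

definition sharp :: "(real \<times> real \<Rightarrow> complex) \<Rightarrow> real \<times> real \<Rightarrow> complex" where
  "sharp f = (\<lambda>(s, t). inverse (1 - \<i> * complex_of_real t) * f (s, t))"

end

theory Submission
  imports Defs "HOL-Probability.Characteristic_Functions" "HOL-Probability.Sinc_Integral"
begin

text \<open>
  The proof separates into two statements that meet in a Lipschitz bound.

  If \<open>g\<close> is bounded and Lipschitz, both with constant \<open>D\<close>, then \<open>sharp g\<close> has Haagerup norm at most a
  multiple of \<open>D\<close> (\<open>haagerup_sharp_of_lipschitz\<close>). The factor \<open>1 / (1 - i t)\<close> makes \<open>sharp g\<close> and its
  Lipschitz constant in \<open>t\<close> decay like \<open>1 / \<bar>t\<bar>\<close>, which is square summable over unit intervals. One
  expands \<open>sharp g (s, t)\<close> in the variable \<open>t\<close> along dyadic approximations of \<open>t\<close>. The terms are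
  increments of \<open>sharp g (s, _)\<close> between neighbouring dyadic points times indicator functions of dyadic
  intervals, and both square sums in the Haagerup norm converge geometrically in the level
  (\<open>haagerup_of_decaying_lipschitz\<close>).

  Every \<open>f\<close> in the Besov class has a representative that is bounded and Lipschitz with constant a
  multiple of its norm (\<open>lipschitz_representative\<close>). The block \<open>f\<^sub>n\<close> has frequencies of size at most
  \<open>2\<^sup>n\<^sup>+\<^sup>1\<close>, so it is reproduced by convolution with the dilate by \<open>2\<^sup>n\<^sup>+\<^sup>1\<close> of a fixed kernel, the
  inverse Fourier transform of a smooth cutoff (\<open>lp_block_smoothing\<close>). The kernel decays rapidly
  together with its gradient. Hence \<open>f\<^sub>n\<close> is represented by a function with Lipschitz constant of
  order \<open>2\<^sup>n\<close> times its supremum (\<open>lp_block_lipschitz_representative\<close>), and the sum of these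
  constants is at most a multiple of the Besov norm. The blocks sum to \<open>f\<close> because convolution with the dilated kernel
  is an approximate identity on Schwartz functions (\<open>schwartz_norm_conv_dilate_tendsto\<close>,
  \<open>lp_block_sums\<close>).

  The Fourier analysis is thereby reduced to facts about convolution with one kernel: its decay, by
  integration by parts against the cutoff, and two instances of Fourier inversion, once for the
  total mass of the kernel and once for the reproducing property.
\<close>

section \<open>Integration on the plane\<close>

lemma lborel_integral_affine:
  fixes f :: "'a::euclidean_space \<Rightarrow> 'b::{banach, second_countable_topology}"
  assumes [measurable]: "f \<in> borel_measurable borel" and c: "c \<noteq> 0"
  shows "(LINT x|lborel. f (t + c *\<^sub>R x)) = (1 / \<bar>c\<bar> ^ DIM('a)) *\<^sub>R (LINT x|lborel. f x)"
proof -
  have "(LINT x|lborel. f x) = (LINT x|density (distr lborel borel (\<lambda>x. t + c *\<^sub>R x)) (\<lambda>_. \<bar>c\<bar> ^ DIM('a)). f x)"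
    by (subst lborel_affine[OF c, of t]) (rule refl)
  also have "\<dots> = \<bar>c\<bar> ^ DIM('a) *\<^sub>R (LINT x|lborel. f (t + c *\<^sub>R x))"
    by (subst integral_density) (auto simp: integral_distr)
  finally show ?thesis using c by simp
qed

lemma lborel_integrable_affine:
  fixes f :: "'a::euclidean_space \<Rightarrow> 'b::{banach, second_countable_topology}"
  assumes f: "integrable lborel f" and c: "c \<noteq> 0"
  shows "integrable lborel (\<lambda>x. f (t + c *\<^sub>R x))"
proof -
  have [measurable]: "f \<in> borel_measurable borel" using f by auto
  have "integrable (density (distr lborel borel (\<lambda>x. t + c *\<^sub>R x)) (\<lambda>_. \<bar>c\<bar> ^ DIM('a))) f"
    using f by (subst (asm) lborel_affine[OF c, of t])
  then have "integrable lborel (\<lambda>x. \<bar>c\<bar> ^ DIM('a) *\<^sub>R f (t + c *\<^sub>R x))"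
    by (subst (asm) integrable_density) (auto simp: integrable_distr_eq)
  from integrable_scaleR_right[of "1 / \<bar>c\<bar> ^ DIM('a)", OF this] show ?thesis
    using c by simp
qed

lemma lborel_integral_reflect:
  fixes f :: "'a::euclidean_space \<Rightarrow> 'b::{banach, second_countable_topology}"
  assumes "f \<in> borel_measurable borel"
  shows "(LINT y|lborel. f (x - y)) = (LINT y|lborel. f y)"
  using lborel_integral_affine[OF assms, of "-1" x] by simp

lemma integrable_pair_mult:
  fixes f :: "'a::euclidean_space \<Rightarrow> complex" and g :: "'b::euclidean_space \<Rightarrow> complex"
  assumes f: "integrable lborel f" and g: "integrable lborel g"
  shows "integrable (lborel \<Otimes>\<^sub>M lborel) (\<lambda>(x, y). f x * g y)"
proof (rule lborel_pair.Fubini_integrable)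
  have [measurable]: "f \<in> borel_measurable borel" "g \<in> borel_measurable borel" using f g by auto
  show "(\<lambda>(x, y). f x * g y) \<in> borel_measurable (lborel \<Otimes>\<^sub>M lborel)" by measurable
  show "integrable lborel (\<lambda>x. LINT y|lborel. norm (case (x, y) of (x, y) \<Rightarrow> f x * g y))"
    using f by (simp add: norm_mult)
  show "AE x in lborel. integrable lborel (\<lambda>y. case (x, y) of (x, y) \<Rightarrow> f x * g y)"
    using g by simp
qed

lemma integrable_pair_convolution:
  fixes f g :: "'a::euclidean_space \<Rightarrow> complex"
  assumes f: "integrable lborel f" and g: "integrable lborel g"
  shows "integrable (lborel \<Otimes>\<^sub>M lborel) (\<lambda>(x, y). f x * g (y - x))"
proof (rule lborel_pair.Fubini_integrable)
  have [measurable]: "f \<in> borel_measurable borel" "g \<in> borel_measurable borel" using f g by auto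
  show "(\<lambda>(x, y). f x * g (y - x)) \<in> borel_measurable (lborel \<Otimes>\<^sub>M lborel)" by measurable
  have tr: "integrable lborel (\<lambda>y. g (y - x))" for x
    using lborel_integrable_affine[OF g, of 1 "- x"] by simp
  have "(LINT y|lborel. norm (g (y - x))) = (LINT y|lborel. norm (g y))" for x
    using lborel_integral_affine[of "\<lambda>y. norm (g y)" 1 "- x"] by simp
  then show "integrable lborel (\<lambda>x. LINT y|lborel. norm (case (x, y) of (x, y) \<Rightarrow> f x * g (y - x)))"
    using f by (simp add: norm_mult)
  show "AE x in lborel. integrable lborel (\<lambda>y. case (x, y) of (x, y) \<Rightarrow> f x * g (y - x))"
    using tr by simp
qed

lemma integrable_mult_bounded_continuous:
  fixes f g :: "'a::euclidean_space \<Rightarrow> complex"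
  assumes f: "integrable lborel f" and g: "continuous_on UNIV g" "\<And>x. norm (g x) \<le> B"
  shows "integrable lborel (\<lambda>x. g x * f x)"
proof (rule Bochner_Integration.integrable_bound)
  show "integrable lborel (\<lambda>x. B * norm (f x))" using f by auto
  have [measurable]: "f \<in> borel_measurable borel" "g \<in> borel_measurable borel"
    using f g by (auto intro: borel_measurable_continuous_onI)
  show "(\<lambda>x. g x * f x) \<in> borel_measurable lborel" by measurable
  have "norm (g x * f x) \<le> norm (B * norm (f x))" for x
    using mult_right_mono[OF g(2)[of x], of "norm (f x)"] by (simp add: norm_mult)
  then show "AE x in lborel. norm (g x * f x) \<le> norm (B * norm (f x))" by simp
qed

lemma integrable_cis_mult:
  fixes f :: "'a::euclidean_space \<Rightarrow> complex"
  assumes "integrable lborel f"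
  shows "integrable lborel (\<lambda>x. cis (a \<bullet> x) * f x)" "integrable lborel (\<lambda>x. cis (- (a \<bullet> x)) * f x)"
    "integrable lborel (\<lambda>x. cis (x \<bullet> a) * f x)" "integrable lborel (\<lambda>x. cis (- (x \<bullet> a)) * f x)"
  by (rule integrable_mult_bounded_continuous[OF assms, where B = 1];
      auto intro!: continuous_intros)+

text \<open>
  With the exponent \<open>4\<close> the bound is dominated by the product of \<open>1 / (1 + x\<^sup>2)\<close> and \<open>1 / (1 + y\<^sup>2)\<close>.
\<close>

lemma integrable_of_decay:
  fixes f :: "real \<times> real \<Rightarrow> complex"
  assumes f: "f \<in> borel_measurable borel" and bd: "\<And>x. (1 + norm x) ^ 4 * norm (f x) \<le> B"
  shows "integrable lborel f"
proof (rule Bochner_Integration.integrable_bound)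
  define h :: "real \<Rightarrow> complex" where "h x = complex_of_real (inverse (1 + x\<^sup>2))" for x
  have "einterval (-\<infinity>) \<infinity> = (UNIV :: real set)" by (auto simp: einterval_def)
  then have "integrable lborel h"
    using integrable_inverse_1_plus_square unfolding h_def
    by (intro integrable_of_real) (simp add: set_integrable_def)
  from integrable_pair_mult[OF this this]
  have "integrable lborel (\<lambda>(x, y). h x * h y)" by (simp add: lborel_prod)
  then show "integrable lborel (\<lambda>z. B * (case z of (x, y) \<Rightarrow> h x * h y))" by auto
  show "f \<in> borel_measurable lborel" using f by simp
  have "norm (f (x, y)) \<le> norm (B * (h x * h y))" for x y
  proof -
    let ?n = "norm (x, y)"
    have "x\<^sup>2 \<le> ?n\<^sup>2" "y\<^sup>2 \<le> ?n\<^sup>2" by (simp_all add: norm_prod_def)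
    then have "(1 + x\<^sup>2) * (1 + y\<^sup>2) \<le> (1 + ?n\<^sup>2) * (1 + ?n\<^sup>2)"
      by (intro mult_mono) auto
    also have "\<dots> \<le> (1 + ?n)\<^sup>2 * (1 + ?n)\<^sup>2"
      by (intro mult_mono) (auto simp: power2_sum)
    finally have le: "(1 + x\<^sup>2) * (1 + y\<^sup>2) \<le> (1 + ?n) ^ 4"
      by (simp add: power_add[symmetric])
    have B: "0 \<le> B" using bd[of 0] by (rule order_trans[rotated]) simp
    have "(1 + x\<^sup>2) * (1 + y\<^sup>2) * norm (f (x, y)) \<le> B"
      using mult_right_mono[OF le norm_ge_zero] bd[of "(x, y)"] by (rule order_trans)
    moreover have "0 < (1 + x\<^sup>2) * (1 + y\<^sup>2)"
      by (intro mult_pos_pos) (auto simp: add_pos_nonneg)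
    ultimately have "norm (f (x, y)) \<le> B / ((1 + x\<^sup>2) * (1 + y\<^sup>2))"
      by (simp add: pos_le_divide_eq mult.commute)
    also have "\<dots> = norm (B * (h x * h y))"
      using B by (simp add: h_def norm_mult norm_inverse divide_inverse flip: of_real_mult of_real_add of_real_power)
    finally show ?thesis .
  qed
  then show "AE z in lborel. norm (f z) \<le> norm (B * (case z of (x, y) \<Rightarrow> h x * h y))"
    by (auto simp del: of_real_mult norm_mult)
qed

section \<open>Fourier inversion\<close>

lemma norm_fourier_le:
  assumes "integrable lborel u"
  shows "norm (fourier u x) \<le> (LINT y|lborel. norm (u y))"
  unfolding fourier_def
  by (rule order_trans[OF integral_norm_bound]) (simp add: norm_mult)

text \<open>
  Dominated convergence, in the form that gives the continuity of both Fourier transforms.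
\<close>

lemma continuous_on_integral_dominated:
  fixes F :: "'a::euclidean_space \<Rightarrow> 'b \<Rightarrow> 'c::{banach, second_countable_topology}"
  assumes w: "integrable M w"
    and meas: "\<And>x. F x \<in> borel_measurable M"
    and cont: "\<And>y. continuous_on UNIV (\<lambda>x. F x y)"
    and bd: "\<And>x y. norm (F x y) \<le> w y"
  shows "continuous_on UNIV (\<lambda>x. LINT y|M. F x y)"
proof (rule continuous_at_imp_continuous_on, intro ballI)
  fix x :: 'a
  show "isCont (\<lambda>x. LINT y|M. F x y) x"
    unfolding continuous_at_sequentially o_def
  proof (intro allI impI)
    fix X :: "nat \<Rightarrow> 'a" assume X: "X \<longlonglongrightarrow> x"
    show "(\<lambda>n. LINT y|M. F (X n) y) \<longlonglongrightarrow> (LINT y|M. F x y)"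
    proof (rule integral_dominated_convergence[OF meas meas w])
      have "(\<lambda>n. F (X n) y) \<longlonglongrightarrow> F x y" for y
        using cont[of y] X by (auto simp: continuous_on_eq_continuous_at intro: isCont_tendsto_compose)
      then show "AE y in M. (\<lambda>n. F (X n) y) \<longlonglongrightarrow> F x y" by simp
      show "AE y in M. norm (F (X n) y) \<le> w y" for n using bd by simp
    qed
  qed
qed

lemma continuous_on_fourier:
  assumes u: "integrable lborel u"
  shows "continuous_on UNIV (fourier u)" "continuous_on UNIV (fourier_inv u)"
proof -
  have [measurable]: "u \<in> borel_measurable borel" using u by auto
  have m [measurable]: "(\<lambda>y. cis (- (y \<bullet> x))) \<in> borel_measurable borel" "(\<lambda>y. cis (x \<bullet> y)) \<in> borel_measurable borel"
    for x :: "real \<times> real" by (intro borel_measurable_continuous_onI continuous_intros)+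
  have "continuous_on UNIV (\<lambda>x. LINT y|lborel. cis (- (y \<bullet> x)) * u y)"
    by (rule continuous_on_integral_dominated[OF integrable_norm[OF u]])
      (auto intro!: continuous_intros simp: norm_mult)
  then show "continuous_on UNIV (fourier u)" by (simp add: fourier_def[abs_def])
  have "continuous_on UNIV (\<lambda>x. LINT y|lborel. cis (x \<bullet> y) * u y)"
    by (rule continuous_on_integral_dominated[OF integrable_norm[OF u]])
      (auto intro!: continuous_intros simp: norm_mult)
  then show "continuous_on UNIV (fourier_inv u)"
    unfolding fourier_inv_def[abs_def] by (intro continuous_intros)
qed

text \<open>
  The Gaussian is written as a product so that its Fourier transform is a product of two
  characteristic functions of the standard normal distribution.
\<close>

definition gauss :: "real \<times> real \<Rightarrow> real" where
  "gauss z = std_normal_density (fst z) * std_normal_density (snd z)"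

lemma integral_cis_std_normal:
  "(LINT x|lborel. cis (t * x) * complex_of_real (std_normal_density x)) = complex_of_real (exp (- t\<^sup>2 / 2))"
proof -
  have "complex_of_real (exp (- t\<^sup>2 / 2)) = char std_normal_distribution t"
    by (simp add: char_std_normal_distribution)
  also have "\<dots> = (LINT x|lborel. std_normal_density x *\<^sub>R exp (\<i> * complex_of_real (t * x)))"
    unfolding char_def
    by (subst integral_density) (auto simp: normal_density_nonneg)
  also have "\<dots> = (LINT x|lborel. cis (t * x) * complex_of_real (std_normal_density x))"
    by (simp add: cis_conv_exp scaleR_conv_of_real mult.commute)
  finally show ?thesis by simp
qed

lemma gauss_eq: "gauss z = exp (- (norm z)\<^sup>2 / 2) / (2 * pi)"
  by (simp add: gauss_def std_normal_density_def norm_prod_def exp_add[symmetric] field_simps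
      power2_eq_square flip: real_sqrt_mult exp_add)

lemma
  shows integrable_gauss: "integrable lborel (\<lambda>z. complex_of_real (gauss z))"
    and integral_cis_gauss: "(LINT z|lborel. cis (a \<bullet> z) * complex_of_real (gauss z)) = complex_of_real (2 * pi * gauss a)"
proof -
  define h where "h x = complex_of_real (std_normal_density x)" for x
  have h: "integrable lborel h" unfolding h_def by (intro integrable_of_real) simp
  have "integrable lborel (\<lambda>(x, y). h x * h y)"
    using integrable_pair_mult[OF h h] by (simp add: lborel_prod)
  then show *: "integrable lborel (\<lambda>z. complex_of_real (gauss z))"
    by (simp add: gauss_def h_def case_prod_unfold)
  have "(LINT z|lborel. cis (a \<bullet> z) * complex_of_real (gauss z)) =
     (LINT z|(lborel \<Otimes>\<^sub>M lborel). (case z of (x, y) \<Rightarrow> (cis (fst a * x) * h x) * (cis (snd a * y) * h y)))"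
    by (simp add: lborel_prod case_prod_unfold gauss_def h_def inner_prod_def cis_mult[symmetric] mult_ac)
  also have "\<dots> = (LINT x|lborel. LINT y|lborel. (cis (fst a * x) * h x) * (cis (snd a * y) * h y))"
    by (rule lborel_pair.integral_fst[symmetric])
      (use integrable_pair_mult[OF integrable_cis_mult(1)[OF h, of "fst a"] integrable_cis_mult(1)[OF h, of "snd a"]] in \<open>simp\<close>)
  also have "\<dots> = (LINT x|lborel. cis (fst a * x) * h x) * (LINT y|lborel. cis (snd a * y) * h y)"
    by simp
  also have "\<dots> = complex_of_real (exp (- (fst a)\<^sup>2 / 2) * exp (- (snd a)\<^sup>2 / 2))"
    by (simp add: h_def integral_cis_std_normal)
  also have "exp (- (fst a)\<^sup>2 / 2) * exp (- (snd a)\<^sup>2 / 2) = 2 * pi * gauss a"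
    by (simp add: gauss_eq norm_prod_def field_simps flip: exp_add)
  finally show "(LINT z|lborel. cis (a \<bullet> z) * complex_of_real (gauss z)) = complex_of_real (2 * pi * gauss a)" .
qed

lemma continuous_on_gauss [continuous_intros]: "continuous_on A f \<Longrightarrow> continuous_on A (\<lambda>x. gauss (f x))"
  unfolding gauss_eq by (intro continuous_intros) auto

lemma gauss_bounds: "0 \<le> gauss z" "2 * pi * gauss z \<le> 1"
  by (auto simp: gauss_eq)

lemma borel_measurable_gauss [measurable]: "gauss \<in> borel_measurable borel"
  by (intro borel_measurable_continuous_onI continuous_intros)

text \<open>
  Fubini turns the damped inversion integral of \<^term>\<open>fourier u\<close> into a double integral over \<open>u\<close> and
  a Gaussian; the Gaussian is its own Fourier transform up to scaling.
\<close>

lemma integral_gauss_average: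
  fixes u :: "real \<times> real \<Rightarrow> complex"
  assumes u: "integrable lborel u" and e: "0 < e"
  shows "complex_of_real (1 / (2 * pi)\<^sup>2) *
      (LINT \<xi>|lborel. cis (x \<bullet> \<xi>) * fourier u \<xi> * complex_of_real (2 * pi * gauss (e *\<^sub>R \<xi>)))
    = (LINT z|lborel. u (x - e *\<^sub>R z) * complex_of_real (gauss z))"
proof -
  have u_meas [measurable]: "u \<in> borel_measurable borel" using u by auto
  define G where "G \<xi> = complex_of_real (gauss (e *\<^sub>R \<xi>))" for \<xi>
  have G: "integrable lborel G"
    unfolding G_def using lborel_integrable_affine[OF integrable_gauss, of e 0] e by simp
  define F where "F = (\<lambda>(\<xi>, y). cis ((x - y) \<bullet> \<xi>) * (G \<xi> * u y))"
  have F: "integrable (lborel \<Otimes>\<^sub>M lborel) F"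
  proof -
    have "integrable lborel (\<lambda>z. (case z of (\<xi>, y) \<Rightarrow> cis ((x - y) \<bullet> \<xi>)) * (case z of (\<xi>, y) \<Rightarrow> G \<xi> * u y))"
      using integrable_pair_mult[OF G u]
      by (intro integrable_mult_bounded_continuous[where B = 1])
        (auto simp: lborel_prod case_prod_unfold intro!: continuous_intros)
    then show ?thesis by (simp add: F_def lborel_prod case_prod_unfold)
  qed
  have inner: "(LINT \<xi>|lborel. F (\<xi>, y)) = u y * complex_of_real (2 * pi / e\<^sup>2 * gauss ((1/e) *\<^sub>R (x - y)))" for y
  proof -
    have m: "(\<lambda>\<zeta>. cis (((1/e) *\<^sub>R (x - y)) \<bullet> \<zeta>) * complex_of_real (gauss \<zeta>)) \<in> borel_measurable borel"
      by (intro borel_measurable_continuous_onI continuous_intros)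
    have "(LINT \<xi>|lborel. F (\<xi>, y)) = u y * (LINT \<xi>|lborel. cis (((1/e) *\<^sub>R (x - y)) \<bullet> (0 + e *\<^sub>R \<xi>)) * complex_of_real (gauss (0 + e *\<^sub>R \<xi>)))"
      using e by (simp add: F_def G_def mult_ac flip: integral_mult_right_zero)
    also have "(LINT \<xi>|lborel. cis (((1/e) *\<^sub>R (x - y)) \<bullet> (0 + e *\<^sub>R \<xi>)) * complex_of_real (gauss (0 + e *\<^sub>R \<xi>)))
       = (1 / \<bar>e\<bar>\<^sup>2) *\<^sub>R complex_of_real (2 * pi * gauss ((1/e) *\<^sub>R (x - y)))"
      by (subst lborel_integral_affine[OF m]) (use e in \<open>auto simp only: integral_cis_gauss DIM_prod DIM_real one_add_one\<close>)
    finally show ?thesis by (simp add: scaleR_conv_of_real)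
  qed
  have "(LINT \<xi>|lborel. cis (x \<bullet> \<xi>) * fourier u \<xi> * complex_of_real (2 * pi * gauss (e *\<^sub>R \<xi>)))
      = 2 * pi * (LINT \<xi>|lborel. LINT y|lborel. F (\<xi>, y))"
  proof -
    have "cis (x \<bullet> \<xi>) * fourier u \<xi> * complex_of_real (2 * pi * gauss (e *\<^sub>R \<xi>)) = 2 * pi * (LINT y|lborel. F (\<xi>, y))" for \<xi>
    proof -
      have "cis ((x - y) \<bullet> \<xi>) = cis (x \<bullet> \<xi>) * cis (- (y \<bullet> \<xi>))" for y
        by (simp add: cis_mult inner_diff_left)
      then have eq: "cis (x \<bullet> \<xi>) * (cis (- (y \<bullet> \<xi>)) * u y) * complex_of_real (2 * pi * gauss (e *\<^sub>R \<xi>)) = 2 * pi * F (\<xi>, y)" for y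
        by (simp add: F_def G_def mult_ac)
      then show ?thesis
        unfolding fourier_def
        by (simp only: integral_mult_right_zero[symmetric] integral_mult_left_zero[symmetric] eq)
    qed
    then show ?thesis by (simp only: integral_mult_right_zero)
  qed
  also have "(LINT \<xi>|lborel. LINT y|lborel. F (\<xi>, y)) = (LINT y|lborel. LINT \<xi>|lborel. F (\<xi>, y))"
    using F lborel_pair.Fubini_integral[of "\<lambda>\<xi> y. F (\<xi>, y)"] by simp
  also have "\<dots> = (LINT y|lborel. u y * complex_of_real (2 * pi / e\<^sup>2 * gauss ((1/e) *\<^sub>R (x - y))))"
    by (simp only: inner)
  also have "\<dots> = e\<^sup>2 *\<^sub>R (LINT z|lborel. u (x + (- e) *\<^sub>R z) * complex_of_real (2 * pi / e\<^sup>2 * gauss ((1/e) *\<^sub>R (x - (x + (-e) *\<^sub>R z)))))"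
    by (subst lborel_integral_affine[of "\<lambda>y. u y * complex_of_real (2 * pi / e\<^sup>2 * gauss ((1/e) *\<^sub>R (x - y)))"])
      (use e in \<open>auto simp: power2_eq_square\<close>)
  also have "\<dots> = 2 * pi * (LINT z|lborel. u (x - e *\<^sub>R z) * complex_of_real (gauss z))"
    using e by (simp add: scaleR_conv_of_real power2_eq_square flip: integral_mult_right_zero) (simp add: field_simps)
  finally show ?thesis by (simp add: power2_eq_square)
qed

text \<open>
  Damping the inversion integral by \<open>2 \<pi> gauss (e \<xi>)\<close> turns it into an average of \<open>u\<close> against a
  Gaussian of width \<open>e\<close> about \<open>x\<close>; both sides converge as \<open>e\<close> tends to \<open>0\<close>.
\<close>

lemma fourier_inversion:
  assumes u: "integrable lborel u" and cont: "continuous_on UNIV u" and bd: "\<And>x. norm (u x) \<le> B"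
    and fu: "integrable lborel (fourier u)"
  shows "fourier_inv (fourier u) x = u x"
proof -
  define e where "e n = 1 / real (Suc n)" for n
  let ?F = "\<lambda>n \<xi>. cis (x \<bullet> \<xi>) * fourier u \<xi> * complex_of_real (2 * pi * gauss (e n *\<^sub>R \<xi>))"
  have e_pos: "0 < e n" for n by (simp add: e_def)
  have e_lim: "e \<longlonglongrightarrow> 0" unfolding e_def using LIMSEQ_inverse_real_of_nat by (simp add: inverse_eq_divide)
  have [measurable]: "u \<in> borel_measurable borel" "fourier u \<in> borel_measurable borel" using u fu by auto
  have [measurable]: "(\<lambda>y. cis (x \<bullet> y)) \<in> borel_measurable borel"
    by (intro borel_measurable_continuous_onI continuous_intros)
  have "(\<lambda>n. LINT \<xi>|lborel. ?F n \<xi>)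
      \<longlonglongrightarrow> (LINT \<xi>|lborel. cis (x \<bullet> \<xi>) * fourier u \<xi>)"
  proof (rule integral_dominated_convergence[where w = "\<lambda>\<xi>. norm (fourier u \<xi>)"])
    have "(\<lambda>n. ?F n \<xi>)
        \<longlonglongrightarrow> cis (x \<bullet> \<xi>) * fourier u \<xi> * complex_of_real (2 * pi * gauss (0 *\<^sub>R \<xi>))" for \<xi>
      by (intro tendsto_intros e_lim) (use continuous_on_tendsto_compose[OF continuous_on_gauss[OF continuous_on_id, of UNIV] tendsto_scaleR[OF e_lim tendsto_const]] in auto)
    then show "AE \<xi> in lborel. (\<lambda>n. ?F n \<xi>)
        \<longlonglongrightarrow> cis (x \<bullet> \<xi>) * fourier u \<xi>"
      by (simp add: gauss_eq)
    have "norm (?F n \<xi>) \<le> norm (fourier u \<xi>)" for n \<xi>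
    proof -
      have "norm (?F n \<xi>) =
          norm (fourier u \<xi>) * (2 * pi * gauss (e n *\<^sub>R \<xi>))"
        using gauss_bounds(1)[of "e n *\<^sub>R \<xi>"] by (simp add: norm_mult)
      also have "\<dots> \<le> norm (fourier u \<xi>) * 1"
        by (intro mult_left_mono gauss_bounds) auto
      finally show ?thesis by simp
    qed
    then show "AE \<xi> in lborel. norm (?F n \<xi>) \<le> norm (fourier u \<xi>)" for n
      by simp
  qed (use fu in auto)
  then have "(\<lambda>n. complex_of_real (1 / (2 * pi)\<^sup>2) * (LINT \<xi>|lborel. ?F n \<xi>))
      \<longlonglongrightarrow> fourier_inv (fourier u) x"
    unfolding fourier_inv_def by (intro tendsto_mult tendsto_const)
  then have lim1: "(\<lambda>n. LINT z|lborel. u (x - e n *\<^sub>R z) * complex_of_real (gauss z)) \<longlonglongrightarrow> fourier_inv (fourier u) x"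
    by (simp only: integral_gauss_average[OF u e_pos])
  have "(\<lambda>n. LINT z|lborel. u (x - e n *\<^sub>R z) * complex_of_real (gauss z)) \<longlonglongrightarrow>
     (LINT z|lborel. u x * complex_of_real (gauss z))"
  proof (rule integral_dominated_convergence[where w = "\<lambda>z. B * norm (complex_of_real (gauss z))"])
    show "integrable lborel (\<lambda>z. B * norm (complex_of_real (gauss z)))"
      using integrable_gauss by (intro integrable_mult_right integrable_norm)
    have "(\<lambda>n. u (x - e n *\<^sub>R z) * complex_of_real (gauss z)) \<longlonglongrightarrow> u (x - 0 *\<^sub>R z) * complex_of_real (gauss z)" for z
      by (intro tendsto_intros continuous_on_tendsto_compose[OF cont] e_lim) auto
    then show "AE z in lborel. (\<lambda>n. u (x - e n *\<^sub>R z) * complex_of_real (gauss z)) \<longlonglongrightarrow> u x * complex_of_real (gauss z)"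
      by simp
    show "AE z in lborel. norm (u (x - e n *\<^sub>R z) * complex_of_real (gauss z)) \<le> B * norm (complex_of_real (gauss z))" for n
      unfolding norm_mult by (intro always_eventually allI mult_right_mono bd norm_ge_zero)
  qed auto
  also have "(LINT z|lborel. u x * complex_of_real (gauss z)) = u x"
    using integral_cis_gauss[of 0] by (simp add: gauss_eq)
  finally show ?thesis using lim1 LIMSEQ_unique by blast
qed

text \<open>
  Fubini alone turns a multiplier into a convolution: the composition is a double integral in which
  the frequency variable can be integrated out first.
\<close>

lemma fourier_mult_fourier_inv:
  fixes m \<phi> :: "real \<times> real \<Rightarrow> complex"
  assumes m: "integrable lborel m" and \<phi>: "integrable lborel \<phi>"
  shows "fourier (\<lambda>\<xi>. m \<xi> * fourier_inv \<phi> \<xi>) x =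
    (LINT y|lborel. \<phi> y * (complex_of_real (1 / (2 * pi)\<^sup>2) * fourier m (x - y)))"
proof -
  define c where "c = complex_of_real (1 / (2 * pi)\<^sup>2)"
  define F where "F = (\<lambda>(\<xi>, y). (c * cis ((y - x) \<bullet> \<xi>)) * (m \<xi> * \<phi> y))"
  have F: "integrable (lborel \<Otimes>\<^sub>M lborel) F"
  proof -
    have "integrable lborel (\<lambda>z. (case z of (\<xi>, y) \<Rightarrow> c * cis ((y - x) \<bullet> \<xi>)) * (case z of (\<xi>, y) \<Rightarrow> m \<xi> * \<phi> y))"
      using integrable_pair_mult[OF m \<phi>]
      by (intro integrable_mult_bounded_continuous[where B = "norm c"])
        (auto simp: lborel_prod case_prod_unfold norm_mult intro!: continuous_intros)
    then show ?thesis by (simp add: F_def lborel_prod case_prod_unfold)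
  qed
  have "fourier (\<lambda>\<xi>. m \<xi> * fourier_inv \<phi> \<xi>) x = (LINT \<xi>|lborel. LINT y|lborel. F (\<xi>, y))"
  proof -
    have "cis ((y - x) \<bullet> \<xi>) = cis (- (x \<bullet> \<xi>)) * cis (\<xi> \<bullet> y)" for \<xi> y
      by (simp add: cis_mult inner_diff_left inner_diff_right inner_commute)
    then have "cis (- (\<xi> \<bullet> x)) * (m \<xi> * (c * (cis (\<xi> \<bullet> y) * \<phi> y))) = F (\<xi>, y)" for \<xi> y
      by (simp add: F_def mult_ac inner_commute)
    then show ?thesis
      unfolding fourier_def fourier_inv_def c_def[symmetric] by (simp flip: integral_mult_right_zero)
  qed
  also have "\<dots> = (LINT y|lborel. LINT \<xi>|lborel. F (\<xi>, y))"
    using F lborel_pair.Fubini_integral[of "\<lambda>\<xi> y. F (\<xi>, y)"] by simp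
  also have "\<dots> = (LINT y|lborel. \<phi> y * (c * fourier m (x - y)))"
    unfolding fourier_def F_def c_def[symmetric]
    by (simp add: inner_diff_left inner_diff_right inner_commute mult_ac flip: integral_mult_right_zero)
  finally show ?thesis by (simp add: c_def)
qed

section \<open>The low-frequency cutoff and its kernel\<close>

text \<open>
  The multiplier of the zeroth block is \<^term>\<open>cutoff w (norm \<xi>)\<close>, and that of each later block is a
  difference of two dilates of it, so all kernels that occur arise from a single one.
\<close>

definition cutoff :: "(real \<Rightarrow> real) \<Rightarrow> real \<Rightarrow> real" where
  "cutoff w r = (if r \<le> 1 then 1 else w r)"

lemma lp_window_differentiable: "lp_window w \<Longrightarrow> (deriv ^^ n) w differentiable (at s)"
  by (auto simp: lp_window_def)

lemma lp_window_continuous: "lp_window w \<Longrightarrow> isCont w s"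
  using lp_window_differentiable[of w 0 s] by (auto intro: differentiable_imp_continuous_within)

lemma lp_window_eq_0:
  assumes w: "lp_window w" and s: "s \<le> 1/2 \<or> 2 \<le> s"
  shows "w s = 0"
proof -
  have zero: "w r = 0" if "r < 1/2 \<or> 2 < r" for r
  proof (rule ccontr)
    assume "w r \<noteq> 0"
    then have "r \<in> closure {s. w s \<noteq> 0}" using closure_subset[of "{s. w s \<noteq> 0}"] by auto
    then have "r \<in> {1/2..2}" using w by (auto simp: lp_window_def)
    with that show False by auto
  qed
  \<comment> \<open>The support condition leaves open the two endpoints, where continuity decides.\<close>
  have "w (1/2) = 0"
  proof (rule tendsto_unique[of "at_left (1/2)" w])
    show "(w \<longlongrightarrow> w (1/2)) (at_left (1/2))"
      using lp_window_continuous[OF w, of "1/2"] by (simp add: isCont_def filterlim_at_split)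
    show "(w \<longlongrightarrow> 0) (at_left (1/2))"
      by (rule tendsto_eventually) (auto simp: eventually_at_filter zero)
  qed auto
  moreover have "w 2 = 0"
  proof (rule tendsto_unique[of "at_right 2" w])
    show "(w \<longlongrightarrow> w 2) (at_right 2)"
      using lp_window_continuous[OF w, of 2] by (simp add: isCont_def filterlim_at_split)
    show "(w \<longlongrightarrow> 0) (at_right 2)"
      by (rule tendsto_eventually) (auto simp: eventually_at_filter zero)
  qed auto
  ultimately show ?thesis using zero s by (metis less_eq_real_def)
qed

lemma lp_window_partition: "lp_window w \<Longrightarrow> 1 \<le> s \<Longrightarrow> s \<le> 2 \<Longrightarrow> w s = 1 - w (s / 2)"
  by (auto simp: lp_window_def)

lemma cutoff_eq_0: "lp_window w \<Longrightarrow> 2 \<le> r \<Longrightarrow> cutoff w r = 0"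
  by (simp add: cutoff_def lp_window_eq_0)

text \<open>
  The partition property of the window in the form that makes sums of multipliers telescope.
\<close>

lemma window_eq_cutoff_diff:
  assumes "lp_window w"
  shows "w r = cutoff w r - cutoff w (2 * r)"
  using lp_window_eq_0[OF assms, of r] lp_window_eq_0[OF assms, of "2 * r"]
    lp_window_partition[OF assms, of "2 * r"]
  by (auto simp: cutoff_def)

lemma cutoff_below_2: "lp_window w \<Longrightarrow> r < 2 \<Longrightarrow> cutoff w r = 1 - w (r / 2)"
  using lp_window_eq_0[of w "r / 2"] lp_window_partition[of w r] by (auto simp: cutoff_def)

lemma lp_window_half_derivative:
  assumes "lp_window w"
  shows "((\<lambda>r. (deriv ^^ n) w (r / 2)) has_real_derivative (deriv ^^ Suc n) w (r / 2) / 2) (at r)"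
proof -
  have "((deriv ^^ n) w has_real_derivative (deriv ^^ Suc n) w s) (at s)" for s
    using lp_window_differentiable[OF assms, of n s] DERIV_deriv_iff_real_differentiable by auto
  moreover have "((\<lambda>r. r / 2) has_real_derivative 1 / 2) (at r)"
    by (auto intro!: derivative_eq_intros)
  ultimately show ?thesis using DERIV_chain2[of "(deriv ^^ n) w" _ "\<lambda>r. r / 2" r "1 / 2" UNIV] by simp
qed

lemma higher_deriv_one_minus_half:
  assumes w: "lp_window w"
  shows "(deriv ^^ n) (\<lambda>r. 1 - w (r / 2)) = (\<lambda>r. (if n = 0 then 1 else 0) - (1/2) ^ n * (deriv ^^ n) w (r / 2))"
proof (induction n)
  case (Suc n)
  have "((\<lambda>r. (if n = 0 then 1 else 0) - (1/2) ^ n * (deriv ^^ n) w (r / 2)) has_real_derivative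
      0 - (1/2) ^ n * ((deriv ^^ Suc n) w (r / 2) / 2)) (at r)" for r
    by (intro DERIV_diff DERIV_const DERIV_cmult lp_window_half_derivative w)
  then show ?case by (auto simp: Suc fun_eq_iff intro!: DERIV_imp_deriv[THEN trans])
qed auto

text \<open>
  The cutoff is given by two formulas. Below \<open>2\<close> it is \<open>1 - w (r / 2)\<close>, by the partition property on
  \<open>[1, 2]\<close>, and above \<open>1\<close> it is \<open>w r\<close>. The two half-lines overlap, so smoothness is inherited from \<open>w\<close>.
\<close>

lemma cutoff_higher_deriv:
  assumes w: "lp_window w"
  shows "((deriv ^^ n) (cutoff w) has_real_derivative (deriv ^^ Suc n) (cutoff w) x) (at x)"
proof -
  have "(deriv ^^ n) (cutoff w) differentiable (at x)"
  proof (cases "x < 2")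
    case True
    have ev: "\<forall>\<^sub>F r in nhds y. cutoff w r = 1 - w (r / 2)" if "y < 2" for y
      using eventually_nhds_in_open[of "{..<2}" y] that
      by (auto elim!: eventually_mono simp: cutoff_below_2[OF w])
    have "\<forall>\<^sub>F r in nhds x. (deriv ^^ n) (cutoff w) r = (deriv ^^ n) (\<lambda>r. 1 - w (r / 2)) r"
      using eventually_nhds_in_open[of "{..<2}" x] True
      by (auto elim!: eventually_mono intro!: higher_deriv_cong_ev ev)
    moreover have "((deriv ^^ n) (\<lambda>r. 1 - w (r / 2)) has_real_derivative
      0 - (1/2) ^ n * ((deriv ^^ Suc n) w (x / 2) / 2)) (at x)"
      unfolding higher_deriv_one_minus_half[OF w]
      by (intro DERIV_diff DERIV_const DERIV_cmult lp_window_half_derivative w)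
    ultimately show ?thesis
      using DERIV_cong_ev[OF refl _ refl, THEN iffD2] real_differentiable_def by blast
  next
    case False
    have ev: "\<forall>\<^sub>F r in nhds y. cutoff w r = w r" if "1 < y" for y
      using eventually_nhds_in_open[of "{1<..}" y] that
      by (auto elim!: eventually_mono simp: cutoff_def)
    have "\<forall>\<^sub>F r in nhds x. (deriv ^^ n) (cutoff w) r = (deriv ^^ n) w r"
      using eventually_nhds_in_open[of "{1<..}" x] False
      by (auto elim!: eventually_mono intro!: higher_deriv_cong_ev ev)
    then show ?thesis
      using DERIV_cong_ev[OF refl _ refl, THEN iffD2] lp_window_differentiable[OF w, of n x] real_differentiable_def
      by blast
  qed
  then show ?thesis using DERIV_deriv_iff_real_differentiable by auto
qed

lemma cutoff_higher_deriv_isCont: "lp_window w \<Longrightarrow> isCont ((deriv ^^ n) (cutoff w)) x"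
  using cutoff_higher_deriv DERIV_isCont by blast

lemma cutoff_higher_deriv_below_1:
  assumes "r < 1"
  shows "(deriv ^^ n) (cutoff w) r = (if n = 0 then 1 else 0)"
proof -
  have "(deriv ^^ n) (cutoff w) r = (deriv ^^ n) (\<lambda>_. 1) r"
    using eventually_nhds_in_open[of "{..<1}" r] assms
    by (auto elim!: eventually_mono intro!: higher_deriv_cong_ev simp: cutoff_def)
  also have "(deriv ^^ n) (\<lambda>_. 1 :: real) = (\<lambda>_. if n = 0 then 1 else 0)"
    by (induction n) auto
  finally show ?thesis by simp
qed

lemma cutoff_higher_deriv_above_2:
  assumes "lp_window w" "2 < r"
  shows "(deriv ^^ n) (cutoff w) r = 0"
proof -
  have "(deriv ^^ n) (cutoff w) r = (deriv ^^ n) (\<lambda>_. 0) r"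
    using eventually_nhds_in_open[of "{2<..}" r] assms
    by (auto elim!: eventually_mono intro!: higher_deriv_cong_ev simp: cutoff_eq_0)
  also have "(deriv ^^ n) (\<lambda>_. 0 :: real) = (\<lambda>_. 0)" by (induction n) auto
  finally show ?thesis by simp
qed

text \<open>
  Iterated partial derivatives of \<open>cutoff \<bar>\<xi>\<bar>\<close>, multiplied by coordinates, are combinations of
  these functions. When \<open>b \<ge> 1\<close> the derivative of the cutoff vanishes near \<open>0\<close>, so the negative
  power of the norm is harmless; when \<open>b = 0\<close> only \<open>c = 0\<close> is of interest.
\<close>

definition radial_term :: "(real \<Rightarrow> real) \<Rightarrow> nat \<Rightarrow> nat \<Rightarrow> nat \<Rightarrow> nat \<Rightarrow> real \<times> real \<Rightarrow> complex" where
  "radial_term w a e c b \<xi> = complex_of_real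
     (fst \<xi> ^ a * snd \<xi> ^ e * inverse (norm \<xi>) ^ c * (deriv ^^ b) (cutoff w) (norm \<xi>))"

lemma radial_term_near_0:
  assumes "c = 0 \<or> 1 \<le> b" "norm \<xi> < 1"
  shows "radial_term w a e c b \<xi> = (if b = 0 then complex_of_real (fst \<xi> ^ a * snd \<xi> ^ e) else 0)"
  using assms by (auto simp: radial_term_def cutoff_higher_deriv_below_1)

lemma radial_term_eq_0: "lp_window w \<Longrightarrow> 2 < norm \<xi> \<Longrightarrow> radial_term w a e c b \<xi> = 0"
  by (simp add: radial_term_def cutoff_higher_deriv_above_2)

lemma continuous_on_radial_term:
  assumes w: "lp_window w" and cb: "c = 0 \<or> 1 \<le> b"
  shows "continuous_on UNIV (radial_term w a e c b)"
proof (rule continuous_at_imp_continuous_on, intro ballI)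
  fix \<xi> :: "real \<times> real"
  show "isCont (radial_term w a e c b) \<xi>"
  proof (cases "norm \<xi> < 1")
    case True
    then have "\<forall>\<^sub>F \<zeta> in nhds \<xi>. norm \<zeta> < 1"
      using eventually_nhds_in_open[of "ball 0 1" \<xi>] by simp
    then have "\<forall>\<^sub>F \<zeta> in nhds \<xi>. radial_term w a e c b \<zeta> = (if b = 0 then complex_of_real (fst \<zeta> ^ a * snd \<zeta> ^ e) else 0)"
      by eventually_elim (rule radial_term_near_0[OF cb])
    then have "isCont (radial_term w a e c b) \<xi> \<longleftrightarrow>
        isCont (\<lambda>\<zeta>. if b = 0 then complex_of_real (fst \<zeta> ^ a * snd \<zeta> ^ e) else 0) \<xi>"
      by (rule isCont_cong)
    then show ?thesis by (cases "b = 0") (auto intro!: continuous_intros)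
  next
    case False
    then have "norm \<xi> \<noteq> 0" by auto
    then show ?thesis
      unfolding radial_term_def[abs_def]
      by (intro continuous_intros isCont_o2[OF _ cutoff_higher_deriv_isCont[OF w]]) auto
  qed
qed

lemma integrable_compact_support:
  fixes f :: "'a::euclidean_space \<Rightarrow> complex"
  assumes f: "continuous_on UNIV f" "\<And>x. R < norm x \<Longrightarrow> f x = 0"
  shows "integrable lborel f"
proof -
  have "integrable lborel (\<lambda>x. indicator (cball 0 R) x *\<^sub>R f x)"
    by (rule borel_integrable_compact) (auto intro: continuous_on_subset[OF f(1)])
  also have "(\<lambda>x. indicator (cball 0 R) x *\<^sub>R f x) = f"
    using f(2) by (auto simp: indicator_def fun_eq_iff not_le)
  finally show ?thesis .
qed

lemma bounded_compact_support:
  fixes f :: "'a::euclidean_space \<Rightarrow> complex"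
  assumes f: "continuous_on UNIV f" "\<And>x. R < norm x \<Longrightarrow> f x = 0"
  obtains B where "\<And>x. norm (f x) \<le> B"
proof -
  have "bounded (f ` cball 0 R)"
    by (rule compact_imp_bounded[OF compact_continuous_image[OF continuous_on_subset[OF f(1) subset_UNIV] compact_cball]])
  then obtain B where B: "\<forall>z\<in>f ` cball 0 R. norm z \<le> B"
    unfolding bounded_iff by (elim exE)
  have "norm (f x) \<le> max B 0" for x
  proof (cases "R < norm x")
    case False
    then have "norm (f x) \<le> B" by (intro bspec[OF B] imageI) simp
    then show ?thesis by simp
  qed (simp add: f)
  then show thesis by (rule that)
qed

lemma integrable_radial_term:
  assumes "lp_window w" "c = 0 \<or> 1 \<le> b"
  shows "integrable lborel (radial_term w a e c b)"
  using integrable_compact_support[OF continuous_on_radial_term[OF assms], of 2] radial_term_eq_0[OF assms(1)] by blast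

lemma radial_term_derivative:
  assumes w: "lp_window w" and cb: "c = 0 \<or> 1 \<le> b"
  shows "((\<lambda>x. radial_term w a e c b (x, y)) has_vector_derivative
      of_nat a * radial_term w (a - 1) e c b (x, y)
    - of_nat c * radial_term w (a + 1) e (c + 2) b (x, y)
    + radial_term w (a + 1) e (c + 1) (b + 1) (x, y)) (at x)"
proof (cases "norm (x, y) < 1")
  case True
  let ?p = "\<lambda>z. if b = 0 then complex_of_real (z ^ a * y ^ e) else 0"
  let ?d = "if b = 0 then complex_of_real (a * x ^ (a - 1) * y ^ e) else 0"
  have "open ((\<lambda>x. norm (x, y)) -` {..<1})"
    by (rule open_vimage) (auto intro!: continuous_intros)
  then have "\<forall>\<^sub>F z in nhds x. norm (z, y) < 1"
    using eventually_nhds_in_open[of "(\<lambda>x. norm (x, y)) -` {..<1}" x] True by simp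
  then have ev: "\<forall>\<^sub>F z in nhds x. radial_term w a e c b (z, y) = ?p z"
    by eventually_elim (simp add: radial_term_near_0[OF cb])
  have "(?p has_vector_derivative
      ?d) (at x)"
  proof (cases "b = 0")
    case True
    have "((\<lambda>z. z ^ a * y ^ e) has_real_derivative a * x ^ (a - 1) * y ^ e) (at x)"
      by (auto intro!: derivative_eq_intros)
    from has_vector_derivative_of_real[OF this] True
    show ?thesis by simp
  qed simp
  moreover have ev': "\<forall>\<^sub>F z in nhds x. z \<in> UNIV \<longrightarrow> radial_term w a e c b (z, y) = ?p z"
    using ev by simp
  have "radial_term w a e c b (x, y) = (if b = 0 then complex_of_real (x ^ a * y ^ e) else 0)"
    using radial_term_near_0[OF cb True] by simp
  from has_vector_derivative_cong_ev[OF ev' this]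
  have "((\<lambda>x. radial_term w a e c b (x, y)) has_vector_derivative
      ?d) (at x) \<longleftrightarrow>
    (?p has_vector_derivative
      ?d) (at x)" by simp
  ultimately have "((\<lambda>x. radial_term w a e c b (x, y)) has_vector_derivative
      ?d) (at x)" by blast
  moreover have "of_nat c * radial_term w (a + 1) e (c + 2) b (x, y) = 0"
    using cb radial_term_near_0[of "c + 2" b "(x, y)"] True by (cases "c = 0") auto
  ultimately show ?thesis
    using True cb by (cases "b = 0") (auto simp: radial_term_near_0 mult.assoc)
next
  case False
  then have n: "norm (x, y) \<noteq> 0" by auto
  then have pos: "0 < x\<^sup>2 + y\<^sup>2" by (auto simp: norm_prod_def sum_power2_gt_zero_iff)
  let ?n = "norm (x, y)" and ?V = "\<lambda>b. (deriv ^^ b) (cutoff w)"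
  have dn: "((\<lambda>x. norm (x, y)) has_real_derivative x / ?n) (at x)"
    unfolding norm_prod_def using pos
    by (auto intro!: derivative_eq_intros simp: field_simps)
  have dV: "((\<lambda>x. ?V b (norm (x, y))) has_real_derivative ?V (Suc b) ?n * (x / ?n)) (at x)"
    by (rule DERIV_chain2[OF cutoff_higher_deriv[OF w] dn])
  have di: "((\<lambda>x. inverse (norm (x, y)) ^ c) has_real_derivative - (real c * x * inverse ?n ^ (c + 2))) (at x)"
  proof -
    have "((\<lambda>x. inverse (norm (x, y)) ^ c) has_real_derivative
        real c * inverse ?n ^ (c - 1) * (- (inverse ?n * (x / ?n) * inverse ?n))) (at x)"
      using n by (auto intro!: derivative_eq_intros dn)
    also have "real c * inverse ?n ^ (c - 1) * (- (inverse ?n * (x / ?n) * inverse ?n)) = - (real c * x * inverse ?n ^ (c + 2))"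
      by (cases c) (auto simp: field_simps power2_eq_square)
    finally show ?thesis .
  qed
  have "((\<lambda>x. x ^ a * y ^ e * inverse (norm (x, y)) ^ c * ?V b (norm (x, y))) has_real_derivative
      (real a * x ^ (a - 1) * y ^ e * inverse ?n ^ c * ?V b ?n
       - real c * (x ^ (a + 1) * y ^ e * inverse ?n ^ (c + 2) * ?V b ?n)
       + x ^ (a + 1) * y ^ e * inverse ?n ^ (c + 1) * ?V (b + 1) ?n)) (at x)"
    by (rule derivative_eq_intros dV di refl)+ (simp add: algebra_simps divide_inverse)
  from has_vector_derivative_of_real[OF this, where ?'a = complex]
  show ?thesis by (simp add: radial_term_def mult_ac)
qed

lemma integral_partial_derivative_eq_0:
  fixes F F' :: "real \<times> real \<Rightarrow> complex"
  assumes der: "\<And>x y. ((\<lambda>x. F (x, y)) has_vector_derivative F' (x, y)) (at x)"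
    and cont: "continuous_on UNIV F'"
    and supp: "\<And>z. R < norm z \<Longrightarrow> F z = 0" "\<And>z. R < norm z \<Longrightarrow> F' z = 0"
  shows "(LINT z|lborel. F' z) = 0"
proof -
  have int: "integrable lborel F'" by (rule integrable_compact_support[OF cont supp(2)])
  define S where "S = \<bar>R\<bar> + 1"
  have S: "R < norm (x, y)" if "S \<le> \<bar>x\<bar>" for x y :: real
  proof -
    have "\<bar>x\<bar> \<le> norm (x, y)" using norm_fst_le[of x y] by simp
    then show ?thesis using that unfolding S_def by linarith
  qed
  have inner: "(LINT x|lborel. F' (x, y)) = 0" for y
  proof -
    have "has_bochner_integral lborel (\<lambda>x. indicator {- S..S} x *\<^sub>R F' (x, y)) (F (S, y) - F (- S, y))"
    proof (rule has_bochner_integral_FTC_Icc)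
      show "- S \<le> S" by (simp add: S_def)
      show "((\<lambda>x. F (x, y)) has_vector_derivative F' (x, y)) (at x within {- S..S})" for x
        using der has_vector_derivative_at_within by blast
      show "continuous_on {- S..S} (\<lambda>x. F' (x, y))"
        by (rule continuous_on_compose2[OF cont]) (auto intro!: continuous_intros)
    qed
    moreover have "(\<lambda>x. indicator {- S..S} x *\<^sub>R F' (x, y)) = (\<lambda>x. F' (x, y))"
      using S supp(2) by (fastforce simp: indicator_def)
    moreover have "F (S, y) = 0" "F (- S, y) = 0"
      using S[of S y] S[of "- S" y] supp(1) by (auto simp: S_def)
    ultimately show ?thesis by (simp add: has_bochner_integral_integral_eq)
  qed
  have "(LINT z|lborel. F' z) = (LINT y|lborel. LINT x|lborel. F' (x, y))"
    using lborel_pair.integral_snd[of "\<lambda>x y. F' (x, y)"] int by (simp add: lborel_prod)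
  then show ?thesis by (simp add: inner)
qed

text \<open>
  Integration by parts: the partial derivative of \<open>cis (- (z \<bullet> x)) * u z\<close> integrates to zero along
  each horizontal line.
\<close>

lemma fourier_partial_derivative:
  fixes u u' :: "real \<times> real \<Rightarrow> complex"
  assumes der: "\<And>x y. ((\<lambda>x. u (x, y)) has_vector_derivative u' (x, y)) (at x)"
    and cont: "continuous_on UNIV u" "continuous_on UNIV u'"
    and supp: "\<And>z. R < norm z \<Longrightarrow> u z = 0" "\<And>z. R < norm z \<Longrightarrow> u' z = 0"
  shows "fourier u' x = \<i> * complex_of_real (fst x) * fourier u x"
proof -
  let ?F = "\<lambda>z. cis (- (z \<bullet> x)) * u z"
  let ?F' = "\<lambda>z. cis (- (z \<bullet> x)) * u' z - \<i> * fst x * (cis (- (z \<bullet> x)) * u z)"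
  have "(LINT z|lborel. ?F' z) = 0"
  proof (rule integral_partial_derivative_eq_0[where F = ?F and R = R])
    fix s t
    have "((\<lambda>s. cis (- ((s, t) \<bullet> x))) has_vector_derivative
        - (fst x *\<^sub>R (\<i> * cis (- ((s, t) \<bullet> x))))) (at s)"
      unfolding has_vector_derivative_def
      by (auto intro!: derivative_eq_intros simp: inner_prod_def scaleR_conv_of_real)
    from has_vector_derivative_mult[OF this der]
    show "((\<lambda>s. ?F (s, t)) has_vector_derivative ?F' (s, t)) (at s)"
      by (simp add: scaleR_conv_of_real mult_ac)
  next
    show "continuous_on UNIV ?F'" by (intro continuous_intros cont)
  qed (use supp in auto)
  moreover have "integrable lborel u" "integrable lborel u'"
    using integrable_compact_support cont supp by blast+
  ultimately have "fourier u' x - \<i> * fst x * fourier u x = 0"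
    unfolding fourier_def
    by (subst (asm) Bochner_Integration.integral_diff) (auto intro!: integrable_cis_mult)
  then show ?thesis by simp
qed

lemma fourier_radial_term_partial:
  assumes w: "lp_window w" and cb: "c = 0 \<or> 1 \<le> b"
  shows "\<i> * complex_of_real (fst x) * fourier (radial_term w a e c b) x =
      of_nat a * fourier (radial_term w (a - 1) e c b) x
    - of_nat c * fourier (radial_term w (a + 1) e (c + 2) b) x
    + fourier (radial_term w (a + 1) e (c + 1) (b + 1)) x"
proof -
  let ?F = "\<lambda>a e c b x. fourier (radial_term w a e c b) x"
  define u2 where "u2 z = of_nat c * radial_term w (a + 1) e (c + 2) b z" for z
  let ?u' = "\<lambda>z. of_nat a * radial_term w (a - 1) e c b z - u2 z + radial_term w (a + 1) e (c + 1) (b + 1) z"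
  have u2: "continuous_on UNIV u2" "\<And>z. 2 < norm z \<Longrightarrow> u2 z = 0"
  proof -
    show "continuous_on UNIV u2"
      using cb by (cases "c = 0") (auto simp: u2_def[abs_def] intro!: continuous_intros continuous_on_radial_term[OF w])
    show "u2 z = 0" if "2 < norm z" for z using radial_term_eq_0[OF w that] by (simp add: u2_def)
  qed
  have "fourier ?u' x = \<i> * complex_of_real (fst x) * ?F a e c b x"
  proof (rule fourier_partial_derivative[where R = 2])
    show "((\<lambda>x. radial_term w a e c b (x, y)) has_vector_derivative ?u' (x, y)) (at x)" for x y
      using radial_term_derivative[OF w cb] by (simp add: u2_def)
    show "continuous_on UNIV (radial_term w a e c b)" by (rule continuous_on_radial_term[OF w cb])
    show "continuous_on UNIV ?u'"
      by (intro continuous_intros u2 continuous_on_radial_term[OF w]) (use cb in auto)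
  qed (use radial_term_eq_0[OF w] u2 in auto)
  moreover have "fourier ?u' x = of_nat a * ?F (a - 1) e c b x - fourier u2 x
      + ?F (a + 1) e (c + 1) (b + 1) x"
  proof -
    have i: "integrable lborel (\<lambda>y. cis (- (y \<bullet> x)) * radial_term w (a - 1) e c b y)"
      "integrable lborel (\<lambda>y. cis (- (y \<bullet> x)) * u2 y)"
      "integrable lborel (\<lambda>y. cis (- (y \<bullet> x)) * radial_term w (a + 1) e (c + 1) (b + 1) y)"
      using cb integrable_compact_support[OF u2]
      by (auto intro!: integrable_cis_mult integrable_radial_term[OF w])
    have "fourier ?u' x = (LINT y|lborel. of_nat a * (cis (- (y \<bullet> x)) * radial_term w (a - 1) e c b y)
       - cis (- (y \<bullet> x)) * u2 y + cis (- (y \<bullet> x)) * radial_term w (a + 1) e (c + 1) (b + 1) y)"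
      unfolding fourier_def by (intro Bochner_Integration.integral_cong) (auto simp: algebra_simps)
    also have "\<dots> = of_nat a * ?F (a - 1) e c b x - fourier u2 x
      + ?F (a + 1) e (c + 1) (b + 1) x"
      unfolding fourier_def using i by simp
    finally show ?thesis .
  qed
  moreover have "fourier u2 x = of_nat c * ?F (a + 1) e (c + 2) b x"
    unfolding fourier_def u2_def by (simp add: mult.left_commute)
  ultimately show ?thesis by simp
qed

text \<open>
  Each factor \<open>fst x\<close> is traded for a derivative. The class of radial terms is closed under
  this derivative, so the induction generalises over all exponents.
\<close>

lemma fourier_radial_term_decay_fst:
  assumes w: "lp_window w" and "c = 0 \<or> 1 \<le> b"
  shows "\<exists>B. \<forall>x. \<bar>fst x\<bar> ^ N * norm (fourier (radial_term w a e c b) x) \<le> B"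
  using assms(2)
proof (induction N arbitrary: a e c b)
  case 0
  show ?case
    by (intro exI[of _ "LINT y|lborel. norm (radial_term w a e c b y)"] allI)
      (simp add: norm_fourier_le[OF integrable_radial_term[OF w 0]])
next
  case (Suc N)
  let ?F = "\<lambda>a e c b x. fourier (radial_term w a e c b) x"
  obtain B1 where B1: "\<And>x. \<bar>fst x\<bar> ^ N * norm (?F (a - 1) e c b x) \<le> B1"
    using Suc.IH[OF Suc.prems] by blast
  obtain B2 where B2: "\<And>x. \<bar>fst x\<bar> ^ N * norm (of_nat c * ?F (a + 1) e (c + 2) b x) \<le> B2"
  proof (cases "c = 0")
    case True
    then show thesis by (intro that[of 0]) auto
  next
    case False
    then obtain B where B: "\<And>x. \<bar>fst x\<bar> ^ N * norm (?F (a + 1) e (c + 2) b x) \<le> B"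
      using Suc.IH[of "c + 2" b "a + 1" e] Suc.prems by blast
    have "\<bar>fst x\<bar> ^ N * norm (of_nat c * ?F (a + 1) e (c + 2) b x) \<le> c * B" for x
      using mult_left_mono[OF B[of x], of "real c"] by (simp add: norm_mult mult_ac)
    then show thesis by (rule that)
  qed
  obtain B3 where B3: "\<And>x. \<bar>fst x\<bar> ^ N * norm (?F (a + 1) e (c + 1) (b + 1) x) \<le> B3"
  proof -
    have "c + 1 = 0 \<or> 1 \<le> b + 1" by simp
    from Suc.IH[OF this, of "a + 1" e] show thesis using that by blast
  qed
  have "\<bar>fst x\<bar> ^ Suc N * norm (?F a e c b x) \<le> a * B1 + B2 + B3" for x
  proof -
    have "\<bar>fst x\<bar> ^ Suc N * norm (?F a e c b x) =
        \<bar>fst x\<bar> ^ N * norm (\<i> * complex_of_real (fst x) * ?F a e c b x)"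
      by (simp add: norm_mult)
    also have "norm (\<i> * complex_of_real (fst x) * ?F a e c b x) \<le>
        real a * norm (?F (a - 1) e c b x)
      + norm (of_nat c * ?F (a + 1) e (c + 2) b x)
      + norm (?F (a + 1) e (c + 1) (b + 1) x)"
      unfolding fourier_radial_term_partial[OF w Suc.prems]
      by (intro order_trans[OF norm_triangle_ineq] add_mono order_trans[OF norm_triangle_ineq4] order_refl)
        (simp add: norm_mult)
    then have "\<bar>fst x\<bar> ^ N * norm (\<i> * complex_of_real (fst x) * ?F a e c b x) \<le>
      \<bar>fst x\<bar> ^ N * (real a * norm (?F (a - 1) e c b x)
      + norm (of_nat c * ?F (a + 1) e (c + 2) b x)
      + norm (?F (a + 1) e (c + 1) (b + 1) x))"
      by (rule mult_left_mono) auto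
    also have "\<dots> \<le> a * B1 + B2 + B3"
      using mult_left_mono[OF B1[of x], of "real a"] B2[of x] B3[of x] by (simp add: algebra_simps)
    finally show ?thesis .
  qed
  then show ?case by blast
qed

text \<open>
  Exchanging the coordinates exchanges the first two exponents, which transfers the decay from the
  first coordinate to the second.
\<close>

lemma fourier_radial_term_swap:
  assumes "lp_window w" "c = 0 \<or> 1 \<le> b"
  shows "fourier (radial_term w a e c b) (prod.swap x) = fourier (radial_term w e a c b) x"
proof -
  let ?F = "\<lambda>z. cis (- (z \<bullet> x)) * radial_term w e a c b z"
  have "integrable lborel ?F"
    using integrable_cis_mult(4)[OF integrable_radial_term[OF assms]] .
  then have "?F \<in> borel_measurable (lborel \<Otimes>\<^sub>M lborel)" by (simp add: lborel_prod)
  from lborel_pair.integral_product_swap[OF this]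
  have "(LINT z|lborel. ?F (prod.swap z)) = (LINT z|lborel. ?F z)"
    by (simp add: lborel_prod case_prod_unfold prod.swap_def)
  then show ?thesis
    by (simp add: fourier_def radial_term_def norm_prod_def inner_prod_def add.commute mult_ac prod.swap_def)
qed

definition rapidly_decreasing :: "('a::real_normed_vector \<Rightarrow> complex) \<Rightarrow> bool" where
  "rapidly_decreasing k \<longleftrightarrow> (\<forall>N. \<exists>B. \<forall>x. (1 + norm x) ^ N * norm (k x) \<le> B)"

lemma one_plus_norm_power_le:
  fixes x :: "real \<times> real"
  shows "(1 + norm x) ^ N \<le> 3 ^ N * (1 + \<bar>fst x\<bar> ^ N + \<bar>snd x\<bar> ^ N)"
proof -
  define m where "m = max 1 (max \<bar>fst x\<bar> \<bar>snd x\<bar>)"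
  have "norm x \<le> \<bar>fst x\<bar> + \<bar>snd x\<bar>" using norm_le_l1 norm_Pair_le[of "fst x" "snd x"] by simp
  then have "1 + norm x \<le> 3 * m" by (simp add: m_def)
  then have "(1 + norm x) ^ N \<le> (3 * m) ^ N" by (intro power_mono) auto
  also have "\<dots> = 3 ^ N * m ^ N" by (rule power_mult_distrib)
  also have "m ^ N \<le> 1 + \<bar>fst x\<bar> ^ N + \<bar>snd x\<bar> ^ N" by (auto simp: m_def max_def)
  finally show ?thesis by simp
qed

lemma rapidly_decreasing_fourier_radial_term:
  assumes w: "lp_window w" and cb: "c = 0 \<or> 1 \<le> b"
  shows "rapidly_decreasing (fourier (radial_term w a e c b))"
  unfolding rapidly_decreasing_def
proof
  fix N
  let ?f = "fourier (radial_term w a e c b)"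
  obtain B0 where B0: "\<And>x. \<bar>fst x\<bar> ^ 0 * norm (?f x) \<le> B0"
    using fourier_radial_term_decay_fst[OF assms, of 0] by blast
  obtain B1 where B1: "\<And>x. \<bar>fst x\<bar> ^ N * norm (?f x) \<le> B1"
    using fourier_radial_term_decay_fst[OF assms] by blast
  obtain B2 where B2: "\<And>x. \<bar>fst x\<bar> ^ N * norm (fourier (radial_term w e a c b) x) \<le> B2"
    using fourier_radial_term_decay_fst[OF assms] by blast
  have "(1 + norm x) ^ N * norm (?f x) \<le> 3 ^ N * (B0 + B1 + B2)" for x
  proof -
    have "\<bar>snd x\<bar> ^ N * norm (?f x) \<le> B2"
      using B2[of "prod.swap x"] fourier_radial_term_swap[OF assms, of e a x] by simp
    then have "(1 + \<bar>fst x\<bar> ^ N + \<bar>snd x\<bar> ^ N) * norm (?f x) \<le> B0 + B1 + B2"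
      using B0[of x] B1[of x] by (simp add: algebra_simps)
    then have le: "3 ^ N * ((1 + \<bar>fst x\<bar> ^ N + \<bar>snd x\<bar> ^ N) * norm (?f x)) \<le> 3 ^ N * (B0 + B1 + B2)"
      by (intro mult_left_mono) auto
    have "(1 + norm x) ^ N * norm (?f x) \<le> 3 ^ N * (1 + \<bar>fst x\<bar> ^ N + \<bar>snd x\<bar> ^ N) * norm (?f x)"
      by (intro mult_right_mono one_plus_norm_power_le) auto
    also note mult.assoc
    also note le
    finally show ?thesis .
  qed
  then show "\<exists>B. \<forall>x. (1 + norm x) ^ N * norm (?f x) \<le> B" by blast
qed

text \<open>
  All derivatives of integrals below are taken through an explicit quadratic remainder, which is
  uniform in the integration variable.
\<close>

lemma has_derivative_of_quadratic_remainder: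
  fixes f :: "'a::real_normed_vector \<Rightarrow> 'b::real_normed_vector"
  assumes D: "bounded_linear D" and r: "\<And>h. norm (f (x + h) - f x - D h) \<le> B * (norm h)\<^sup>2"
  shows "(f has_derivative D) (at x)"
  unfolding has_derivative_at
proof
  have "((\<lambda>h::'a. B * norm h) \<longlongrightarrow> B * norm (0 :: 'a)) (at 0)"
    by (rule tendsto_mult[OF tendsto_const tendsto_norm[OF tendsto_ident_at]])
  then have lim: "((\<lambda>h::'a. B * norm h) \<longlongrightarrow> 0) (at 0)" by simp
  show "((\<lambda>h. norm (f (x + h) - f x - D h) / norm h) \<longlongrightarrow> 0) (at 0)"
  proof (rule Lim_null_comparison[OF _ lim])
    have "norm (norm (f (x + h) - f x - D h) / norm h) \<le> B * norm h" if "h \<noteq> 0" for h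
      using divide_right_mono[OF r[of h] norm_ge_zero[of h]] that by (simp add: power2_eq_square)
    then show "\<forall>\<^sub>F h in at 0. norm (norm (f (x + h) - f x - D h) / norm h) \<le> B * norm h"
      by (auto simp: eventually_at_filter)
  qed
qed (rule D)

lemma norm_cis_remainder: "norm (cis t - 1 - \<i> * complex_of_real t) \<le> t\<^sup>2 / 2"
proof -
  have "cis t - 1 - \<i> * complex_of_real t = exp (\<i> * complex_of_real t) - (\<Sum>k\<le>1. (\<i> * complex_of_real t) ^ k / fact k)"
    by (simp add: cis_conv_exp)
  then show ?thesis using iexp_approx1[of t 1] by (simp add: numeral_2_eq_2 diff_diff_eq)
qed

lemma fourier_has_derivative:
  fixes u :: "real \<times> real \<Rightarrow> complex"
  assumes u: "integrable lborel u" "integrable lborel (\<lambda>\<xi>. complex_of_real (fst \<xi>) * u \<xi>)"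
      "integrable lborel (\<lambda>\<xi>. complex_of_real (snd \<xi>) * u \<xi>)"
    and u2: "integrable lborel (\<lambda>\<xi>. (norm \<xi>)\<^sup>2 * norm (u \<xi>))"
  shows "(fourier u has_derivative (\<lambda>h. - \<i> * (complex_of_real (fst h) * fourier (\<lambda>\<xi>. complex_of_real (fst \<xi>) * u \<xi>) x
      + complex_of_real (snd h) * fourier (\<lambda>\<xi>. complex_of_real (snd \<xi>) * u \<xi>) x))) (at x)"
    (is "(_ has_derivative ?D) _")
proof (rule has_derivative_of_quadratic_remainder)
  have [measurable]: "u \<in> borel_measurable borel" using u by auto
  show "bounded_linear ?D"
    by (intro bounded_linear_const_mult bounded_linear_add bounded_linear_mult_const
        bounded_linear_compose[OF bounded_linear_of_real] bounded_linear_fst bounded_linear_snd)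
  fix h
  let ?r = "\<lambda>\<xi>. cis (- (\<xi> \<bullet> x)) * (cis (- (\<xi> \<bullet> h)) - 1 - \<i> * complex_of_real (- (\<xi> \<bullet> h))) * u \<xi>"
  let ?b = "\<lambda>\<xi>. (norm h)\<^sup>2 / 2 * ((norm \<xi>)\<^sup>2 * norm (u \<xi>))"
  note ci = integrable_cis_mult(4)[OF u(1)] integrable_cis_mult(4)[OF u(2)] integrable_cis_mult(4)[OF u(3)]
  have "fourier u (x + h) - fourier u x - ?D h =
      (LINT \<xi>|lborel. cis (- (\<xi> \<bullet> (x + h))) * u \<xi> - cis (- (\<xi> \<bullet> x)) * u \<xi>
        + \<i> * (complex_of_real (fst h) * (cis (- (\<xi> \<bullet> x)) * (complex_of_real (fst \<xi>) * u \<xi>))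
        + complex_of_real (snd h) * (cis (- (\<xi> \<bullet> x)) * (complex_of_real (snd \<xi>) * u \<xi>))))"
    unfolding fourier_def using ci by simp
  also have "\<dots> = (LINT \<xi>|lborel. ?r \<xi>)"
  proof (intro Bochner_Integration.integral_cong refl)
    fix \<xi>
    have "cis (- (\<xi> \<bullet> (x + h))) = cis (- (\<xi> \<bullet> x)) * cis (- (\<xi> \<bullet> h))"
      by (simp add: cis_mult inner_add_right)
    then show "cis (- (\<xi> \<bullet> (x + h))) * u \<xi> - cis (- (\<xi> \<bullet> x)) * u \<xi>
        + \<i> * (complex_of_real (fst h) * (cis (- (\<xi> \<bullet> x)) * (complex_of_real (fst \<xi>) * u \<xi>))
        + complex_of_real (snd h) * (cis (- (\<xi> \<bullet> x)) * (complex_of_real (snd \<xi>) * u \<xi>))) =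
      ?r \<xi>"
      by (simp add: inner_prod_def algebra_simps)
  qed
  also have "norm \<dots> \<le> (LINT \<xi>|lborel. ?b \<xi>)"
  proof (rule Bochner_Integration.integral_norm_bound_integral)
    show "integrable lborel (\<lambda>\<xi>. ?b \<xi>)" using u2 by simp
    show b: "norm (?r \<xi>)
        \<le> ?b \<xi>" for \<xi>
    proof -
      have "(\<xi> \<bullet> h)\<^sup>2 \<le> (norm \<xi>)\<^sup>2 * (norm h)\<^sup>2"
        using power_mono[OF Cauchy_Schwarz_ineq2[of \<xi> h], of 2] by (simp add: power_mult_distrib)
      then have "norm (cis (- (\<xi> \<bullet> h)) - 1 - \<i> * complex_of_real (- (\<xi> \<bullet> h))) \<le> (norm \<xi>)\<^sup>2 * (norm h)\<^sup>2 / 2"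
        using norm_cis_remainder[of "- (\<xi> \<bullet> h)"] by simp
      from mult_right_mono[OF this norm_ge_zero[of "u \<xi>"]]
      show ?thesis by (simp add: norm_mult mult_ac)
    qed
    have m: "(\<lambda>\<xi>. cis (- (\<xi> \<bullet> x)) * (cis (- (\<xi> \<bullet> h)) - 1 - \<i> * complex_of_real (- (\<xi> \<bullet> h)))) \<in> borel_measurable borel"
      by (intro borel_measurable_continuous_onI continuous_intros)
    show "integrable lborel (\<lambda>\<xi>. ?r \<xi>)"
    proof (rule Bochner_Integration.integrable_bound)
      show "integrable lborel (\<lambda>\<xi>. ?b \<xi>)" using u2 by simp
      show "(\<lambda>\<xi>. ?r \<xi>) \<in> borel_measurable lborel"
        using m by measurable
      show "AE \<xi> in lborel. norm (?r \<xi>)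
        \<le> norm (?b \<xi>)"
        using b by (intro always_eventually allI order_trans[OF b]) simp
    qed
  qed
  also have "\<dots> = (norm h)\<^sup>2 / 2 * (LINT \<xi>|lborel. (norm \<xi>)\<^sup>2 * norm (u \<xi>))"
    by (rule integral_mult_right_zero)
  finally show "norm (fourier u (x + h) - fourier u x - ?D h) \<le>
      ((LINT \<xi>|lborel. (norm \<xi>)\<^sup>2 * norm (u \<xi>)) / 2) * (norm h)\<^sup>2"
    by (simp add: mult_ac)
qed

lemma norm_weight_mult: "norm (complex_of_real ((1 + norm x) ^ N) * z) = (1 + norm x) ^ N * norm z"
  unfolding norm_mult norm_of_real by simp

lemma rapidly_decreasing_integrable:
  fixes k :: "real \<times> real \<Rightarrow> complex"
  assumes k: "k \<in> borel_measurable borel" "rapidly_decreasing k"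
  shows "integrable lborel (\<lambda>x. complex_of_real ((1 + norm x) ^ N) * k x)"
proof -
  obtain B where B: "\<And>x. (1 + norm x) ^ (4 + N) * norm (k x) \<le> B"
    using k(2) unfolding rapidly_decreasing_def by blast
  show ?thesis
  proof (rule integrable_of_decay)
    show "(\<lambda>x. complex_of_real ((1 + norm x) ^ N) * k x) \<in> borel_measurable borel"
      using k(1) by measurable
    show "(1 + norm x) ^ 4 * norm (complex_of_real ((1 + norm x) ^ N) * k x) \<le> B" for x
      using B[of x] unfolding norm_weight_mult by (simp add: power_add mult.assoc)
  qed
qed

text \<open>
  Convolution with this kernel is the operator with multiplier \<^term>\<open>cutoff w (norm \<xi>)\<close>.
\<close>

definition lp_kernel :: "(real \<Rightarrow> real) \<Rightarrow> real \<times> real \<Rightarrow> complex" where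
  "lp_kernel w x = complex_of_real (1 / (2 * pi)\<^sup>2) * fourier (\<lambda>\<xi>. complex_of_real (cutoff w (norm \<xi>))) x"

lemma radial_term_cutoff:
  "radial_term w 0 0 0 0 = (\<lambda>\<xi>. complex_of_real (cutoff w (norm \<xi>)))"
  by (simp add: radial_term_def fun_eq_iff)

lemma continuous_on_cutoff_norm:
  assumes "lp_window w"
  shows "continuous_on UNIV (\<lambda>\<xi> :: real \<times> real. complex_of_real (cutoff w (norm \<xi>)))"
  using continuous_on_radial_term[OF assms, of 0 0 0 0] by (simp add: radial_term_cutoff)

lemma integrable_cutoff_norm:
  assumes "lp_window w"
  shows "integrable lborel (\<lambda>\<xi> :: real \<times> real. complex_of_real (cutoff w (norm \<xi>)))"
  using integrable_radial_term[OF assms, of 0 0 0 0] by (simp add: radial_term_cutoff)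

lemma lp_kernel_continuous: "lp_window w \<Longrightarrow> continuous_on UNIV (lp_kernel w)"
  unfolding lp_kernel_def[abs_def]
  by (intro continuous_intros continuous_on_fourier integrable_cutoff_norm)

lemma lp_kernel_measurable: "lp_window w \<Longrightarrow> lp_kernel w \<in> borel_measurable borel"
  by (intro borel_measurable_continuous_onI lp_kernel_continuous)

lemma rapidly_decreasing_cmult:
  assumes "rapidly_decreasing k"
  shows "rapidly_decreasing (\<lambda>x. c * k x)"
  unfolding rapidly_decreasing_def
proof
  fix N
  obtain B where B: "\<And>x. (1 + norm x) ^ N * norm (k x) \<le> B"
    using assms unfolding rapidly_decreasing_def by blast
  have "(1 + norm x) ^ N * norm (c * k x) \<le> norm c * B" for x
    using mult_left_mono[OF B[of x], of "norm c"] by (simp add: norm_mult mult_ac)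
  then show "\<exists>B. \<forall>x. (1 + norm x) ^ N * norm (c * k x) \<le> B" by blast
qed

lemma lp_kernel_rapidly_decreasing:
  assumes "lp_window w"
  shows "rapidly_decreasing (lp_kernel w)"
proof -
  have "rapidly_decreasing (fourier (radial_term w 0 0 0 0))"
    by (rule rapidly_decreasing_fourier_radial_term[OF assms]) simp
  from rapidly_decreasing_cmult[OF this, of "complex_of_real (1 / (2 * pi)\<^sup>2)"] show ?thesis
    unfolding lp_kernel_def[abs_def] radial_term_cutoff .
qed

lemma lp_kernel_integrable_power:
  assumes "lp_window w"
  shows "integrable lborel (\<lambda>x. (1 + norm x) ^ N * norm (lp_kernel w x))"
  using integrable_norm[OF rapidly_decreasing_integrable[OF lp_kernel_measurable[OF assms] lp_kernel_rapidly_decreasing[OF assms]], of N]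
  unfolding norm_weight_mult .

lemma lp_kernel_integrable: "lp_window w \<Longrightarrow> integrable lborel (lp_kernel w)"
  using rapidly_decreasing_integrable[OF lp_kernel_measurable lp_kernel_rapidly_decreasing, of w 0] by simp

text \<open>
  Fourier inversion at the origin, where the cutoff equals \<open>1\<close>.
\<close>

lemma integral_lp_kernel:
  assumes w: "lp_window w"
  shows "(LINT x|lborel. lp_kernel w x) = 1"
proof -
  let ?u = "\<lambda>\<xi> :: real \<times> real. complex_of_real (cutoff w (norm \<xi>))"
  have z: "?u \<xi> = 0" if "2 < norm \<xi>" for \<xi> :: "real \<times> real"
    using cutoff_eq_0[OF w, of "norm \<xi>"] that by simp
  obtain B where B: "\<And>\<xi>. norm (?u \<xi>) \<le> B"
    by (rule bounded_compact_support[OF continuous_on_cutoff_norm[OF w] z]) (assumption, rule that)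
  have "integrable lborel (\<lambda>x. (2 * pi)\<^sup>2 * lp_kernel w x)"
    using lp_kernel_integrable[OF w] by (rule integrable_mult_right)
  then have "integrable lborel (fourier ?u)" by (simp add: lp_kernel_def power2_eq_square)
  from fourier_inversion[OF integrable_cutoff_norm[OF w] continuous_on_cutoff_norm[OF w] B this, of 0]
  have "fourier_inv (fourier ?u) 0 = 1" by (simp add: cutoff_def)
  then show ?thesis by (simp add: fourier_inv_def lp_kernel_def)
qed

text \<open>
  The gradient of the kernel is again a Fourier transform of radial terms, hence rapidly decreasing.
  For short translations this bounds the difference by an integrable function times the length; for
  long ones the triangle inequality suffices.
\<close>

lemma lp_kernel_L1_lipschitz:
  assumes w: "lp_window w"
  obtains L where "0 \<le> L" "\<And>a. (LINT x|lborel. norm (lp_kernel w (x - a) - lp_kernel w x)) \<le> L * norm a"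
proof -
  define c where "c = complex_of_real (1 / (2 * pi)\<^sup>2)"
  define u where "u = radial_term w 0 0 0 0"
  define K1 where "K1 x = c * fourier (radial_term w 1 0 0 0) x" for x
  define K2 where "K2 x = c * fourier (radial_term w 0 1 0 0) x" for x
  let ?k = "lp_kernel w" and ?D = "\<lambda>x h. - \<i> * (complex_of_real (fst h) * K1 x + complex_of_real (snd h) * K2 x)"
  have k: "?k = (\<lambda>x. c * fourier u x)"
    by (simp add: lp_kernel_def[abs_def] c_def u_def radial_term_cutoff)
  have r: "(\<lambda>\<xi>. complex_of_real (fst \<xi>) * u \<xi>) = radial_term w 1 0 0 0"
      "(\<lambda>\<xi>. complex_of_real (snd \<xi>) * u \<xi>) = radial_term w 0 1 0 0"
    by (auto simp: u_def radial_term_def fun_eq_iff)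
  have "integrable lborel (\<lambda>\<xi>. complex_of_real ((norm \<xi>)\<^sup>2) * u \<xi>)"
  proof (rule integrable_compact_support)
    show "continuous_on UNIV (\<lambda>\<xi>. complex_of_real ((norm \<xi>)\<^sup>2) * u \<xi>)"
      unfolding u_def by (intro continuous_intros continuous_on_radial_term[OF w]) auto
    show "complex_of_real ((norm \<xi>)\<^sup>2) * u \<xi> = 0" if "2 < norm \<xi>" for \<xi>
      using radial_term_eq_0[OF w that] by (simp add: u_def)
  qed
  from integrable_norm[OF this]
  have u2: "integrable lborel (\<lambda>\<xi>. (norm \<xi>)\<^sup>2 * norm (u \<xi>))" by (simp add: norm_mult norm_power)
  have der: "(?k has_derivative (?D x)) (at x)" for x
  proof -
    have "(fourier u has_derivative (\<lambda>h. - \<i> * (complex_of_real (fst h) * fourier (radial_term w 1 0 0 0) x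
      + complex_of_real (snd h) * fourier (radial_term w 0 1 0 0) x))) (at x)"
      using fourier_has_derivative[of u x] u2 unfolding r
      by (simp add: integrable_radial_term[OF w] u_def)
    from has_derivative_mult_right[OF this, of c] show ?thesis
      unfolding k K1_def K2_def by (simp add: algebra_simps)
  qed
  have "rapidly_decreasing K1" "rapidly_decreasing K2"
    unfolding K1_def[abs_def] K2_def[abs_def]
    by (intro rapidly_decreasing_cmult rapidly_decreasing_fourier_radial_term[OF w]; simp)+
  then obtain B1 B2 where B1: "\<And>x. (1 + norm x) ^ 4 * norm (K1 x) \<le> B1"
    and B2: "\<And>x. (1 + norm x) ^ 4 * norm (K2 x) \<le> B2"
    unfolding rapidly_decreasing_def by meson
  define B where "B = 16 * (B1 + B2)"
  have B0: "0 \<le> B"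
    using order_trans[OF _ B1[of 0], of 0] order_trans[OF _ B2[of 0], of 0] by (simp add: B_def)
  define p :: "real \<times> real \<Rightarrow> real" where "p x = 1 / (1 + norm x) ^ 4" for x
  have "integrable lborel (\<lambda>x. complex_of_real (p x))"
  proof (rule integrable_of_decay)
    show "(\<lambda>x. complex_of_real (p x)) \<in> borel_measurable borel" unfolding p_def by measurable
    have "1 + norm x \<noteq> 0" for x :: "real \<times> real" using norm_ge_zero[of x] by linarith
    then show "(1 + norm x) ^ 4 * norm (complex_of_real (p x)) \<le> 1" for x
      unfolding norm_of_real p_def by simp
  qed
  moreover have "norm (complex_of_real (p x)) = p x" for x
    unfolding norm_of_real by (simp add: p_def)
  ultimately have p: "integrable lborel p" using integrable_norm[of lborel "\<lambda>x. complex_of_real (p x)"] by simp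
  have near: "norm (?k (x - a) - ?k x) \<le> B * p x * norm a" if a: "norm a \<le> 1" for x a
  proof -
    have "norm (?k (x - a) - ?k x) \<le> B * p x * norm (x - a - x)"
    proof (rule differentiable_bound[of "closed_segment x (x - a)"])
      fix z assume z: "z \<in> closed_segment x (x - a)"
      show "(?k has_derivative (?D z)) (at z within closed_segment x (x - a))"
        by (rule has_derivative_at_withinI[OF der])
      have "norm (z - x) \<le> norm a" using segment_bound(1)[OF z] by simp
      then have "norm x \<le> norm z + 1" using a norm_triangle_ineq2[of x z] by (simp add: norm_minus_commute)
      then have "1 + norm x \<le> norm z + 2" by simp
      also have "\<dots> \<le> 2 * (1 + norm z)" by simp
      finally have "1 + norm x \<le> 2 * (1 + norm z)" .
      from power_mono[OF this, of 4]
      have "(1 + norm x) ^ 4 \<le> 16 * (1 + norm z) ^ 4" unfolding power_mult_distrib by simp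
      from mult_right_mono[OF this, of "norm (K1 z) + norm (K2 z)"]
      have "(1 + norm x) ^ 4 * (norm (K1 z) + norm (K2 z)) \<le> 16 * (1 + norm z) ^ 4 * (norm (K1 z) + norm (K2 z))"
        by simp
      also have "\<dots> \<le> B" using B1[of z] B2[of z] by (simp add: B_def algebra_simps)
      finally have "norm (K1 z) + norm (K2 z) \<le> B * p x"
        using zero_less_power[of "1 + norm x" 4] by (simp add: p_def field_simps add_pos_nonneg)
      have "norm (?D z h) \<le> B * p x * norm h" for h
      proof -
        have "norm (?D z h) \<le>
            \<bar>fst h\<bar> * norm (K1 z) + \<bar>snd h\<bar> * norm (K2 z)"
          using norm_triangle_ineq[of "complex_of_real (fst h) * K1 z" "complex_of_real (snd h) * K2 z"]
          by (simp add: norm_mult)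
        also have "\<dots> \<le> norm h * norm (K1 z) + norm h * norm (K2 z)"
          using norm_fst_le[of "fst h" "snd h"] norm_snd_le[of "snd h" "fst h"]
          by (intro add_mono mult_right_mono) auto
        also have "\<dots> = (norm (K1 z) + norm (K2 z)) * norm h" by (simp add: algebra_simps)
        also have "\<dots> \<le> B * p x * norm h"
          by (intro mult_right_mono) (use \<open>norm (K1 z) + norm (K2 z) \<le> B * p x\<close> in auto)
        finally show ?thesis .
      qed
      then show "onorm (?D z) \<le> B * p x"
        by (rule onorm_le)
    qed auto
    then show ?thesis by simp
  qed
  have tr: "integrable lborel (\<lambda>x. ?k (x - a))" "(LINT x|lborel. norm (?k (x - a))) = (LINT x|lborel. norm (?k x))" for a
    using lborel_integrable_affine[OF lp_kernel_integrable[OF w], of 1 "- a"]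
      lborel_integral_affine[of "\<lambda>x. norm (?k x)" 1 "- a"] lp_kernel_measurable[OF w] by simp_all
  define L where "L = B * (LINT x|lborel. p x) + 2 * (LINT x|lborel. norm (?k x))"
  have pos: "0 \<le> B * (LINT x|lborel. p x)" "0 \<le> (LINT x|lborel. norm (?k x))"
    using B0 by (auto simp: p_def)
  show thesis
  proof (rule that[of L])
    show "0 \<le> L" using pos by (simp add: L_def)
    fix a
    have int: "integrable lborel (\<lambda>x. norm (?k (x - a) - ?k x))"
      using tr lp_kernel_integrable[OF w] by auto
    show "(LINT x|lborel. norm (?k (x - a) - ?k x)) \<le> L * norm a"
    proof (cases "norm a \<le> 1")
      case True
      have "(LINT x|lborel. norm (?k (x - a) - ?k x)) \<le> (LINT x|lborel. B * p x * norm a)"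
        by (rule integral_mono[OF int]) (use p near[OF True] in auto)
      also have "\<dots> = B * (LINT x|lborel. p x) * norm a" by simp
      also have "\<dots> \<le> L * norm a" using pos by (intro mult_right_mono) (auto simp: L_def)
      finally show ?thesis .
    next
      case False
      have "(LINT x|lborel. norm (?k (x - a) - ?k x)) \<le> (LINT x|lborel. norm (?k (x - a)) + norm (?k x))"
        by (rule integral_mono[OF int]) (use tr lp_kernel_integrable[OF w] norm_triangle_ineq4 in auto)
      also have "\<dots> = 2 * (LINT x|lborel. norm (?k x))"
        using tr lp_kernel_integrable[OF w] by simp
      also have "\<dots> \<le> L * 1" using pos by (simp add: L_def)
      also have "\<dots> \<le> L * norm a" using False pos by (intro mult_left_mono) (auto simp: L_def)
      finally show ?thesis .
    qed
  qed
qed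

section \<open>Schwartz functions and convolution\<close>

lemma iter_deriv_append: "iter_deriv bs (iter_deriv cs \<phi>) = iter_deriv (bs @ cs) \<phi>"
  by (induction bs) auto

lemma schwartzD:
  assumes "\<phi> \<in> schwartz" "bs \<in> lists Basis"
  shows "iter_deriv bs \<phi> differentiable (at x)"
    and "bounded (range (\<lambda>x. (1 + norm x) ^ N *\<^sub>R iter_deriv bs \<phi> x))"
  using assms by (simp_all add: schwartz_def smooth_def)

lemma schwartz_bound:
  assumes "\<phi> \<in> schwartz" "bs \<in> lists Basis"
  obtains B where "0 \<le> B" "\<And>x. (1 + norm x) ^ N * norm (iter_deriv bs \<phi> x) \<le> B"
proof -
  obtain B where "\<forall>z\<in>range (\<lambda>x. (1 + norm x) ^ N *\<^sub>R iter_deriv bs \<phi> x). norm z \<le> B"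
    using schwartzD(2)[OF assms, of N] unfolding bounded_iff by (elim exE)
  then have B: "norm ((1 + norm x) ^ N *\<^sub>R iter_deriv bs \<phi> x) \<le> B" for x
    by (rule bspec) (rule rangeI)
  show thesis
  proof (rule that)
    show "0 \<le> B" by (rule order_trans[OF norm_ge_zero B[of 0]])
    show "(1 + norm x) ^ N * norm (iter_deriv bs \<phi> x) \<le> B" for x
      using B[of x] unfolding norm_scaleR by simp
  qed
qed

lemma schwartzI:
  assumes d: "\<And>bs x. bs \<in> lists Basis \<Longrightarrow> iter_deriv bs \<phi> differentiable (at x)"
    and b: "\<And>bs N. bs \<in> lists Basis \<Longrightarrow> \<exists>B. \<forall>x. (1 + norm x) ^ N * norm (iter_deriv bs \<phi> x) \<le> B"
  shows "\<phi> \<in> schwartz"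
proof -
  have "bounded (range (\<lambda>x. (1 + norm x) ^ N *\<^sub>R iter_deriv bs \<phi> x))" if bs: "bs \<in> lists Basis" for bs N
  proof -
    obtain B where B: "\<forall>x. (1 + norm x) ^ N * norm (iter_deriv bs \<phi> x) \<le> B"
      using b[OF bs, of N] by (elim exE)
    have "norm z \<le> B" if "z \<in> range (\<lambda>x. (1 + norm x) ^ N *\<^sub>R iter_deriv bs \<phi> x)" for z
      using that B by (elim rangeE) (simp add: abs_of_nonneg)
    then show ?thesis by (rule boundedI)
  qed
  then show ?thesis using d by (simp add: schwartz_def smooth_def)
qed

lemma schwartz_iter_deriv:
  assumes \<phi>: "\<phi> \<in> schwartz" and bs: "bs \<in> lists Basis"
  shows "iter_deriv bs \<phi> \<in> schwartz"
proof (rule schwartzI)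
  fix cs :: "'a list" and x and N :: nat assume cs: "cs \<in> lists Basis"
  have l: "cs @ bs \<in> lists Basis" using cs bs by simp
  show "iter_deriv cs (iter_deriv bs \<phi>) differentiable (at x)"
    unfolding iter_deriv_append by (rule schwartzD(1)[OF \<phi> l])
  show "\<exists>B. \<forall>x. (1 + norm x) ^ N * norm (iter_deriv cs (iter_deriv bs \<phi>) x) \<le> B"
    unfolding iter_deriv_append by (rule schwartz_bound[OF \<phi> l, of N]) (intro exI allI)
qed

lemma schwartz_has_derivative:
  assumes "\<phi> \<in> schwartz"
  shows "(\<phi> has_derivative (\<lambda>h. \<Sum>b\<in>Basis. (h \<bullet> b) *\<^sub>R iter_deriv [b] \<phi> x)) (at x)"
proof -
  have d: "(\<phi> has_derivative frechet_derivative \<phi> (at x)) (at x)"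
    using schwartzD(1)[OF assms lists.Nil, of x] by (simp add: frechet_derivative_works)
  then have lin: "linear (frechet_derivative \<phi> (at x))" by (rule has_derivative_linear)
  have "frechet_derivative \<phi> (at x) h = (\<Sum>b\<in>Basis. (h \<bullet> b) *\<^sub>R iter_deriv [b] \<phi> x)" for h
  proof -
    have "frechet_derivative \<phi> (at x) h = frechet_derivative \<phi> (at x) (\<Sum>b\<in>Basis. (h \<bullet> b) *\<^sub>R b)"
      by (simp add: euclidean_representation)
    also have "\<dots> = (\<Sum>b\<in>Basis. (h \<bullet> b) *\<^sub>R iter_deriv [b] \<phi> x)"
      by (simp add: linear_sum[OF lin] linear_cmul[OF lin] o_def)
    finally show ?thesis .
  qed
  then have "frechet_derivative \<phi> (at x) = (\<lambda>h. \<Sum>b\<in>Basis. (h \<bullet> b) *\<^sub>R iter_deriv [b] \<phi> x)" by (rule ext)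
  from d[unfolded this] show ?thesis .
qed

lemma schwartz_decay:
  assumes "\<phi> \<in> schwartz"
  obtains B where "0 \<le> B" "\<And>x. (1 + norm x) ^ N * norm (\<phi> x) \<le> B"
  by (rule schwartz_bound[OF assms lists.Nil, of N]) (simp only: iter_deriv.simps)

lemma schwartz_continuous: "\<phi> \<in> schwartz \<Longrightarrow> continuous_on UNIV \<phi>"
  by (intro continuous_at_imp_continuous_on ballI has_derivative_continuous[OF schwartz_has_derivative])

lemma schwartz_measurable: "\<phi> \<in> schwartz \<Longrightarrow> \<phi> \<in> borel_measurable borel"
  by (intro borel_measurable_continuous_onI schwartz_continuous)

lemma schwartz_integrable:
  fixes \<phi> :: "real \<times> real \<Rightarrow> complex"
  assumes "\<phi> \<in> schwartz"
  shows "integrable lborel \<phi>"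
proof -
  obtain B where "\<And>x. (1 + norm x) ^ 4 * norm (\<phi> x) \<le> B"
    by (rule schwartz_decay[OF assms, of 4]) (rule that)
  then show ?thesis by (intro integrable_of_decay[OF schwartz_measurable[OF assms]])
qed

lemma iter_deriv_linear:
  assumes \<phi>: "\<phi> \<in> schwartz" and \<psi>: "\<psi> \<in> schwartz" and "bs \<in> lists Basis"
  shows "iter_deriv bs (\<lambda>x. \<phi> x + c * \<psi> x) = (\<lambda>x. iter_deriv bs \<phi> x + c * iter_deriv bs \<psi> x)"
  using assms(3)
proof (induction bs)
  case (Cons b bs)
  then have bs: "bs \<in> lists Basis" by auto
  show ?case
  proof
    fix x
    note d = schwartz_has_derivative[OF schwartz_iter_deriv[OF \<phi> bs]] schwartz_has_derivative[OF schwartz_iter_deriv[OF \<psi> bs]]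
    from d have d: "(iter_deriv bs \<phi> has_derivative frechet_derivative (iter_deriv bs \<phi>) (at x)) (at x)"
       "(iter_deriv bs \<psi> has_derivative frechet_derivative (iter_deriv bs \<psi>) (at x)) (at x)"
      using frechet_derivative_works differentiable_def by blast+
    have "((\<lambda>x. iter_deriv bs \<phi> x + c * iter_deriv bs \<psi> x) has_derivative
        (\<lambda>h. frechet_derivative (iter_deriv bs \<phi>) (at x) h + c * frechet_derivative (iter_deriv bs \<psi>) (at x) h)) (at x)"
      by (intro has_derivative_add has_derivative_mult_right d)
    from fun_cong[OF frechet_derivative_at[OF this], of b]
    show "iter_deriv (b # bs) (\<lambda>x. \<phi> x + c * \<psi> x) x = iter_deriv (b # bs) \<phi> x + c * iter_deriv (b # bs) \<psi> x"
      by (simp add: Cons.IH)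
  qed
qed simp

lemma schwartz_linear:
  fixes \<phi> \<psi> :: "'a::euclidean_space \<Rightarrow> complex"
  assumes \<phi>: "\<phi> \<in> schwartz" and \<psi>: "\<psi> \<in> schwartz"
  shows "(\<lambda>x. \<phi> x + c * \<psi> x) \<in> schwartz"
proof (rule schwartzI)
  fix bs :: "'a list" and x and N :: nat assume bs: "bs \<in> lists Basis"
  note schwartzD(1)[OF \<phi> bs, of x] schwartzD(1)[OF \<psi> bs, of x]
  then show "iter_deriv bs (\<lambda>x. \<phi> x + c * \<psi> x) differentiable (at x)"
    unfolding iter_deriv_linear[OF assms bs] by simp
  obtain B1 where B1: "\<And>x. (1 + norm x) ^ N * norm (iter_deriv bs \<phi> x) \<le> B1"
    by (rule schwartz_bound[OF \<phi> bs, of N]) (rule that)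
  obtain B2 where B2: "\<And>x. (1 + norm x) ^ N * norm (iter_deriv bs \<psi> x) \<le> B2"
    by (rule schwartz_bound[OF \<psi> bs, of N]) (rule that)
  have "(1 + norm x) ^ N * norm (iter_deriv bs \<phi> x + c * iter_deriv bs \<psi> x) \<le> B1 + norm c * B2" for x
  proof -
    have "(1 + norm x) ^ N * norm (iter_deriv bs \<phi> x + c * iter_deriv bs \<psi> x) \<le>
        (1 + norm x) ^ N * (norm (iter_deriv bs \<phi> x) + norm c * norm (iter_deriv bs \<psi> x))"
      using norm_triangle_ineq[of "iter_deriv bs \<phi> x" "c * iter_deriv bs \<psi> x"]
      by (intro mult_left_mono) (auto simp: norm_mult)
    also have "\<dots> \<le> B1 + norm c * B2"
      using B1[of x] mult_left_mono[OF B2[of x], of "norm c"] by (simp add: algebra_simps)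
    finally show ?thesis .
  qed
  then show "\<exists>B. \<forall>x. (1 + norm x) ^ N * norm (iter_deriv bs (\<lambda>x. \<phi> x + c * \<psi> x) x) \<le> B"
    unfolding iter_deriv_linear[OF assms bs] by (intro exI allI)
qed

lemma onorm_coordinate_sum_le:
  fixes c :: "'a::euclidean_space \<Rightarrow> complex"
  shows "onorm (\<lambda>h. \<Sum>b\<in>Basis. (h \<bullet> b) *\<^sub>R c b) \<le> (\<Sum>b\<in>Basis. norm (c b))"
proof (rule onorm_le)
  fix h :: 'a
  have "norm (\<Sum>b\<in>Basis. (h \<bullet> b) *\<^sub>R c b) \<le> (\<Sum>b\<in>Basis. norm h * norm (c b))"
    by (intro sum_norm_le) (auto intro!: mult_right_mono Basis_le_norm)
  then show "norm (\<Sum>b\<in>Basis. (h \<bullet> b) *\<^sub>R c b) \<le> (\<Sum>b\<in>Basis. norm (c b)) * norm h"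
    by (simp add: sum_distrib_left mult.commute)
qed

lemma one_plus_norm_submult: "1 + norm (x :: 'a::real_normed_vector) \<le> (1 + norm (x - y)) * (1 + norm y)"
proof -
  have "norm x \<le> norm (x - y) + norm y" using norm_triangle_ineq[of "x - y" y] by simp
  also have "\<dots> \<le> norm (x - y) + norm y + norm (x - y) * norm y" by simp
  finally show ?thesis by (simp add: algebra_simps)
qed

text \<open>
  The weight \<open>(1 + norm x) ^ N\<close> is submultiplicative, so moving from \<open>x\<close> to any point of the segment
  towards \<open>x - y\<close> costs at most a factor \<open>(1 + norm y) ^ N\<close>.
\<close>

lemma schwartz_weighted_lipschitz:
  fixes \<phi> :: "'a::euclidean_space \<Rightarrow> complex"
  assumes \<phi>: "\<phi> \<in> schwartz"
  obtains B where "0 \<le> B" "\<And>x y. (1 + norm x) ^ N * norm (\<phi> (x - y) - \<phi> x) \<le> B * (norm y * (1 + norm y) ^ N)"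
proof -
  let ?P = "\<lambda>b B. 0 \<le> B \<and> (\<forall>x. (1 + norm x) ^ N * norm (iter_deriv [b] \<phi> x) \<le> B)"
  have "\<forall>b\<in>Basis. \<exists>B. ?P b B"
  proof
    fix b :: 'a assume "b \<in> Basis"
    then have "[b] \<in> lists Basis" by simp
    then obtain B where "0 \<le> B" "\<And>x. (1 + norm x) ^ N * norm (iter_deriv [b] \<phi> x) \<le> B"
      by (rule schwartz_bound[OF \<phi>, of "[b]" N]) (rule that)
    then show "\<exists>B. ?P b B"
      by (intro exI[of _ B] conjI allI)
  qed
  then obtain B where "\<forall>b\<in>Basis. ?P b (B b)"
    unfolding bchoice_iff by (elim exE)
  then have B: "\<And>b. b \<in> Basis \<Longrightarrow> 0 \<le> B b"
    "\<And>b x. b \<in> Basis \<Longrightarrow> (1 + norm x) ^ N * norm (iter_deriv [b] \<phi> x) \<le> B b"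
    by simp_all
  show thesis
  proof (rule that[of "\<Sum>b\<in>Basis. B b"])
    show "0 \<le> (\<Sum>b\<in>Basis. B b)" using B by (intro sum_nonneg)
    fix x y :: 'a
    define M where "M = (\<Sum>b\<in>Basis. B b) * (1 + norm y) ^ N / (1 + norm x) ^ N"
    have px: "0 < (1 + norm x) ^ N" by (simp add: add_pos_nonneg)
    have "norm (\<phi> (x - y) - \<phi> x) \<le> M * norm (x - y - x)"
    proof (rule differentiable_bound[of "closed_segment x (x - y)"])
      fix z assume z: "z \<in> closed_segment x (x - y)"
      show "(\<phi> has_derivative (\<lambda>h. \<Sum>b\<in>Basis. (h \<bullet> b) *\<^sub>R iter_deriv [b] \<phi> z)) (at z within closed_segment x (x - y))"
        by (rule has_derivative_at_withinI[OF schwartz_has_derivative[OF \<phi>]])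
      have "norm (x - z) \<le> norm y" using segment_bound(1)[OF z] by (simp add: norm_minus_commute)
      then have "(1 + norm (x - (x - z))) * (1 + norm (x - z)) \<le> (1 + norm z) * (1 + norm y)"
        by (intro mult_mono) auto
      then have "1 + norm x \<le> (1 + norm z) * (1 + norm y)"
        using one_plus_norm_submult[of x "x - z"] by linarith
      then have w: "(1 + norm x) ^ N \<le> (1 + norm z) ^ N * (1 + norm y) ^ N"
        unfolding power_mult_distrib[symmetric] by (rule power_mono) simp
      have "(1 + norm x) ^ N * (\<Sum>b\<in>Basis. norm (iter_deriv [b] \<phi> z)) \<le>
          (1 + norm z) ^ N * (1 + norm y) ^ N * (\<Sum>b\<in>Basis. norm (iter_deriv [b] \<phi> z))"
        by (intro mult_right_mono w sum_nonneg) auto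
      also have "\<dots> = (1 + norm y) ^ N * (\<Sum>b\<in>Basis. (1 + norm z) ^ N * norm (iter_deriv [b] \<phi> z))"
        by (simp only: sum_distrib_left mult_ac)
      also have "\<dots> \<le> (1 + norm y) ^ N * (\<Sum>b\<in>Basis. B b)"
        by (intro mult_left_mono sum_mono B) auto
      finally have "(\<Sum>b\<in>Basis. norm (iter_deriv [b] \<phi> z)) \<le> M"
        using px by (simp only: M_def pos_le_divide_eq mult.commute)
      with onorm_coordinate_sum_le show "onorm (\<lambda>h. \<Sum>b\<in>Basis. (h \<bullet> b) *\<^sub>R iter_deriv [b] \<phi> z) \<le> M"
        by (rule order_trans)
    qed auto
    then have "(1 + norm x) ^ N * norm (\<phi> (x - y) - \<phi> x) \<le> (1 + norm x) ^ N * (M * norm y)"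
      using px by (intro mult_left_mono) auto
    also have "\<dots> = (\<Sum>b\<in>Basis. B b) * (norm y * (1 + norm y) ^ N)"
    proof -
      have "1 + norm x \<noteq> 0" using norm_ge_zero[of x] by linarith
      then show ?thesis by (simp add: M_def)
    qed
    finally show "(1 + norm x) ^ N * norm (\<phi> (x - y) - \<phi> x) \<le> (\<Sum>b\<in>Basis. B b) * (norm y * (1 + norm y) ^ N)" .
  qed
qed

lemma schwartz_quadratic_remainder:
  fixes \<phi> :: "'a::euclidean_space \<Rightarrow> complex"
  assumes \<phi>: "\<phi> \<in> schwartz"
  obtains B where "0 \<le> B"
    "\<And>x h. norm (\<phi> (x + h) - \<phi> x - (\<Sum>b\<in>Basis. (h \<bullet> b) *\<^sub>R iter_deriv [b] \<phi> x)) \<le> B * (norm h)\<^sup>2"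
proof -
  let ?P = "\<lambda>b B. 0 \<le> B \<and> (\<forall>x y. norm (iter_deriv [b] \<phi> (x - y) - iter_deriv [b] \<phi> x) \<le> B * norm y)"
  have "\<forall>b\<in>Basis. \<exists>B. ?P b B"
  proof
    fix b :: 'a assume "b \<in> Basis"
    then have "[b] \<in> lists Basis" by simp
    then obtain B where B: "0 \<le> B"
      "\<And>x y. (1 + norm x) ^ 0 * norm (iter_deriv [b] \<phi> (x - y) - iter_deriv [b] \<phi> x) \<le> B * (norm y * (1 + norm y) ^ 0)"
      by (rule schwartz_weighted_lipschitz[OF schwartz_iter_deriv[OF \<phi>], of "[b]" 0]) (rule that)
    show "\<exists>B. ?P b B"
    proof (intro exI[of _ B] conjI allI B(1))
      show "norm (iter_deriv [b] \<phi> (x - y) - iter_deriv [b] \<phi> x) \<le> B * norm y" for x y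
        using B(2)[of x y] by (simp only: power_0 mult_1_left mult_1_right)
    qed
  qed
  then obtain B where "\<forall>b\<in>Basis. ?P b (B b)"
    unfolding bchoice_iff by (elim exE)
  then have B: "\<And>b. b \<in> Basis \<Longrightarrow> 0 \<le> B b"
    "\<And>b x y. b \<in> Basis \<Longrightarrow> norm (iter_deriv [b] \<phi> (x - y) - iter_deriv [b] \<phi> x) \<le> B b * norm y"
    by (simp_all del: iter_deriv.simps)
  let ?D = "\<lambda>z h. \<Sum>b\<in>Basis. (h \<bullet> b) *\<^sub>R iter_deriv [b] \<phi> z"
  show thesis
  proof (rule that[of "\<Sum>b\<in>Basis. B b"])
    show "0 \<le> (\<Sum>b\<in>Basis. B b)" using B by (intro sum_nonneg)
    fix x h :: 'a
    have "norm (\<phi> (x + h) - \<phi> x - ?D x (x + h - x)) \<le> norm (x + h - x) * ((\<Sum>b\<in>Basis. B b) * norm h)"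
    proof (rule differentiable_bound_linearization[where S = "closed_segment x (x + h)"])
      show "x + t *\<^sub>R (x + h - x) \<in> closed_segment x (x + h)" if "t \<in> {0..1}" for t
        using that by (auto simp: closed_segment_def algebra_simps intro!: exI[of _ t])
      show "(\<phi> has_derivative ?D z) (at z within closed_segment x (x + h))" for z
        by (rule has_derivative_at_withinI[OF schwartz_has_derivative[OF \<phi>]])
      fix z assume z: "z \<in> closed_segment x (x + h)"
      have eq: "?D z - ?D x = (\<lambda>h. \<Sum>b\<in>Basis. (h \<bullet> b) *\<^sub>R (iter_deriv [b] \<phi> z - iter_deriv [b] \<phi> x))"
        by (simp add: fun_eq_iff sum_subtractf scaleR_diff_right)
      have "onorm (?D z - ?D x) \<le> (\<Sum>b\<in>Basis. norm (iter_deriv [b] \<phi> z - iter_deriv [b] \<phi> x))"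
        unfolding eq by (rule onorm_coordinate_sum_le)
      also have "\<dots> \<le> (\<Sum>b\<in>Basis. B b * norm h)"
      proof (rule sum_mono)
        fix b :: 'a assume b: "b \<in> Basis"
        have "norm (iter_deriv [b] \<phi> (x - (x - z)) - iter_deriv [b] \<phi> x) \<le> B b * norm (x - z)" by (rule B(2)[OF b])
        also have "\<dots> \<le> B b * norm h"
          using segment_bound(1)[OF z] by (intro mult_left_mono B(1)[OF b]) (simp add: norm_minus_commute)
        finally show "norm (iter_deriv [b] \<phi> z - iter_deriv [b] \<phi> x) \<le> B b * norm h" by simp
      qed
      finally show "onorm (?D z - ?D x) \<le> (\<Sum>b\<in>Basis. B b) * norm h" by (simp add: sum_distrib_right)
    qed auto
    then show "norm (\<phi> (x + h) - \<phi> x - ?D x h) \<le> (\<Sum>b\<in>Basis. B b) * (norm h)\<^sup>2"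
      by (simp add: power2_eq_square mult_ac)
  qed
qed

definition conv :: "('a::euclidean_space \<Rightarrow> complex) \<Rightarrow> ('a \<Rightarrow> complex) \<Rightarrow> 'a \<Rightarrow> complex" where
  "conv \<phi> k x = (LINT y|lborel. \<phi> (x - y) * k y)"

lemma schwartz_conv_integrable:
  assumes \<phi>: "\<phi> \<in> schwartz" and k: "integrable lborel k"
  shows "integrable lborel (\<lambda>y. \<phi> (x - y) * k y)"
proof -
  obtain B where "\<And>x. (1 + norm x) ^ 0 * norm (\<phi> x) \<le> B"
    by (rule schwartz_decay[OF \<phi>, of 0]) (rule that)
  then have B: "norm (\<phi> (x - y)) \<le> B" for y by simp
  have "continuous_on UNIV (\<lambda>y. \<phi> (x - y))"
    by (rule continuous_on_compose2[OF schwartz_continuous[OF \<phi>]]) (auto intro!: continuous_intros)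
  from integrable_mult_bounded_continuous[OF k this B] show ?thesis .
qed

lemma conv_has_derivative:
  assumes \<phi>: "\<phi> \<in> schwartz" and k: "integrable lborel k"
  shows "(conv \<phi> k has_derivative (\<lambda>h. \<Sum>b\<in>Basis. (h \<bullet> b) *\<^sub>R conv (iter_deriv [b] \<phi>) k x)) (at x)"
proof -
  let ?D = "\<lambda>h. \<Sum>b\<in>Basis. (h \<bullet> b) *\<^sub>R conv (iter_deriv [b] \<phi>) k x"
  obtain B where B: "0 \<le> B"
    "\<And>x h. norm (\<phi> (x + h) - \<phi> x - (\<Sum>b\<in>Basis. (h \<bullet> b) *\<^sub>R iter_deriv [b] \<phi> x)) \<le> B * (norm h)\<^sup>2"
    by (rule schwartz_quadratic_remainder[OF \<phi>]) (rule that)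
  have i: "integrable lborel (\<lambda>y. \<phi> (x - y) * k y)" for x by (rule schwartz_conv_integrable[OF \<phi> k])
  have ib: "integrable lborel (\<lambda>y. iter_deriv [b] \<phi> (x - y) * k y)" if "b \<in> Basis" for b
    using that by (intro schwartz_conv_integrable schwartz_iter_deriv \<phi> k) auto
  show ?thesis
  proof (rule has_derivative_of_quadratic_remainder)
    show "bounded_linear ?D"
      by (intro bounded_linear_sum bounded_linear_scaleR_const bounded_linear_inner_left)
    fix h
    let ?r = "\<lambda>y. (\<phi> (x - y + h) - \<phi> (x - y) - (\<Sum>b\<in>Basis. (h \<bullet> b) *\<^sub>R iter_deriv [b] \<phi> (x - y))) * k y"
    have r: "?r y = \<phi> (x + h - y) * k y - \<phi> (x - y) * k y - (\<Sum>b\<in>Basis. (h \<bullet> b) *\<^sub>R (iter_deriv [b] \<phi> (x - y) * k y))" for y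
      by (simp add: left_diff_distrib sum_distrib_right diff_add_eq)
    have int_sum: "integrable lborel (\<lambda>y. \<Sum>b\<in>Basis. (h \<bullet> b) *\<^sub>R (iter_deriv [b] \<phi> (x - y) * k y))"
      by (intro Bochner_Integration.integrable_sum integrable_scaleR_right ib)
    have ri: "integrable lborel ?r"
      unfolding r by (intro Bochner_Integration.integrable_diff i int_sum)
    have "conv \<phi> k (x + h) - conv \<phi> k x - ?D h = (LINT y|lborel. ?r y)"
    proof -
      have "?D h =
          (LINT y|lborel. (\<Sum>b\<in>Basis. (h \<bullet> b) *\<^sub>R (iter_deriv [b] \<phi> (x - y) * k y)))"
        unfolding conv_def using ib
        by (subst Bochner_Integration.integral_sum) auto
      then show ?thesis
        unfolding r conv_def using i int_sum by simp
    qed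
    also have "norm \<dots> \<le> (LINT y|lborel. B * (norm h)\<^sup>2 * norm (k y))"
    proof (rule Bochner_Integration.integral_norm_bound_integral)
      show "integrable lborel ?r" by (rule ri)
      show "integrable lborel (\<lambda>y. B * (norm h)\<^sup>2 * norm (k y))"
        by (intro integrable_mult_right integrable_norm k)
      show "norm (?r y) \<le> B * (norm h)\<^sup>2 * norm (k y)" for y
        unfolding norm_mult by (intro mult_right_mono B(2) norm_ge_zero)
    qed
    also have "\<dots> = B * (norm h)\<^sup>2 * (LINT y|lborel. norm (k y))" by (rule integral_mult_right_zero)
    also have "\<dots> = (B * (LINT y|lborel. norm (k y))) * (norm h)\<^sup>2" by (simp only: mult_ac)
    finally show "norm (conv \<phi> k (x + h) - conv \<phi> k x - ?D h)
      \<le> (B * (LINT y|lborel. norm (k y))) * (norm h)\<^sup>2" .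
  qed
qed

text \<open>
  All derivatives fall on the Schwartz factor, so the kernel only has to decay.
\<close>

lemma iter_deriv_conv:
  assumes \<phi>: "\<phi> \<in> schwartz" and k: "integrable lborel k" and "bs \<in> lists Basis"
  shows "iter_deriv bs (conv \<phi> k) = conv (iter_deriv bs \<phi>) k"
  using assms(3)
proof (induction bs)
  case (Cons b bs)
  then have b: "b \<in> Basis" and bs: "bs \<in> lists Basis" by auto
  show ?case
  proof
    fix x
    have "iter_deriv (b # bs) (conv \<phi> k) x = frechet_derivative (conv (iter_deriv bs \<phi>) k) (at x) b"
      by (simp add: Cons.IH)
    also have "\<dots> = (\<Sum>c\<in>Basis. (b \<bullet> c) *\<^sub>R conv (iter_deriv [c] (iter_deriv bs \<phi>)) k x)"
      using frechet_derivative_at[OF conv_has_derivative[OF schwartz_iter_deriv[OF \<phi> bs] k, of x]]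
      by (simp add: fun_eq_iff)
    also have "\<dots> = (\<Sum>c\<in>Basis. if c = b then conv (iter_deriv [b] (iter_deriv bs \<phi>)) k x else 0)"
      using b by (intro sum.cong refl) (auto simp: inner_Basis)
    also have "\<dots> = conv (iter_deriv (b # bs) \<phi>) k x" using b by simp
    finally show "iter_deriv (b # bs) (conv \<phi> k) x = conv (iter_deriv (b # bs) \<phi>) k x" .
  qed
qed simp

lemma conv_weighted_bound:
  assumes \<phi>: "\<phi> \<in> schwartz" and B: "\<And>x. (1 + norm x) ^ N * norm (\<phi> x) \<le> B"
    and k: "integrable lborel k" "integrable lborel (\<lambda>y. (1 + norm y) ^ N * norm (k y))"
  shows "(1 + norm x) ^ N * norm (conv \<phi> k x) \<le> B * (LINT y|lborel. (1 + norm y) ^ N * norm (k y))"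
proof -
  have "(1 + norm x) ^ N * norm (conv \<phi> k x) = norm (LINT y|lborel. complex_of_real ((1 + norm x) ^ N) * (\<phi> (x - y) * k y))"
    unfolding conv_def integral_mult_right_zero norm_weight_mult ..
  also have "\<dots> \<le> (LINT y|lborel. B * ((1 + norm y) ^ N * norm (k y)))"
  proof (rule Bochner_Integration.integral_norm_bound_integral)
    show "integrable lborel (\<lambda>y. complex_of_real ((1 + norm x) ^ N) * (\<phi> (x - y) * k y))"
      by (intro integrable_mult_right schwartz_conv_integrable \<phi> k)
    show "integrable lborel (\<lambda>y. B * ((1 + norm y) ^ N * norm (k y)))"
      by (intro integrable_mult_right k)
    fix y
    have "(1 + norm x) ^ N \<le> (1 + norm (x - y)) ^ N * (1 + norm y) ^ N"
      using power_mono[OF one_plus_norm_submult[of x y], of N] by (simp add: power_mult_distrib)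
    then have "(1 + norm x) ^ N * norm (\<phi> (x - y) * k y) \<le> (1 + norm (x - y)) ^ N * (1 + norm y) ^ N * norm (\<phi> (x - y) * k y)"
      by (rule mult_right_mono) auto
    also have "\<dots> = ((1 + norm (x - y)) ^ N * norm (\<phi> (x - y))) * ((1 + norm y) ^ N * norm (k y))"
      by (simp only: norm_mult mult_ac)
    also have "\<dots> \<le> B * ((1 + norm y) ^ N * norm (k y))"
      by (intro mult_right_mono B) auto
    finally show "norm (complex_of_real ((1 + norm x) ^ N) * (\<phi> (x - y) * k y)) \<le> B * ((1 + norm y) ^ N * norm (k y))"
      unfolding norm_weight_mult .
  qed
  also have "\<dots> = B * (LINT y|lborel. (1 + norm y) ^ N * norm (k y))" by (rule integral_mult_right_zero)
  finally show ?thesis .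
qed

lemma conv_schwartz:
  fixes \<phi> :: "'a::euclidean_space \<Rightarrow> complex"
  assumes \<phi>: "\<phi> \<in> schwartz" and k: "integrable lborel k" "\<And>N. integrable lborel (\<lambda>y. (1 + norm y) ^ N * norm (k y))"
  shows "conv \<phi> k \<in> schwartz"
proof (rule schwartzI)
  fix bs :: "'a list" and x and N :: nat assume bs: "bs \<in> lists Basis"
  note s = schwartz_iter_deriv[OF \<phi> bs]
  show "iter_deriv bs (conv \<phi> k) differentiable (at x)"
    unfolding iter_deriv_conv[OF \<phi> k(1) bs] using conv_has_derivative[OF s k(1)] differentiable_def by blast
  obtain B where "\<And>x. (1 + norm x) ^ N * norm (iter_deriv bs \<phi> x) \<le> B"
    by (rule schwartz_bound[OF \<phi> bs, of N]) (rule that)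
  from conv_weighted_bound[OF s this k]
  show "\<exists>B. \<forall>x. (1 + norm x) ^ N * norm (iter_deriv bs (conv \<phi> k) x) \<le> B"
    unfolding iter_deriv_conv[OF \<phi> k(1) bs] by (intro exI allI)
qed

lemma conv_approximation_bound:
  assumes \<phi>: "\<phi> \<in> schwartz"
    and B: "\<And>x y. (1 + norm x) ^ N * norm (\<phi> (x - y) - \<phi> x) \<le> B * (norm y * (1 + norm y) ^ N)"
    and k: "integrable lborel k" "(LINT y|lborel. k y) = 1" "integrable lborel (\<lambda>y. norm y * (1 + norm y) ^ N * norm (k y))"
  shows "(1 + norm x) ^ N * norm (conv \<phi> k x - \<phi> x) \<le> B * (LINT y|lborel. norm y * (1 + norm y) ^ N * norm (k y))"
proof -
  have i: "integrable lborel (\<lambda>y. (\<phi> (x - y) - \<phi> x) * k y)"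
    using schwartz_conv_integrable[OF \<phi> k(1), of x] k(1) by (simp add: left_diff_distrib)
  have "conv \<phi> k x - \<phi> x = (LINT y|lborel. (\<phi> (x - y) - \<phi> x) * k y)"
    using schwartz_conv_integrable[OF \<phi> k(1), of x] k by (simp add: conv_def left_diff_distrib)
  then have "(1 + norm x) ^ N * norm (conv \<phi> k x - \<phi> x) = norm (LINT y|lborel. complex_of_real ((1 + norm x) ^ N) * ((\<phi> (x - y) - \<phi> x) * k y))"
    unfolding integral_mult_right_zero norm_weight_mult by simp
  also have "\<dots> \<le> (LINT y|lborel. B * (norm y * (1 + norm y) ^ N * norm (k y)))"
  proof (rule Bochner_Integration.integral_norm_bound_integral)
    show "integrable lborel (\<lambda>y. complex_of_real ((1 + norm x) ^ N) * ((\<phi> (x - y) - \<phi> x) * k y))"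
      by (intro integrable_mult_right i)
    show "integrable lborel (\<lambda>y. B * (norm y * (1 + norm y) ^ N * norm (k y)))"
      by (intro integrable_mult_right k)
    fix y
    show "norm (complex_of_real ((1 + norm x) ^ N) * ((\<phi> (x - y) - \<phi> x) * k y)) \<le> B * (norm y * (1 + norm y) ^ N * norm (k y))"
      using mult_right_mono[OF B[of x y] norm_ge_zero[of "k y"]]
      unfolding norm_weight_mult by (simp only: norm_mult mult_ac)
  qed
  also have "\<dots> = B * (LINT y|lborel. norm y * (1 + norm y) ^ N * norm (k y))" by (rule integral_mult_right_zero)
  finally show ?thesis .
qed

lemma schwartz_norm_le:
  fixes \<phi> :: "'a::euclidean_space \<Rightarrow> complex"
  assumes "\<And>bs x. bs \<in> lists Basis \<Longrightarrow> length bs \<le> N \<Longrightarrow> (1 + norm x) ^ N * norm (iter_deriv bs \<phi> x) \<le> B"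
  shows "schwartz_norm N \<phi> \<le> B"
  unfolding schwartz_norm_def
proof (rule cSUP_least)
  have "([], 0) \<in> {bs \<in> lists (Basis :: 'a set). length bs \<le> N} \<times> (UNIV :: 'a set)" by simp
  then show "{bs \<in> lists (Basis :: 'a set). length bs \<le> N} \<times> (UNIV :: 'a set) \<noteq> {}"
    by (rule ex_in_conv[THEN iffD1, OF exI])
  fix p assume "p \<in> {bs \<in> lists (Basis :: 'a set). length bs \<le> N} \<times> (UNIV :: 'a set)"
  then obtain bs x where "p = (bs, x)" "bs \<in> lists Basis" "length bs \<le> N" by (cases p) simp
  with assms show "(case p of (bs, x) \<Rightarrow> (1 + norm x) ^ N * norm (iter_deriv bs \<phi> x)) \<le> B" by simp
qed

lemma finite_basis_lists: "finite {bs \<in> lists (Basis :: 'a::euclidean_space set). length bs \<le> N}"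
  using finite_lists_length_le[OF finite_Basis, of N] by (simp add: lists_eq_set)

lemma schwartz_norm_nonneg:
  fixes \<phi> :: "'a::euclidean_space \<Rightarrow> complex"
  assumes \<phi>: "\<phi> \<in> schwartz"
  shows "0 \<le> schwartz_norm N \<phi>"
proof -
  let ?S = "{bs \<in> lists (Basis :: 'a set). length bs \<le> N}"
  have fin: "finite ?S" by (rule finite_basis_lists)
  let ?P = "\<lambda>bs B. \<forall>x. (1 + norm x) ^ N * norm (iter_deriv bs \<phi> x) \<le> B"
  have "\<forall>bs\<in>?S. \<exists>B. ?P bs B"
  proof
    fix bs :: "'a list" assume "bs \<in> ?S"
    then have "bs \<in> lists Basis" by simp
    obtain B where "\<And>x. (1 + norm x) ^ N * norm (iter_deriv bs \<phi> x) \<le> B"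
      by (rule schwartz_bound[OF \<phi> \<open>bs \<in> lists Basis\<close>, of N]) (rule that)
    then show "\<exists>B. ?P bs B" by (intro exI[of _ B] allI)
  qed
  then obtain B where "\<forall>bs\<in>?S. ?P bs (B bs)"
    unfolding bchoice_iff by (elim exE)
  then have B: "\<And>bs x. bs \<in> ?S \<Longrightarrow> (1 + norm x) ^ N * norm (iter_deriv bs \<phi> x) \<le> B bs" by simp
  have "bdd_above ((\<lambda>(bs, x). (1 + norm x) ^ N * norm (iter_deriv bs \<phi> x)) ` (?S \<times> UNIV))"
  proof (rule bdd_aboveI2)
    fix p assume "p \<in> ?S \<times> (UNIV :: 'a set)"
    then obtain bs x where p: "p = (bs, x)" "bs \<in> ?S" by auto
    have "(1 + norm x) ^ N * norm (iter_deriv bs \<phi> x) \<le> B bs" by (rule B[OF p(2)])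
    also have "\<dots> \<le> Max (B ` ?S)" using fin p by (intro Max_ge) auto
    finally show "(case p of (bs, x) \<Rightarrow> (1 + norm x) ^ N * norm (iter_deriv bs \<phi> x)) \<le> Max (B ` ?S)" using p by simp
  qed
  from cSUP_upper[OF _ this, of "([], 0)"]
  have "norm (\<phi> 0) \<le> schwartz_norm N \<phi>" by (simp add: schwartz_norm_def)
  then show ?thesis using norm_ge_zero order_trans by blast
qed

text \<open>
  The normalisation preserves the integral.
\<close>

definition dilate :: "real \<Rightarrow> ('a::euclidean_space \<Rightarrow> complex) \<Rightarrow> 'a \<Rightarrow> complex" where
  "dilate c k x = complex_of_real (c ^ DIM('a)) * k (c *\<^sub>R x)"

lemma dilate_integrable: "integrable lborel k \<Longrightarrow> 0 < c \<Longrightarrow> integrable lborel (dilate c k)"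
  using lborel_integrable_affine[of k c 0] unfolding dilate_def[abs_def] by auto

lemma integral_dilate:
  assumes "k \<in> borel_measurable borel" "0 < c"
  shows "(LINT x|lborel. dilate c k x) = (LINT x|lborel. k x)"
  using lborel_integral_affine[OF assms(1), of c 0] assms(2)
  by (simp add: dilate_def scaleR_conv_of_real)

lemma integral_norm_dilate:
  assumes [measurable]: "k \<in> borel_measurable borel" and "0 < c"
  shows "(LINT x|lborel. norm (dilate c k x)) = (LINT x|lborel. norm (k x))"
  using lborel_integral_affine[of "\<lambda>x. norm (k x)" c 0] assms(2)
  by (simp add: dilate_def norm_mult norm_power)

text \<open>
  The factor \<open>norm y\<close> gains \<open>1 / c\<close>: this is the rate at which the dilates concentrate at the origin.
\<close>

lemma integral_dilate_moment:
  fixes k :: "'a::euclidean_space \<Rightarrow> complex"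
  assumes k: "k \<in> borel_measurable borel" "\<And>N. integrable lborel (\<lambda>x. (1 + norm x) ^ N * norm (k x))" and c: "1 \<le> c"
  shows "integrable lborel (\<lambda>y. norm y * (1 + norm y) ^ N * norm (dilate c k y))"
    and "(LINT y|lborel. norm y * (1 + norm y) ^ N * norm (dilate c k y)) \<le> (1 / c) * (LINT y|lborel. (1 + norm y) ^ Suc N * norm (k y))"
proof -
  define F where "F y = norm ((1/c) *\<^sub>R y) * (1 + norm ((1/c) *\<^sub>R y)) ^ N * norm (k y)" for y
  have [measurable]: "k \<in> borel_measurable borel" by fact
  have F_meas: "F \<in> borel_measurable borel" unfolding F_def by measurable
  have F_nonneg: "0 \<le> F y" for y by (simp add: F_def)
  have F_le: "F y \<le> (1/c) * ((1 + norm y) ^ Suc N * norm (k y))" for y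
  proof -
    have n: "norm ((1/c) *\<^sub>R y) = (1/c) * norm y" using c by simp
    have h1: "norm ((1/c) *\<^sub>R y) \<le> (1/c) * (1 + norm y)"
      unfolding n by (intro mult_left_mono) (use c in auto)
    have h2: "norm ((1/c) *\<^sub>R y) \<le> norm y" using c mult_right_mono[of "1/c" 1 "norm y"] by simp
    have "norm ((1/c) *\<^sub>R y) * (1 + norm ((1/c) *\<^sub>R y)) ^ N \<le> ((1/c) * (1 + norm y)) * (1 + norm y) ^ N"
      by (intro mult_mono power_mono h1 add_left_mono h2) (use c in auto)
    from mult_right_mono[OF this norm_ge_zero[of "k y"]] show ?thesis by (simp add: F_def mult_ac)
  qed
  have F_int: "integrable lborel F"
    by (rule Bochner_Integration.integrable_bound[of _ "\<lambda>y. (1/c) * ((1 + norm y) ^ Suc N * norm (k y))"])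
      (use k F_meas F_le F_nonneg c in \<open>auto simp del: power_Suc intro!: always_eventually order_trans[OF _ abs_ge_self]\<close>)
  have eq: "norm y * (1 + norm y) ^ N * norm (dilate c k y) = c ^ DIM('a) * F (0 + c *\<^sub>R y)" for y
    using c by (simp add: F_def dilate_def norm_mult norm_power)
  show "integrable lborel (\<lambda>y. norm y * (1 + norm y) ^ N * norm (dilate c k y))"
    unfolding eq by (intro integrable_mult_right lborel_integrable_affine F_int) (use c in auto)
  have "(LINT y|lborel. norm y * (1 + norm y) ^ N * norm (dilate c k y)) = (LINT y|lborel. F y)"
    unfolding eq using lborel_integral_affine[OF F_meas, of c 0] c by simp
  also have "\<dots> \<le> (LINT y|lborel. (1/c) * ((1 + norm y) ^ Suc N * norm (k y)))"
    by (intro integral_mono F_int integrable_mult_right k F_le)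
  also have "\<dots> = (1/c) * (LINT y|lborel. (1 + norm y) ^ Suc N * norm (k y))" by (rule integral_mult_right_zero)
  finally show "(LINT y|lborel. norm y * (1 + norm y) ^ N * norm (dilate c k y)) \<le> (1 / c) * (LINT y|lborel. (1 + norm y) ^ Suc N * norm (k y))" .
qed

lemma dilate_integrable_power:
  fixes k :: "'a::euclidean_space \<Rightarrow> complex"
  assumes k: "k \<in> borel_measurable borel" "\<And>N. integrable lborel (\<lambda>x. (1 + norm x) ^ N * norm (k x))" and c: "1 \<le> c"
  shows "integrable lborel (\<lambda>y. (1 + norm y) ^ N * norm (dilate c k y))"
proof -
  define F where "F y = (1 + norm ((1/c) *\<^sub>R y)) ^ N * norm (k y)" for y
  have [measurable]: "k \<in> borel_measurable borel" by fact
  have F_meas: "F \<in> borel_measurable lborel" unfolding F_def by measurable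
  have F_le: "norm (F y) \<le> norm ((1 + norm y) ^ N * norm (k y))" for y
  proof -
    have "norm ((1/c) *\<^sub>R y) \<le> norm y" using c mult_right_mono[of "1/c" 1 "norm y"] by simp
    then have "(1 + norm ((1/c) *\<^sub>R y)) ^ N * norm (k y) \<le> (1 + norm y) ^ N * norm (k y)"
      by (intro mult_right_mono power_mono) auto
    then show ?thesis unfolding F_def by (subst (1 2) real_norm_def, subst (1 2) abs_of_nonneg) auto
  qed
  have F_int: "integrable lborel F"
    by (rule Bochner_Integration.integrable_bound[OF k(2)[of N] F_meas]) (use F_le in \<open>intro always_eventually allI\<close>)
  have eq: "(1 + norm y) ^ N * norm (dilate c k y) = c ^ DIM('a) * F (0 + c *\<^sub>R y)" for y
    using c by (simp add: F_def dilate_def norm_mult norm_power)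
  show ?thesis
    unfolding eq by (intro integrable_mult_right lborel_integrable_affine F_int) (use c in auto)
qed

text \<open>
  The dilates form an approximate identity in the topology of the Schwartz space, not just pointwise;
  a tempered distribution is continuous in exactly this sense.
\<close>

lemma schwartz_norm_conv_dilate_tendsto:
  fixes \<phi> :: "'a::euclidean_space \<Rightarrow> complex"
  assumes \<phi>: "\<phi> \<in> schwartz"
    and k: "integrable lborel k" "(LINT x|lborel. k x) = 1" "\<And>N. integrable lborel (\<lambda>x. (1 + norm x) ^ N * norm (k x))"
  shows "(\<lambda>n. schwartz_norm N (\<lambda>x. conv \<phi> (dilate (2 ^ n) k) x + (- 1) * \<phi> x)) \<longlonglongrightarrow> 0"
proof -
  let ?e = "\<lambda>n x. conv \<phi> (dilate (2 ^ n) k) x + (- 1) * \<phi> x"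
  have k_meas: "k \<in> borel_measurable borel" using k(1) by auto
  let ?S = "{bs \<in> lists (Basis :: 'a set). length bs \<le> N}"
  have fin: "finite ?S" by (rule finite_basis_lists)
  let ?P = "\<lambda>bs B. \<forall>x y. (1 + norm x) ^ N * norm (iter_deriv bs \<phi> (x - y) - iter_deriv bs \<phi> x) \<le> B * (norm y * (1 + norm y) ^ N)"
  have "\<forall>bs\<in>?S. \<exists>B. ?P bs B"
  proof
    fix bs :: "'a list" assume "bs \<in> ?S"
    then have bs: "bs \<in> lists Basis" by simp
    obtain B where "\<And>x y. (1 + norm x) ^ N * norm (iter_deriv bs \<phi> (x - y) - iter_deriv bs \<phi> x) \<le> B * (norm y * (1 + norm y) ^ N)"
      by (rule schwartz_weighted_lipschitz[OF schwartz_iter_deriv[OF \<phi> bs], of N]) (rule that)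
    then show "\<exists>B. ?P bs B"
      by (intro exI[of _ B] allI)
  qed
  then obtain B where "\<forall>bs\<in>?S. ?P bs (B bs)"
    unfolding bchoice_iff by (elim exE)
  then have B: "\<And>bs x y. bs \<in> ?S \<Longrightarrow>
      (1 + norm x) ^ N * norm (iter_deriv bs \<phi> (x - y) - iter_deriv bs \<phi> x) \<le> B bs * (norm y * (1 + norm y) ^ N)"
    by simp
  define M where "M = Max (insert 0 (B ` ?S))"
  define J where "J = (LINT y|lborel. (1 + norm y) ^ Suc N * norm (k y))"
  have kd: "integrable lborel (dilate (2 ^ n) k)" for n by (intro dilate_integrable k) simp
  have "integrable lborel (\<lambda>y. (1 + norm y) ^ N * norm (dilate (2 ^ n) k y))" for n N
    by (intro dilate_integrable_power k_meas k) simp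
  then have conv_s: "conv \<phi> (dilate (2 ^ n) k) \<in> schwartz" for n by (intro conv_schwartz \<phi> kd)
  have le: "schwartz_norm N (?e n) \<le> M * J * (1/2) ^ n" for n
  proof (rule schwartz_norm_le)
    fix bs :: "'a list" and x :: 'a assume bs: "bs \<in> lists Basis" "length bs \<le> N"
    let ?k = "dilate (2 ^ n) k"
    have "iter_deriv bs (\<lambda>x. conv \<phi> ?k x + (- 1) * \<phi> x) x = conv (iter_deriv bs \<phi>) ?k x - iter_deriv bs \<phi> x"
      using iter_deriv_linear[OF conv_s \<phi> bs(1), of n "-1"] iter_deriv_conv[OF \<phi> kd bs(1)] by simp
    then have "(1 + norm x) ^ N * norm (iter_deriv bs (\<lambda>x. conv \<phi> ?k x + (- 1) * \<phi> x) x)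
        = (1 + norm x) ^ N * norm (conv (iter_deriv bs \<phi>) ?k x - iter_deriv bs \<phi> x)" by simp
    also have "\<dots> \<le> B bs * (LINT y|lborel. norm y * (1 + norm y) ^ N * norm (?k y))"
    proof (rule conv_approximation_bound)
      show "iter_deriv bs \<phi> \<in> schwartz" by (rule schwartz_iter_deriv[OF \<phi> bs(1)])
      show "(1 + norm x) ^ N * norm (iter_deriv bs \<phi> (x - y) - iter_deriv bs \<phi> x) \<le> B bs * (norm y * (1 + norm y) ^ N)" for x y
        using B bs by simp
      show "(LINT y|lborel. ?k y) = 1" using integral_dilate[OF k_meas] k(2) by simp
      show "integrable lborel (\<lambda>y. norm y * (1 + norm y) ^ N * norm (?k y))"
        by (rule integral_dilate_moment(1)[OF k_meas k(3)]) simp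
    qed (rule kd)
    also have "\<dots> \<le> M * (LINT y|lborel. norm y * (1 + norm y) ^ N * norm (?k y))"
      using bs fin by (intro mult_right_mono integral_nonneg_AE) (auto simp: M_def intro!: Max_ge)
    also have "\<dots> \<le> M * (1 / 2 ^ n * J)"
      using integral_dilate_moment(2)[OF k_meas k(3), of "2 ^ n" N] fin
      by (intro mult_left_mono) (auto simp: J_def M_def intro!: Max_ge)
    also have "\<dots> = M * J * (1/2) ^ n" by (simp add: power_one_over)
    finally show "(1 + norm x) ^ N * norm (iter_deriv bs (\<lambda>x. conv \<phi> ?k x + (- 1) * \<phi> x) x) \<le> M * J * (1/2) ^ n" .
  qed
  have nonneg: "0 \<le> schwartz_norm N (?e n)" for n
    by (intro schwartz_norm_nonneg schwartz_linear conv_s \<phi>)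
  have "(\<lambda>n. M * J * (1/2) ^ n) \<longlonglongrightarrow> M * J * 0"
    by (intro tendsto_mult tendsto_const LIMSEQ_power_zero) simp
  then have lim: "(\<lambda>n. M * J * (1/2) ^ n) \<longlonglongrightarrow> 0" by simp
  show ?thesis
    by (rule tendsto_sandwich[OF always_eventually[OF allI[OF nonneg]] always_eventually[OF allI[OF le]] tendsto_const lim])
qed

section \<open>Littlewood-Paley blocks as convolutions\<close>

lemma tendsto_cutoff_dyadic: "(\<lambda>n. cutoff w (r / 2 ^ n)) \<longlonglongrightarrow> 1"
proof -
  have "(\<lambda>n. r * (1/2) ^ n) \<longlonglongrightarrow> r * 0"
    by (intro tendsto_mult tendsto_const LIMSEQ_power_zero) simp
  then have "\<forall>\<^sub>F n in sequentially. r * (1/2) ^ n < 1"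
    by (rule order_tendstoD(2)) simp
  then have "\<forall>\<^sub>F n in sequentially. cutoff w (r / 2 ^ n) = 1"
    by eventually_elim (simp add: cutoff_def power_one_over)
  then show ?thesis by (rule tendsto_eventually)
qed

lemma lp_multiplier_eq_cutoff:
  assumes w: "lp_window w"
  shows "lp_multiplier w 0 \<xi> = cutoff w (norm \<xi>)"
    and "lp_multiplier w (Suc n) \<xi> = cutoff w (norm \<xi> / 2 ^ Suc n) - cutoff w (norm \<xi> / 2 ^ n)"
proof -
  have d: "w (norm \<xi> / 2 ^ Suc n) = cutoff w (norm \<xi> / 2 ^ Suc n) - cutoff w (norm \<xi> / 2 ^ n)" for n
    using window_eq_cutoff_diff[OF w, of "norm \<xi> / 2 ^ Suc n"] by simp
  then show "lp_multiplier w (Suc n) \<xi> = cutoff w (norm \<xi> / 2 ^ Suc n) - cutoff w (norm \<xi> / 2 ^ n)"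
    by (simp add: lp_multiplier_def)
  have "(\<lambda>k. w (norm \<xi> / 2 ^ Suc k)) sums (1 - cutoff w (norm \<xi> / 2 ^ 0))"
    unfolding d by (rule telescope_sums[OF tendsto_cutoff_dyadic])
  then show "lp_multiplier w 0 \<xi> = cutoff w (norm \<xi>)"
    using sums_unique by (fastforce simp: lp_multiplier_def)
qed

text \<open>
  The low-pass multiplier at scale \<open>n + 1\<close> equals \<open>1\<close> wherever the multiplier of block \<open>n\<close> is nonzero.
\<close>

lemma lp_multiplier_absorb:
  assumes w: "lp_window w"
  shows "lp_multiplier w n \<xi> * cutoff w (norm \<xi> / 2 ^ Suc n) = lp_multiplier w n \<xi>"
proof (cases "norm \<xi> \<le> 2 ^ Suc n")
  case True
  then show ?thesis by (simp add: cutoff_def)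
next
  case False
  then have "2 \<le> norm \<xi> / 2 ^ n" by (simp add: field_simps)
  then have "lp_multiplier w n \<xi> = 0"
    using lp_multiplier_eq_cutoff(1)[OF w, of \<xi>] cutoff_eq_0[OF w] lp_window_eq_0[OF w]
    by (cases n) (auto simp: lp_multiplier_def)
  then show ?thesis by simp
qed

abbreviation low_pass :: "(real \<Rightarrow> real) \<Rightarrow> nat \<Rightarrow> real \<times> real \<Rightarrow> complex" where
  "low_pass w n \<xi> \<equiv> complex_of_real (cutoff w (norm \<xi> / 2 ^ n))"

lemma continuous_on_low_pass:
  assumes "lp_window w"
  shows "continuous_on UNIV (low_pass w n)"
proof -
  have "continuous_on UNIV (\<lambda>\<xi> :: real \<times> real. (1 / 2 ^ n) *\<^sub>R \<xi>)" by (intro continuous_intros)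
  from continuous_on_compose2[OF continuous_on_cutoff_norm[OF assms] this]
  show ?thesis by simp
qed

lemma low_pass_eq_0: "lp_window w \<Longrightarrow> 2 ^ Suc n < norm \<xi> \<Longrightarrow> low_pass w n \<xi> = 0"
  by (simp add: cutoff_eq_0 field_simps)

lemma fourier_low_pass:
  assumes w: "lp_window w"
  shows "complex_of_real (1 / (2 * pi)\<^sup>2) * fourier (low_pass w n) x = dilate (2 ^ n) (lp_kernel w) x"
proof -
  let ?h = "\<lambda>\<zeta>. cis (- (\<zeta> \<bullet> (2 ^ n *\<^sub>R x))) * complex_of_real (cutoff w (norm \<zeta>))"
  have m: "?h \<in> borel_measurable borel"
    by (intro borel_measurable_continuous_onI continuous_intros continuous_on_cutoff_norm w)
  have "fourier (low_pass w n) x = (LINT \<xi>|lborel. ?h (0 + (1 / 2 ^ n) *\<^sub>R \<xi>))"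
    unfolding fourier_def by simp
  also have "\<dots> = (2 ^ n) ^ DIM(real \<times> real) *\<^sub>R (LINT \<zeta>|lborel. ?h \<zeta>)"
    by (subst lborel_integral_affine[OF m]) (simp_all add: power_divide)
  finally show ?thesis
    by (simp add: dilate_def lp_kernel_def fourier_def scaleR_conv_of_real)
qed

definition smoothing :: "(real \<Rightarrow> real) \<Rightarrow> nat \<Rightarrow> (real \<times> real \<Rightarrow> complex) \<Rightarrow> real \<times> real \<Rightarrow> complex" where
  "smoothing w n \<phi> = conv \<phi> (dilate (2 ^ n) (lp_kernel w))"

lemma smoothing_kernel_integrable:
  "lp_window w \<Longrightarrow> integrable lborel (dilate (2 ^ n) (lp_kernel w))"
  by (intro dilate_integrable lp_kernel_integrable) simp_all

lemma smoothing_schwartz: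
  assumes w: "lp_window w" and \<phi>: "\<phi> \<in> schwartz"
  shows "smoothing w n \<phi> \<in> schwartz"
  unfolding smoothing_def
  by (intro conv_schwartz \<phi> smoothing_kernel_integrable w dilate_integrable_power
      lp_kernel_measurable lp_kernel_integrable_power) simp

lemma conv_reflect:
  assumes [measurable]: "\<phi> \<in> borel_measurable borel" "k \<in> borel_measurable borel"
  shows "conv \<phi> k x = (LINT y|lborel. \<phi> y * k (x - y))"
proof -
  have "(\<lambda>y. \<phi> y * k (x - y)) \<in> borel_measurable borel" by measurable
  from lborel_integral_reflect[OF this, of x] show ?thesis by (simp add: conv_def)
qed

lemma fourier_low_pass_mult:
  assumes w: "lp_window w" and \<phi>: "\<phi> \<in> schwartz"
  shows "fourier (\<lambda>\<xi>. low_pass w n \<xi> * fourier_inv \<phi> \<xi>) = smoothing w n \<phi>"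
proof
  fix x
  let ?k = "dilate (2 ^ n) (lp_kernel w)"
  have i: "integrable lborel (low_pass w n)"
    by (rule integrable_compact_support[OF continuous_on_low_pass[OF w] low_pass_eq_0[OF w]])
  have [measurable]: "\<phi> \<in> borel_measurable borel" "?k \<in> borel_measurable borel"
    using schwartz_measurable[OF \<phi>] smoothing_kernel_integrable[OF w, of n] by auto
  have "fourier (\<lambda>\<xi>. low_pass w n \<xi> * fourier_inv \<phi> \<xi>) x = (LINT y|lborel. \<phi> y * ?k (x - y))"
    unfolding fourier_mult_fourier_inv[OF i schwartz_integrable[OF \<phi>]] fourier_low_pass[OF w] ..
  also have "\<dots> = smoothing w n \<phi> x"
    unfolding smoothing_def by (rule conv_reflect[symmetric]) measurable
  finally show "fourier (\<lambda>\<xi>. low_pass w n \<xi> * fourier_inv \<phi> \<xi>) x = smoothing w n \<phi> x" .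
qed

lemma
  assumes w: "lp_window w" and \<phi>: "\<phi> \<in> schwartz"
  shows continuous_on_low_pass_mult: "continuous_on UNIV (\<lambda>\<xi>. low_pass w n \<xi> * fourier_inv \<phi> \<xi>)"
    and integrable_low_pass_mult: "integrable lborel (\<lambda>\<xi>. low_pass w n \<xi> * fourier_inv \<phi> \<xi>)"
proof -
  show c: "continuous_on UNIV (\<lambda>\<xi>. low_pass w n \<xi> * fourier_inv \<phi> \<xi>)"
    by (rule continuous_on_mult[OF continuous_on_low_pass[OF w] continuous_on_fourier(2)[OF schwartz_integrable[OF \<phi>]]])
  show "integrable lborel (\<lambda>\<xi>. low_pass w n \<xi> * fourier_inv \<phi> \<xi>)"
    by (rule integrable_compact_support[OF c, of "2 ^ Suc n"]) (simp only: low_pass_eq_0[OF w] mult_zero_left)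
qed

lemma lp_block_apply:
  "lp_block w f n \<phi> = f (fourier (\<lambda>\<xi>. complex_of_real (lp_multiplier w n \<xi>) * fourier_inv \<phi> \<xi>))"
  by (simp add: lp_block_def dist_fourier_inv_def dist_mult_def dist_fourier_def)

lemma lp_block_0:
  assumes w: "lp_window w" and \<phi>: "\<phi> \<in> schwartz"
  shows "lp_block w f 0 \<phi> = f (smoothing w 0 \<phi>)"
  using fourier_low_pass_mult[OF assms, of 0] by (simp add: lp_block_apply lp_multiplier_eq_cutoff(1)[OF w])

lemma lp_block_Suc:
  assumes w: "lp_window w" and \<phi>: "\<phi> \<in> schwartz"
  shows "lp_block w f (Suc n) \<phi> = f (\<lambda>x. smoothing w (Suc n) \<phi> x + (- 1) * smoothing w n \<phi> x)"
proof -
  have "fourier (\<lambda>\<xi>. complex_of_real (lp_multiplier w (Suc n) \<xi>) * fourier_inv \<phi> \<xi>) x =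
      smoothing w (Suc n) \<phi> x + (- 1) * smoothing w n \<phi> x" for x
  proof -
    have i: "integrable lborel (\<lambda>\<xi>. cis (- (\<xi> \<bullet> x)) * (low_pass w n \<xi> * fourier_inv \<phi> \<xi>))" for n
      by (rule integrable_cis_mult(4)[OF integrable_low_pass_mult[OF assms]])
    have "fourier (\<lambda>\<xi>. complex_of_real (lp_multiplier w (Suc n) \<xi>) * fourier_inv \<phi> \<xi>) x =
        (LINT \<xi>|lborel. cis (- (\<xi> \<bullet> x)) * (low_pass w (Suc n) \<xi> * fourier_inv \<phi> \<xi>)
          - cis (- (\<xi> \<bullet> x)) * (low_pass w n \<xi> * fourier_inv \<phi> \<xi>))"
      unfolding fourier_def lp_multiplier_eq_cutoff(2)[OF w] of_real_diff
      by (simp only: left_diff_distrib right_diff_distrib)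
    also have "\<dots> = fourier (\<lambda>\<xi>. low_pass w (Suc n) \<xi> * fourier_inv \<phi> \<xi>) x
        - fourier (\<lambda>\<xi>. low_pass w n \<xi> * fourier_inv \<phi> \<xi>) x"
      unfolding fourier_def by (rule Bochner_Integration.integral_diff[OF i i])
    finally show ?thesis
      by (simp only: fourier_low_pass_mult[OF assms] mult_minus1 diff_conv_add_uminus)
  qed
  then have "fourier (\<lambda>\<xi>. complex_of_real (lp_multiplier w (Suc n) \<xi>) * fourier_inv \<phi> \<xi>) =
      (\<lambda>x. smoothing w (Suc n) \<phi> x + (- 1) * smoothing w n \<phi> x)" by (rule ext)
  then show ?thesis unfolding lp_block_apply by (rule arg_cong)
qed

text \<open>
  A block is reproduced by the smoothing one scale above. The outer multiplier absorbs the low-pass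
  multiplier once the transforms in between have been cancelled by Fourier inversion.
\<close>

lemma lp_block_smoothing:
  assumes w: "lp_window w" and \<phi>: "\<phi> \<in> schwartz"
  shows "lp_block w f n (smoothing w (Suc n) \<phi>) = lp_block w f n \<phi>"
proof -
  let ?u = "\<lambda>\<xi>. low_pass w (Suc n) \<xi> * fourier_inv \<phi> \<xi>"
  have z: "?u \<xi> = 0" if "2 ^ Suc (Suc n) < norm \<xi>" for \<xi>
    by (simp only: low_pass_eq_0[OF w that] mult_zero_left)
  obtain B where B: "\<And>\<xi>. norm (?u \<xi>) \<le> B"
    by (rule bounded_compact_support[OF continuous_on_low_pass_mult[OF assms] z]) (assumption, rule that)
  have "fourier ?u = smoothing w (Suc n) \<phi>" by (rule fourier_low_pass_mult[OF assms])
  moreover have "integrable lborel (fourier ?u)"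
    unfolding fourier_low_pass_mult[OF assms] by (rule schwartz_integrable[OF smoothing_schwartz[OF assms]])
  ultimately have inv: "fourier_inv (smoothing w (Suc n) \<phi>) \<xi> = ?u \<xi>" for \<xi>
    using fourier_inversion[OF integrable_low_pass_mult[OF assms, of "Suc n"] continuous_on_low_pass_mult[OF assms] B, of \<xi>]
    by simp
  have "complex_of_real (lp_multiplier w n \<xi>) * fourier_inv (smoothing w (Suc n) \<phi>) \<xi> =
      complex_of_real (lp_multiplier w n \<xi>) * fourier_inv \<phi> \<xi>" for \<xi>
  proof -
    have "complex_of_real (lp_multiplier w n \<xi>) * low_pass w (Suc n) \<xi> = complex_of_real (lp_multiplier w n \<xi>)"
      unfolding of_real_mult[symmetric] lp_multiplier_absorb[OF w] ..
    then show ?thesis unfolding inv by (simp only: mult.assoc[symmetric])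
  qed
  then have "(\<lambda>\<xi>. complex_of_real (lp_multiplier w n \<xi>) * fourier_inv (smoothing w (Suc n) \<phi>) \<xi>) =
      (\<lambda>\<xi>. complex_of_real (lp_multiplier w n \<xi>) * fourier_inv \<phi> \<xi>)" by (rule ext)
  then show ?thesis unfolding lp_block_apply by (rule arg_cong)
qed

lemma tempered_add:
  assumes "tempered f" "\<phi> \<in> schwartz" "\<psi> \<in> schwartz"
  shows "f (\<lambda>x. \<phi> x + \<psi> x) = f \<phi> + f \<psi>"
proof -
  have "\<forall>\<phi>\<in>schwartz. \<forall>\<psi>\<in>schwartz. f (\<lambda>x. \<phi> x + \<psi> x) = f \<phi> + f \<psi>"
    using assms(1) unfolding tempered_def by (elim conjE)
  from bspec[OF bspec[OF this assms(2)] assms(3)] show ?thesis .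
qed

lemma tempered_scale:
  assumes "tempered f" "\<phi> \<in> schwartz"
  shows "f (\<lambda>x. c * \<phi> x) = c * f \<phi>"
proof -
  have "\<forall>\<phi>\<in>schwartz. \<forall>c. f (\<lambda>x. c * \<phi> x) = c * f \<phi>"
    using assms(1) unfolding tempered_def by (elim conjE)
  from spec[OF bspec[OF this assms(2)], of c] show ?thesis .
qed

lemma schwartz_zero: "(\<lambda>_. 0) \<in> schwartz"
proof -
  have z: "iter_deriv bs (\<lambda>_. 0 :: complex) = (\<lambda>_. 0)" for bs :: "'a list"
    by (induction bs) auto
  show ?thesis by (rule schwartzI) (auto simp: z)
qed

lemma schwartz_scale:
  assumes "\<phi> \<in> schwartz"
  shows "(\<lambda>x. c * \<phi> x) \<in> schwartz"
  using schwartz_linear[OF schwartz_zero assms, of c] by simp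

lemma tempered_diff:
  assumes "tempered f" "\<phi> \<in> schwartz" "\<psi> \<in> schwartz"
  shows "f (\<lambda>x. \<phi> x + (- 1) * \<psi> x) = f \<phi> - f \<psi>"
  using tempered_add[OF assms(1,2) schwartz_scale[OF assms(3), of "- 1"]] tempered_scale[OF assms(1,3), of "- 1"]
  by simp

text \<open>
  The partial sums of the blocks telescope to \<open>f\<close> applied to smoothings of the test function.
\<close>

lemma lp_block_sums:
  assumes w: "lp_window w" and f: "tempered f" and \<phi>: "\<phi> \<in> schwartz"
  shows "(\<lambda>n. lp_block w f n \<phi>) sums f \<phi>"
proof -
  let ?e = "\<lambda>n x. smoothing w n \<phi> x + (- 1) * \<phi> x"
  note s = smoothing_schwartz[OF w \<phi>]
  have partial: "(\<Sum>i<Suc n. lp_block w f i \<phi>) = f (smoothing w n \<phi>)" for n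
  proof (induction n)
    case 0
    then show ?case by (simp add: lp_block_0[OF w \<phi>])
  next
    case (Suc n)
    have "lp_block w f (Suc n) \<phi> = f (smoothing w (Suc n) \<phi>) - f (smoothing w n \<phi>)"
      unfolding lp_block_Suc[OF w \<phi>] by (rule tempered_diff[OF f s s])
    with Suc show ?case by simp
  qed
  obtain N K where K: "\<forall>\<phi>\<in>schwartz. norm (f \<phi>) \<le> K * schwartz_norm N \<phi>"
    using f unfolding tempered_def by (elim conjE exE)
  have "norm (f (smoothing w n \<phi>) - f \<phi>) \<le> K * schwartz_norm N (?e n)" for n
    using bspec[OF K schwartz_linear[OF s \<phi>, of n "- 1"]] unfolding tempered_diff[OF f s \<phi>] .
  then have le: "\<forall>\<^sub>F n in sequentially. norm (f (smoothing w n \<phi>) - f \<phi>) \<le> K * schwartz_norm N (?e n)"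
    by (intro always_eventually allI)
  have "(\<lambda>n. K * schwartz_norm N (?e n)) \<longlonglongrightarrow> K * 0"
    unfolding smoothing_def
    by (intro tendsto_mult tendsto_const schwartz_norm_conv_dilate_tendsto \<phi> lp_kernel_integrable w
        integral_lp_kernel lp_kernel_integrable_power)
  then have lim: "(\<lambda>n. K * schwartz_norm N (?e n)) \<longlonglongrightarrow> 0"
    by (simp only: mult_zero_right)
  have "(\<lambda>n. f (smoothing w n \<phi>) - f \<phi>) \<longlonglongrightarrow> 0"
    by (rule Lim_null_comparison[OF le lim])
  then have "(\<lambda>n. f (smoothing w n \<phi>)) \<longlonglongrightarrow> f \<phi>" by (rule LIM_zero_cancel)
  then show ?thesis
    unfolding sums_def by (subst filterlim_sequentially_Suc[symmetric]) (simp only: partial)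
qed

section \<open>Lipschitz representatives\<close>

lemma dilate_L1_lipschitz:
  fixes k :: "'a::euclidean_space \<Rightarrow> complex"
  assumes k: "k \<in> borel_measurable borel"
    and L: "\<And>a. (LINT x|lborel. norm (k (x - a) - k x)) \<le> L * norm a" and c: "0 < c"
  shows "(LINT x|lborel. norm (dilate c k (x - y) - dilate c k (x - z))) \<le> L * c * norm (y - z)"
proof -
  have [measurable]: "k \<in> borel_measurable borel" by fact
  let ?g = "\<lambda>u. norm (k (u - c *\<^sub>R (y - z)) - k u)"
  have "norm (dilate c k (x - y) - dilate c k (x - z)) = c ^ DIM('a) * ?g (- (c *\<^sub>R z) + c *\<^sub>R x)" for x
  proof -
    have "- (c *\<^sub>R z) + c *\<^sub>R x - c *\<^sub>R (y - z) = c *\<^sub>R (x - y)" "- (c *\<^sub>R z) + c *\<^sub>R x = c *\<^sub>R (x - z)"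
      by (simp_all add: algebra_simps)
    then have g: "?g (- (c *\<^sub>R z) + c *\<^sub>R x) = norm (k (c *\<^sub>R (x - y)) - k (c *\<^sub>R (x - z)))" by (simp only:)
    have "dilate c k (x - y) - dilate c k (x - z) = complex_of_real (c ^ DIM('a)) * (k (c *\<^sub>R (x - y)) - k (c *\<^sub>R (x - z)))"
      unfolding dilate_def by (rule right_diff_distrib[symmetric])
    then show ?thesis unfolding g using c by (simp add: norm_mult norm_power)
  qed
  then have "(LINT x|lborel. norm (dilate c k (x - y) - dilate c k (x - z))) =
      c ^ DIM('a) * (LINT x|lborel. ?g (- (c *\<^sub>R z) + c *\<^sub>R x))"
    by simp
  also have "\<dots> = (LINT u|lborel. ?g u)"
    by (subst lborel_integral_affine) (use c in auto)
  also have "\<dots> \<le> L * norm (c *\<^sub>R (y - z))" by (rule L)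
  finally show ?thesis using c by (simp add: mult_ac)
qed

text \<open>
  Changing a representative on a null set is harmless and makes it bounded everywhere.
\<close>

lemma bounded_representative:
  assumes h: "represents h u" and bd: "AE x in lborel. norm (h x) \<le> H" and H: "0 \<le> H"
  obtains h' where "represents h' u" "\<And>x. norm (h' x) \<le> H"
proof -
  define h' where "h' x = (if norm (h x) \<le> H then h x else 0)" for x
  have hm [measurable]: "h \<in> borel_measurable lborel" using h unfolding represents_def by (rule conjunct1)
  have h'm [measurable]: "h' \<in> borel_measurable lborel" unfolding h'_def by measurable
  have ae: "AE x in lborel. h x * \<phi> x = h' x * \<phi> x" for \<phi>
    using bd by eventually_elim (simp add: h'_def)
  have "represents h' u"
    unfolding represents_def
  proof (intro conjI ballI h'm)
    fix \<phi> :: "real \<times> real \<Rightarrow> complex" assume \<phi>: "\<phi> \<in> schwartz"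
    have [measurable]: "\<phi> \<in> borel_measurable lborel" using schwartz_measurable[OF \<phi>] by simp
    have m: "(\<lambda>x. h x * \<phi> x) \<in> borel_measurable lborel" "(\<lambda>x. h' x * \<phi> x) \<in> borel_measurable lborel"
      by measurable
    from h have *: "integrable lborel (\<lambda>x. h x * \<phi> x) \<and> u \<phi> = (LINT x|lborel. h x * \<phi> x)"
      unfolding represents_def using \<phi> by (elim conjE) (erule bspec)
    show "integrable lborel (\<lambda>x. h' x * \<phi> x)"
      using * by (subst integrable_cong_AE[OF m ae, symmetric]) (rule conjunct1)
    have "(LINT x|lborel. h x * \<phi> x) = (LINT x|lborel. h' x * \<phi> x)"
      by (rule integral_cong_AE[OF m ae])
    with * show "u \<phi> = (LINT x|lborel. h' x * \<phi> x)" by simp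
  qed
  then show thesis
    by (rule that) (use H in \<open>simp add: h'_def\<close>)
qed

lemma representsD:
  assumes "represents g u" "\<phi> \<in> schwartz"
  shows "integrable lborel (\<lambda>x. g x * \<phi> x)" "u \<phi> = (LINT x|lborel. g x * \<phi> x)"
  using assms by (simp_all add: represents_def)

text \<open>
  Bernstein's inequality for a block: by the reproducing property a representative may be convolved
  with the dilated kernel, and the Lipschitz bound in mean of the kernel, scaled by \<open>2 ^ Suc n\<close>,
  becomes a Lipschitz bound for the result.
\<close>

lemma lp_block_lipschitz_representative:
  assumes w: "lp_window w"
    and h: "represents h (lp_block w f n)" and bd: "\<And>x. norm (h x) \<le> H"
    and L: "\<And>a. (LINT x|lborel. norm (lp_kernel w (x - a) - lp_kernel w x)) \<le> L * norm a"
  obtains g where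
    "\<And>x. norm (g x) \<le> H * (LINT x|lborel. norm (lp_kernel w x))"
    "\<And>x y. norm (g x - g y) \<le> 2 ^ Suc n * H * L * norm (x - y)"
    "\<And>\<phi>. \<phi> \<in> schwartz \<Longrightarrow> lp_block w f n \<phi> = (LINT x|lborel. g x * \<phi> x)"
proof -
  let ?k = "dilate (2 ^ Suc n) (lp_kernel w)"
  define g where "g y = (LINT x|lborel. h x * ?k (x - y))" for y
  have h_meas [measurable]: "h \<in> borel_measurable borel" using h by (simp add: represents_def)
  have k: "integrable lborel ?k" by (rule smoothing_kernel_integrable[OF w])
  have k_meas [measurable]: "?k \<in> borel_measurable borel" using k by auto
  have H: "0 \<le> H" by (rule order_trans[OF norm_ge_zero bd])
  have kt: "integrable lborel (\<lambda>x. ?k (x - y))" for y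
    using lborel_integrable_affine[OF k, of 1 "- y"] by simp
  have knorm: "(LINT x|lborel. norm (?k (x - y))) = (LINT x|lborel. norm (lp_kernel w x))" for y
  proof -
    have "(LINT x|lborel. norm (?k (x - y))) = (LINT x|lborel. norm (?k x))"
      using lborel_integral_affine[OF measurable_compose[OF k_meas borel_measurable_norm], of 1 "- y"] by simp
    also have "\<dots> = (LINT x|lborel. norm (lp_kernel w x))"
      by (intro integral_norm_dilate lp_kernel_measurable w) simp
    finally show ?thesis .
  qed
  have hk: "integrable lborel (\<lambda>x. h x * ?k (x - y))" for y
  proof (rule Bochner_Integration.integrable_bound)
    show "integrable lborel (\<lambda>x. H * norm (?k (x - y)))" by (intro integrable_mult_right integrable_norm kt)
    show "(\<lambda>x. h x * ?k (x - y)) \<in> borel_measurable lborel" by measurable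
    show "AE x in lborel. norm (h x * ?k (x - y)) \<le> norm (H * norm (?k (x - y)))"
      using bd H by (intro always_eventually allI) (simp add: norm_mult mult_right_mono)
  qed
  have b1: "norm (g y) \<le> H * (LINT x|lborel. norm (lp_kernel w x))" for y
  proof -
    have "norm (g y) \<le> (LINT x|lborel. H * norm (?k (x - y)))"
      unfolding g_def
    proof (rule Bochner_Integration.integral_norm_bound_integral[OF hk])
      show "integrable lborel (\<lambda>x. H * norm (?k (x - y)))" by (intro integrable_mult_right integrable_norm kt)
      show "norm (h x * ?k (x - y)) \<le> H * norm (?k (x - y))" for x
        unfolding norm_mult by (intro mult_right_mono bd norm_ge_zero)
    qed
    then show ?thesis unfolding integral_mult_right_zero knorm .
  qed
  have b2: "norm (g y - g z) \<le> 2 ^ Suc n * H * L * norm (y - z)" for y z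
  proof -
    have "g y - g z = (LINT x|lborel. h x * (?k (x - y) - ?k (x - z)))"
      unfolding g_def right_diff_distrib by (rule Bochner_Integration.integral_diff[OF hk hk, symmetric])
    also have "norm \<dots> \<le> (LINT x|lborel. H * norm (?k (x - y) - ?k (x - z)))"
    proof (rule Bochner_Integration.integral_norm_bound_integral)
      show "integrable lborel (\<lambda>x. h x * (?k (x - y) - ?k (x - z)))"
        unfolding right_diff_distrib by (intro Bochner_Integration.integrable_diff hk)
      show "integrable lborel (\<lambda>x. H * norm (?k (x - y) - ?k (x - z)))"
        by (intro integrable_mult_right integrable_norm Bochner_Integration.integrable_diff kt)
      show "norm (h x * (?k (x - y) - ?k (x - z))) \<le> H * norm (?k (x - y) - ?k (x - z))" for x
        unfolding norm_mult by (intro mult_right_mono bd norm_ge_zero)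
    qed
    also have "\<dots> = H * (LINT x|lborel. norm (?k (x - y) - ?k (x - z)))" by (rule integral_mult_right_zero)
    also have "\<dots> \<le> H * (L * 2 ^ Suc n * norm (y - z))"
      by (intro mult_left_mono H dilate_L1_lipschitz lp_kernel_measurable w L) simp
    finally show ?thesis by (simp only: mult_ac)
  qed
  have b3: "lp_block w f n \<phi> = (LINT y|lborel. g y * \<phi> y)" if \<phi>: "\<phi> \<in> schwartz" for \<phi>
  proof -
    have [measurable]: "\<phi> \<in> borel_measurable borel" by (rule schwartz_measurable[OF \<phi>])
    have F: "integrable (lborel \<Otimes>\<^sub>M lborel) (\<lambda>(y, x). h x * (\<phi> y * ?k (x - y)))"
    proof (rule Bochner_Integration.integrable_bound)
      show "integrable (lborel \<Otimes>\<^sub>M lborel) (\<lambda>z. H * norm (case z of (y, x) \<Rightarrow> \<phi> y * ?k (x - y)))"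
        by (intro integrable_mult_right integrable_norm integrable_pair_convolution schwartz_integrable \<phi> k)
      show "(\<lambda>(y, x). h x * (\<phi> y * ?k (x - y))) \<in> borel_measurable (lborel \<Otimes>\<^sub>M lborel)" by measurable
      show "AE z in lborel \<Otimes>\<^sub>M lborel. norm (case z of (y, x) \<Rightarrow> h x * (\<phi> y * ?k (x - y)))
          \<le> norm (H * norm (case z of (y, x) \<Rightarrow> \<phi> y * ?k (x - y)))"
      proof (intro always_eventually allI)
        fix z :: "(real \<times> real) \<times> (real \<times> real)"
        obtain y x where z: "z = (y, x)" by (cases z)
        show "norm (case z of (y, x) \<Rightarrow> h x * (\<phi> y * ?k (x - y))) \<le> norm (H * norm (case z of (y, x) \<Rightarrow> \<phi> y * ?k (x - y)))"
          using mult_right_mono[OF bd[of x] norm_ge_zero[of "\<phi> y * ?k (x - y)"]] H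
          unfolding z prod.case norm_mult[of "h x"] by (simp add: abs_mult)
      qed
    qed
    have "lp_block w f n \<phi> = lp_block w f n (smoothing w (Suc n) \<phi>)"
      by (rule lp_block_smoothing[OF w \<phi>, symmetric])
    also have "\<dots> = (LINT x|lborel. h x * smoothing w (Suc n) \<phi> x)"
      by (rule representsD(2)[OF h smoothing_schwartz[OF w \<phi>]])
    also have "\<dots> = (LINT x|lborel. LINT y|lborel. h x * (\<phi> y * ?k (x - y)))"
    proof (rule Bochner_Integration.integral_cong[OF refl])
      fix x
      have "smoothing w (Suc n) \<phi> x = (LINT y|lborel. \<phi> y * ?k (x - y))"
        unfolding smoothing_def by (rule conv_reflect) measurable
      then show "h x * smoothing w (Suc n) \<phi> x = (LINT y|lborel. h x * (\<phi> y * ?k (x - y)))"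
        by (simp only: integral_mult_right_zero)
    qed
    also have "\<dots> = (LINT y|lborel. LINT x|lborel. h x * (\<phi> y * ?k (x - y)))"
      using lborel_pair.Fubini_integral[OF F] .
    also have "\<dots> = (LINT y|lborel. g y * \<phi> y)"
    proof (rule Bochner_Integration.integral_cong[OF refl])
      fix y
      have "(LINT x|lborel. h x * (\<phi> y * ?k (x - y))) = (LINT x|lborel. (h x * ?k (x - y)) * \<phi> y)"
        by (simp only: mult_ac)
      then show "(LINT x|lborel. h x * (\<phi> y * ?k (x - y))) = g y * \<phi> y"
        by (simp only: integral_mult_left_zero g_def)
    qed
    finally show ?thesis .
  qed
  show thesis by (rule that[OF b1 b2 b3])
qed

lemma continuous_on_of_lipschitz_bound:
  fixes g :: "'a::real_normed_vector \<Rightarrow> 'b::real_normed_vector"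
  assumes "\<And>x y. norm (g x - g y) \<le> D * norm (x - y)" "0 \<le> D"
  shows "continuous_on UNIV g"
  using assms by (intro lipschitz_on_continuous_on[of D] lipschitz_onI) (auto simp: dist_norm)

text \<open>
  The block estimates are summed. Each block is represented within \<open>B * (1/4) ^ n\<close> of its norm, a
  slack that is summable even after the weights \<open>2 ^ n\<close>; it is positive because \<open>B\<close> is.
\<close>

lemma lipschitz_representative:
  assumes w: "lp_window w"
  obtains C where "0 < C"
    "\<And>f B. f \<in> besov w \<Longrightarrow> 0 < B \<Longrightarrow> enn2real (besov_norm w f) \<le> B \<Longrightarrow>
      \<exists>g. represents g f \<and> (\<forall>x. norm (g x) \<le> C * B) \<and> (\<forall>x y. norm (g x - g y) \<le> C * B * norm (x - y))"
proof -
  obtain L where L0: "0 \<le> L" and L: "\<And>a. (LINT x|lborel. norm (lp_kernel w (x - a) - lp_kernel w x)) \<le> L * norm a"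
    by (rule lp_kernel_L1_lipschitz[OF w]) (rule that)
  define A where "A = (LINT x|lborel. norm (lp_kernel w x))"
  have A0: "0 \<le> A" by (simp add: A_def)
  define C where "C = 3 * (A + 2 * L) + 1"
  have C: "0 < C" using A0 L0 by (simp add: C_def)
  have "\<exists>g. represents g f \<and> (\<forall>x. norm (g x) \<le> C * B) \<and> (\<forall>x y. norm (g x - g y) \<le> C * B * norm (x - y))"
    if f: "f \<in> besov w" and B: "0 < B" and fB: "enn2real (besov_norm w f) \<le> B" for f B
  proof -
    have temp: "tempered f" and fin: "besov_norm w f < \<infinity>" using f by (simp_all add: besov_def)
    define b where "b n = enn2real (dist_Linf_norm (lp_block w f n))" for n
    have fin_n: "2 ^ n * dist_Linf_norm (lp_block w f n) < \<infinity>" for n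
    proof -
      have "2 ^ n * dist_Linf_norm (lp_block w f n) \<le> besov_norm w f"
        unfolding besov_norm_def using sum_le_suminf[OF summableI, of "{n}"] by simp
      then show ?thesis using fin by (rule order_le_less_trans)
    qed
    have Linf: "dist_Linf_norm (lp_block w f n) = ennreal (b n)" for n
    proof -
      have "dist_Linf_norm (lp_block w f n) \<noteq> \<infinity>"
        using fin_n[of n] by (intro notI) (simp add: ennreal_mult_top)
      then show ?thesis by (simp add: b_def less_top)
    qed
    have b0: "0 \<le> b n" for n by (simp add: b_def)
    have term_eq: "2 ^ n * dist_Linf_norm (lp_block w f n) = ennreal (2 ^ n * b n)" for n
      unfolding Linf using b0[of n] by (simp add: ennreal_mult ennreal_power[symmetric])
    have norm_eq: "besov_norm w f = (\<Sum>n. ennreal (2 ^ n * b n))"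
      unfolding besov_norm_def term_eq ..
    have sb: "summable (\<lambda>n. 2 ^ n * b n)"
      by (rule summable_suminf_not_top) (use b0 fin norm_eq in auto)
    have "besov_norm w f = ennreal (\<Sum>n. 2 ^ n * b n)"
      unfolding norm_eq by (rule suminf_ennreal2) (use b0 sb in auto)
    then have sum_b: "(\<Sum>n. 2 ^ n * b n) \<le> B"
      using fB b0 suminf_nonneg[OF sb] by simp
    define H where "H n = b n + B * (1/4) ^ n" for n
    have H0: "0 \<le> H n" for n using b0 B by (simp add: H_def)
    have H_eq: "2 ^ n * H n = 2 ^ n * b n + B * (1/2) ^ n" for n
    proof -
      have "(2::real) ^ n * (1/4) ^ n = (1/2) ^ n" by (subst power_mult_distrib[symmetric]) simp
      then show ?thesis by (simp add: H_def algebra_simps)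
    qed
    have geo: "summable (\<lambda>n. B * (1/2::real) ^ n)" "(\<Sum>n. B * (1/2::real) ^ n) = 2 * B"
      by (simp_all add: summable_mult suminf_mult suminf_geometric)
    have sH: "summable (\<lambda>n. 2 ^ n * H n)" unfolding H_eq by (intro summable_add sb geo)
    have sum_H: "(\<Sum>n. 2 ^ n * H n) \<le> 3 * B"
      unfolding H_eq using suminf_add[OF sb geo(1)] sum_b geo(2) by simp
    have ex_h: "\<exists>h. represents h (lp_block w f n) \<and> (\<forall>x. norm (h x) \<le> H n)" for n
    proof -
      have "b n < H n" using B by (simp add: H_def)
      then have "dist_Linf_norm (lp_block w f n) < ennreal (H n)"
        unfolding Linf using b0 by (simp add: ennreal_less_iff)
      then obtain h where h: "represents h (lp_block w f n)"
        and e: "esssup lborel (\<lambda>x. ennreal (norm (h x))) < ennreal (H n)"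
        unfolding dist_Linf_norm_def INF_less_iff by auto
      have "AE x in lborel. ennreal (norm (h x)) \<le> esssup lborel (\<lambda>x. ennreal (norm (h x)))"
        by (rule esssup_AE)
      then have "AE x in lborel. norm (h x) \<le> H n"
      proof eventually_elim
        case (elim x)
        then have "ennreal (norm (h x)) \<le> ennreal (H n)" using e by (meson less_imp_le order_trans)
        then show ?case using H0 by (simp add: ennreal_le_iff)
      qed
      from bounded_representative[OF h this H0] obtain h' where "represents h' (lp_block w f n)" "\<And>x. norm (h' x) \<le> H n"
        by blast
      then show ?thesis by blast
    qed
    let ?P = "\<lambda>n g. (\<forall>x. norm (g x) \<le> H n * A) \<and> (\<forall>x y. norm (g x - g y) \<le> 2 ^ Suc n * H n * L * norm (x - y)) \<and>
        (\<forall>\<phi>\<in>schwartz. lp_block w f n \<phi> = (LINT x|lborel. g x * \<phi> x))"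
    have "\<forall>n. \<exists>g. ?P n g"
    proof
      fix n
      from ex_h[of n] obtain h where h: "represents h (lp_block w f n)" "\<forall>x. norm (h x) \<le> H n" by (elim exE conjE)
      show "\<exists>g. ?P n g"
        unfolding A_def
        by (rule lp_block_lipschitz_representative[OF w h(1) spec[OF h(2)] L]) (intro exI conjI allI ballI)
    qed
    from choice[OF this] obtain g where "\<forall>n. ?P n (g n)"
      by (elim exE)
    then have g_bd: "\<And>n x. norm (g n x) \<le> H n * A"
      and g_lip: "\<And>n x y. norm (g n x - g n y) \<le> 2 ^ Suc n * H n * L * norm (x - y)"
      and g_rep: "\<And>n \<phi>. \<phi> \<in> schwartz \<Longrightarrow> lp_block w f n \<phi> = (LINT x|lborel. g n x * \<phi> x)"
      by (simp_all del: split_paired_All)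
    have g_bd': "norm (g n x) \<le> 2 ^ n * H n * A" for n x
    proof -
      have "1 * H n \<le> 2 ^ n * H n" by (intro mult_right_mono H0) simp
      then have "H n * A \<le> 2 ^ n * H n * A" by (intro mult_right_mono A0) simp
      with g_bd show ?thesis by (rule order_trans)
    qed
    have sHA: "summable (\<lambda>n. 2 ^ n * H n * A)" by (rule summable_mult2[OF sH])
    have sg: "summable (\<lambda>n. norm (g n x))" for x
      by (rule summable_comparison_test'[OF sHA, of 0]) (simp add: g_bd')
    have sg': "summable (\<lambda>n. g n x)" for x by (rule summable_norm_cancel[OF sg])
    define G where "G x = (\<Sum>n. g n x)" for x
    have G_bd: "norm (G x) \<le> C * B" for x
    proof -
      have "norm (G x) \<le> (\<Sum>n. norm (g n x))" unfolding G_def by (rule summable_norm[OF sg])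
      also have "\<dots> \<le> (\<Sum>n. 2 ^ n * H n * A)" by (rule suminf_le[OF g_bd' sg sHA])
      also have "\<dots> = (\<Sum>n. 2 ^ n * H n) * A" by (rule suminf_mult2[OF sH, symmetric])
      also have "\<dots> \<le> 3 * B * A" by (intro mult_right_mono sum_H A0)
      also have "\<dots> \<le> C * B" using A0 L0 B by (simp add: C_def algebra_simps)
      finally show ?thesis .
    qed
    have G_lip: "norm (G x - G y) \<le> C * B * norm (x - y)" for x y
    proof -
      let ?d = "2 * L * norm (x - y)"
      have s2: "summable (\<lambda>n. 2 ^ n * H n * ?d)" by (rule summable_mult2[OF sH])
      have le: "norm (g n x - g n y) \<le> 2 ^ n * H n * ?d" for n
        using g_lip[of n x y] by (simp add: mult_ac)
      have s1: "summable (\<lambda>n. norm (g n x - g n y))"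
        by (rule summable_comparison_test'[OF s2, of 0]) (simp only: le real_norm_def abs_norm_cancel)
      have "G x - G y = (\<Sum>n. g n x - g n y)" unfolding G_def by (rule suminf_diff[OF sg' sg'])
      also have "norm \<dots> \<le> (\<Sum>n. norm (g n x - g n y))" by (rule summable_norm[OF s1])
      also have "\<dots> \<le> (\<Sum>n. 2 ^ n * H n * ?d)" by (rule suminf_le[OF le s1 s2])
      also have "\<dots> = (\<Sum>n. 2 ^ n * H n) * ?d" by (rule suminf_mult2[OF sH, symmetric])
      also have "\<dots> \<le> 3 * B * ?d" by (intro mult_right_mono sum_H) (simp add: L0)
      also have "\<dots> = (3 * B * (2 * L)) * norm (x - y)" by (simp only: mult_ac)
      also have "\<dots> \<le> C * B * norm (x - y)"
        using A0 L0 B by (intro mult_right_mono) (simp_all add: C_def algebra_simps)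
      finally show ?thesis .
    qed
    have CB: "0 \<le> C * B" using C B by simp
    have G_cont: "continuous_on UNIV G" by (rule continuous_on_of_lipschitz_bound[OF G_lip CB])
    have g_cont: "continuous_on UNIV (g n)" for n
      by (rule continuous_on_of_lipschitz_bound[OF g_lip]) (intro mult_nonneg_nonneg H0 L0 zero_le_power, simp)
    have "represents G f"
      unfolding represents_def
    proof (intro conjI ballI)
      show "G \<in> borel_measurable lborel" using borel_measurable_continuous_onI[OF G_cont] by simp
      fix \<phi> :: "real \<times> real \<Rightarrow> complex" assume \<phi>: "\<phi> \<in> schwartz"
      note \<phi>i = schwartz_integrable[OF \<phi>]
      show "integrable lborel (\<lambda>x. G x * \<phi> x)"
        by (rule integrable_mult_bounded_continuous[OF \<phi>i G_cont G_bd])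
      have gi: "integrable lborel (\<lambda>x. g n x * \<phi> x)" for n
        by (rule integrable_mult_bounded_continuous[OF \<phi>i g_cont g_bd])
      have sgp: "summable (\<lambda>n. norm (g n x * \<phi> x))" for x
        unfolding norm_mult by (rule summable_mult2[OF sg])
      have int_le: "(LINT x|lborel. norm (g n x * \<phi> x)) \<le> 2 ^ n * H n * (A * (LINT x|lborel. norm (\<phi> x)))" for n
      proof -
        have "(LINT x|lborel. norm (g n x * \<phi> x)) \<le> (LINT x|lborel. 2 ^ n * H n * A * norm (\<phi> x))"
        proof (rule integral_mono)
          show "integrable lborel (\<lambda>x. norm (g n x * \<phi> x))" by (rule integrable_norm[OF gi])
          show "integrable lborel (\<lambda>x. 2 ^ n * H n * A * norm (\<phi> x))"
            by (rule integrable_mult_right[OF integrable_norm[OF \<phi>i]])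
          show "norm (g n x * \<phi> x) \<le> 2 ^ n * H n * A * norm (\<phi> x)" for x
            unfolding norm_mult by (rule mult_right_mono[OF g_bd' norm_ge_zero])
        qed
        then show ?thesis by (simp only: integral_mult_right_zero mult.assoc)
      qed
      have sint: "summable (\<lambda>n. LINT x|lborel. norm (g n x * \<phi> x))"
      proof (rule summable_comparison_test'[OF summable_mult2[OF sH], of 0])
        fix n
        show "norm (LINT x|lborel. norm (g n x * \<phi> x)) \<le> 2 ^ n * H n * (A * (LINT x|lborel. norm (\<phi> x)))"
          using int_le[of n] by (simp add: abs_of_nonneg)
      qed
      have "(\<lambda>n. LINT x|lborel. g n x * \<phi> x) sums (LINT x|lborel. (\<Sum>n. g n x * \<phi> x))"
        by (rule sums_integral[OF gi _ sint]) (simp add: sgp)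
      moreover have "(\<Sum>n. g n x * \<phi> x) = G x * \<phi> x" for x
        unfolding G_def by (rule suminf_mult2[OF sg', symmetric])
      ultimately have "(\<lambda>n. lp_block w f n \<phi>) sums (LINT x|lborel. G x * \<phi> x)"
        by (simp only: g_rep[OF \<phi>])
      with lp_block_sums[OF w temp \<phi>] show "f \<phi> = (LINT x|lborel. G x * \<phi> x)"
        by (rule sums_unique2)
    qed
    with G_bd G_lip show ?thesis by (intro exI[of _ G] conjI allI)
  qed
  with C show thesis by (rule that)
qed

section \<open>Haagerup norms of functions with decay and a Lipschitz bound in one variable\<close>

text \<open>
  Enumerating the index type is harmless because the sum converges unconditionally.
\<close>

lemma haagerup_of_countable_family:
  fixes \<phi> \<psi> :: "'i::countable \<Rightarrow> real \<Rightarrow> complex"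
  assumes inf: "infinite (UNIV :: 'i set)"
    and meas: "\<And>i. \<phi> i \<in> borel_measurable borel" "\<And>i. \<psi> i \<in> borel_measurable borel"
    and A: "\<And>F x. finite F \<Longrightarrow> (\<Sum>i\<in>F. (norm (\<phi> i x))\<^sup>2) \<le> A"
    and B: "\<And>F x. finite F \<Longrightarrow> (\<Sum>i\<in>F. (norm (\<psi> i x))\<^sup>2) \<le> B"
    and sum: "\<And>x y. ((\<lambda>i. \<phi> i x * \<psi> i y) has_sum \<Phi> (x, y)) UNIV"
  shows "\<Phi> \<in> haagerup" and "haagerup_norm \<Phi> \<le> sqrt (A * B)"
proof -
  define e where "e = from_nat_into (UNIV :: 'i set)"
  have bij: "bij_betw e UNIV UNIV"
    unfolding e_def by (intro bij_betw_from_nat_into inf) auto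
  then have inj: "inj e" by (rule bij_betw_imp_inj_on)
  have sup: "sup_sq_sum (\<lambda>n. f (e n)) \<le> ennreal D"
    if D: "\<And>F x. finite F \<Longrightarrow> (\<Sum>i\<in>F. (norm (f i x))\<^sup>2) \<le> D"
    for f :: "'i \<Rightarrow> real \<Rightarrow> complex" and D
    unfolding sup_sq_sum_def
  proof (rule SUP_least, rule suminf_le_const)
    fix x :: real and n :: nat
    have "(\<Sum>i<n. ennreal ((norm (f (e i) x))\<^sup>2)) = ennreal (\<Sum>i<n. (norm (f (e i) x))\<^sup>2)"
      by (rule sum_ennreal) auto
    also have "(\<Sum>i<n. (norm (f (e i) x))\<^sup>2) = (\<Sum>i\<in>e ` {..<n}. (norm (f i x))\<^sup>2)"
      by (subst sum.reindex) (use inj in \<open>auto simp: inj_on_def\<close>)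
    also have "\<dots> \<le> D" by (rule D) auto
    finally show "(\<Sum>i<n. ennreal ((norm (f (e i) x))\<^sup>2)) \<le> ennreal D"
      by (simp add: ennreal_leI)
  qed auto
  have bdd: "f i \<in> bounded_borel"
    if "\<And>F x. finite F \<Longrightarrow> (\<Sum>i\<in>F. (norm (f i x))\<^sup>2) \<le> D" "\<And>i. f i \<in> borel_measurable borel"
    for f :: "'i \<Rightarrow> real \<Rightarrow> complex" and D i
  proof -
    have "norm (f i x) \<le> sqrt D" for x
      using that(1)[of "{i}" x] by (auto intro: real_le_rsqrt)
    then show ?thesis using that(2) by (auto simp: bounded_borel_def bounded_iff)
  qed
  have rep: "haagerup_rep (\<lambda>n. \<phi> (e n)) (\<lambda>n. \<psi> (e n)) \<Phi>"
    unfolding haagerup_rep_def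
  proof (intro conjI allI)
    show "\<phi> (e n) \<in> bounded_borel" for n by (rule bdd[OF A meas(1)])
    show "\<psi> (e n) \<in> bounded_borel" for n by (rule bdd[OF B meas(2)])
    show "sup_sq_sum (\<lambda>n. \<phi> (e n)) < \<infinity>" using sup[of \<phi> A, OF A] by (simp add: order_le_less_trans)
    show "sup_sq_sum (\<lambda>n. \<psi> (e n)) < \<infinity>" using sup[of \<psi> B, OF B] by (simp add: order_le_less_trans)
    show "(\<lambda>n. \<phi> (e n) x * \<psi> (e n) y) sums \<Phi> (x, y)" for x y
      using sum[of x y] has_sum_reindex_bij_betw[OF bij, of "\<lambda>i. \<phi> i x * \<psi> i y"]
      by (intro has_sum_imp_sums) simp
  qed
  then show "\<Phi> \<in> haagerup" by (auto simp: haagerup_def)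
  have A0: "0 \<le> A" and B0: "0 \<le> B" using A[of "{}"] B[of "{}"] by auto
  have "haagerup_norm \<Phi> \<le> sqrt (enn2real (sup_sq_sum (\<lambda>n. \<phi> (e n)) * sup_sq_sum (\<lambda>n. \<psi> (e n))))"
    unfolding haagerup_norm_def
    by (intro cInf_lower) (use rep in \<open>auto intro!: bdd_belowI[of _ 0]\<close>)
  also have "\<dots> \<le> sqrt (enn2real (ennreal A * ennreal B))"
    by (intro real_sqrt_le_mono enn2real_mono mult_mono sup A B)
      (auto simp: ennreal_mult[symmetric] A0 B0)
  also have "\<dots> = sqrt (A * B)" using A0 B0 by (simp add: enn2real_mult)
  finally show "haagerup_norm \<Phi> \<le> sqrt (A * B)" .
qed

lemma bounded_sum_inverse_square_int:
  obtains S where "0 < S" "\<And>Q :: int set. finite Q \<Longrightarrow> (\<Sum>q\<in>Q. 1 / (1 + (real_of_int q)\<^sup>2)) \<le> S"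
proof
  let ?v = "\<lambda>q::int. 1 / (1 + (real_of_int q)\<^sup>2)"
  let ?f = "\<lambda>n::nat. 1 / (1 + (real n)\<^sup>2)"
  have sm: "summable ?f"
  proof (rule summable_comparison_test')
    show "summable (\<lambda>n. inverse (real n ^ 2))" by (rule inverse_power_summable) simp
    show "norm (?f n) \<le> inverse (real n ^ 2)" if "n \<ge> 1" for n
      using that by (auto simp: field_simps add_pos_nonneg)
  qed
  have pos: "0 \<le> ?f n" for n by simp
  show "0 < 2 * suminf ?f"
    using suminf_pos2[OF sm pos, of 0] by simp
  fix Q :: "int set" assume "finite Q"
  define N where "N = Suc (nat (Max (insert 0 (abs ` Q))))"
  have "\<bar>q\<bar> \<le> Max (insert 0 (abs ` Q))" if "q \<in> Q" for q
    using \<open>finite Q\<close> that by (intro Max_ge) auto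
  then have bd: "nat \<bar>q\<bar> < N" if "q \<in> Q" for q
    using that unfolding N_def by (auto simp: less_Suc_eq_le intro!: nat_mono)
  have sub: "Q \<subseteq> int ` {..<N} \<union> (\<lambda>n. - int n) ` {..<N}"
  proof
    fix q assume "q \<in> Q"
    then show "q \<in> int ` {..<N} \<union> (\<lambda>n. - int n) ` {..<N}"
      using bd[of q] by (cases "q \<ge> 0") (auto intro!: image_eqI[of _ _ "nat \<bar>q\<bar>"])
  qed
  have "(\<Sum>q\<in>Q. ?v q) \<le>
      (\<Sum>q\<in>int ` {..<N} \<union> (\<lambda>n. - int n) ` {..<N}. ?v q)"
    by (rule sum_mono2) (use sub in auto)
  also have "\<dots> \<le> (\<Sum>q\<in>int ` {..<N}. ?v q)
                  + (\<Sum>q\<in>(\<lambda>n. - int n) ` {..<N}. ?v q)"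
    by (subst sum_Un) (auto intro!: sum_nonneg)
  also have "\<dots> = (\<Sum>n<N. ?f n) + (\<Sum>n<N. ?f n)"
    by (subst (1 2) sum.reindex) (auto simp: inj_on_def)
  also have "\<dots> \<le> 2 * suminf ?f"
    using sum_le_suminf[OF sm, of "{..<N}"] pos by auto
  finally show "(\<Sum>q\<in>Q. ?v q) \<le> 2 * suminf ?f" .
qed

text \<open>
  Let \<open>P\<^sub>j t\<close> be the largest multiple of \<open>2\<^sup>-\<^sup>j\<close> not exceeding \<open>t\<close>. Then \<open>H (s, t)\<close> is \<open>H (s, P\<^sub>0 t)\<close> plus
  the sum over \<open>j \<ge> 1\<close> of the increments \<open>H (s, P\<^sub>j t) - H (s, P\<^sub>j\<^sub>-\<^sub>1 t)\<close>. Each summand is a sum of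
  products of a function of \<open>s\<close> and the indicator of a dyadic interval of \<open>t\<close>. In a unit interval \<open>[q, q + 1)\<close>
  there are \<open>2\<^sup>j\<close> increments of level \<open>j\<close>, each of size \<open>D 2\<^sup>-\<^sup>j\<close> times \<open>(1 + q\<^sup>2)\<^sup>-\<^sup>1\<^sup>/\<^sup>2\<close>, so their squares sum to
  a multiple of \<open>D\<^sup>2 2\<^sup>-\<^sup>j\<close>. This leaves room for weights \<open>a j\<close> that make the squares of the indicators,
  of which one per level is nonzero, summable as well.
\<close>

lemma haagerup_of_decaying_lipschitz:
  obtains C where "C > 0"
    and "\<And>H D. (\<And>t. (\<lambda>s. H (s, t)) \<in> borel_measurable borel) \<Longrightarrow> 0 \<le> D \<Longrightarrow>
      (\<And>s t. norm (H (s, t)) \<le> D / sqrt (1 + t\<^sup>2)) \<Longrightarrow>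
      (\<And>s t t'. norm (H (s, t) - H (s, t')) \<le> D * \<bar>t - t'\<bar> / sqrt (1 + t\<^sup>2)) \<Longrightarrow>
      H \<in> haagerup \<and> haagerup_norm H \<le> C * D"
proof -
  obtain S where S: "0 < S"
    "\<And>Q :: int set. finite Q \<Longrightarrow> (\<Sum>q\<in>Q. 1 / (1 + (real_of_int q)\<^sup>2)) \<le> S"
    using bounded_sum_inverse_square_int by blast
  show thesis
  proof (rule that[of "sqrt (36 * S)"])
    show "0 < sqrt (36 * S)" using S by simp
    fix H :: "real \<times> real \<Rightarrow> complex" and D :: real
    assume meas [measurable]: "\<And>t. (\<lambda>s. H (s, t)) \<in> borel_measurable borel" and D: "0 \<le> D"
      and dec: "\<And>s t. norm (H (s, t)) \<le> D / sqrt (1 + t\<^sup>2)"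
      and lip: "\<And>s t t'. norm (H (s, t) - H (s, t')) \<le> D * \<bar>t - t'\<bar> / sqrt (1 + t\<^sup>2)"
    let ?v = "\<lambda>q::int. 1 / (1 + (real_of_int q)\<^sup>2)"
    define \<tau> :: "nat \<Rightarrow> int \<Rightarrow> nat \<Rightarrow> real" where "\<tau> j q r = q + r / 2 ^ j" for j q r
    \<comment> \<open>The point \<open>r\<close> of level \<open>j\<close> has parent \<open>r div 2\<close> of level \<open>j - 1\<close>; for \<open>r \<ge> 2\<^sup>j\<close> the index is void.\<close>
    define \<Delta> :: "nat \<Rightarrow> int \<Rightarrow> nat \<Rightarrow> real \<Rightarrow> complex" where
      "\<Delta> j q r s = (if r < 2 ^ j
         then H (s, \<tau> j q r) - (if j = 0 then 0 else H (s, \<tau> j q (2 * (r div 2)))) else 0)" for j q r s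
    \<comment> \<open>Any ratio strictly between 1 and 2 would serve in place of 3/2.\<close>
    define a :: "nat \<Rightarrow> real" where "a j = sqrt ((3/2) ^ j)" for j
    define I :: "nat \<Rightarrow> int \<Rightarrow> nat \<Rightarrow> real set" where
      "I j q r = (if r < 2 ^ j then {\<tau> j q r ..< \<tau> j q (Suc r)} else {})" for j q r
    define \<phi> :: "nat \<times> int \<times> nat \<Rightarrow> real \<Rightarrow> complex" where
      "\<phi> = (\<lambda>(j, q, r) s. a j * \<Delta> j q r s)"
    define \<psi> :: "nat \<times> int \<times> nat \<Rightarrow> real \<Rightarrow> complex" where
      "\<psi> = (\<lambda>(j, q, r) t. complex_of_real (indicator (I j q r) t / a j))"
    define R :: "nat \<Rightarrow> real \<Rightarrow> nat" where "R j t = nat \<lfloor>2 ^ j * (t - \<lfloor>t\<rfloor>)\<rfloor>" for j t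
    have a_pos: "a j > 0" and a_sq: "(a j)\<^sup>2 = (3/2) ^ j" for j by (auto simp: a_def)
    have R_less: "R j t < 2 ^ j" for j t
    proof -
      have "2 ^ j * (t - \<lfloor>t\<rfloor>) < 2 ^ j * 1"
      proof (rule mult_strict_left_mono)
        show "t - \<lfloor>t\<rfloor> < 1" by linarith
      qed simp
      then have "\<lfloor>2 ^ j * (t - \<lfloor>t\<rfloor>)\<rfloor> < 2 ^ j" by (simp add: floor_less_iff)
      then show ?thesis unfolding R_def by (simp add: nat_less_iff)
    qed
    have R_bounds: "\<tau> j \<lfloor>t\<rfloor> (R j t) \<le> t" "t < \<tau> j \<lfloor>t\<rfloor> (Suc (R j t))" for j t
    proof -
      define z where "z = 2 ^ j * (t - \<lfloor>t\<rfloor>)"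
      have z: "0 \<le> z" using floor_correct[of t] by (simp add: z_def)
      have tz: "t = \<lfloor>t\<rfloor> + z / 2 ^ j" by (simp add: z_def)
      have r: "real (R j t) \<le> z" "z < real (Suc (R j t))"
        using z unfolding R_def z_def[symmetric] by linarith+
      show "\<tau> j \<lfloor>t\<rfloor> (R j t) \<le> t"
        by (subst (2) tz) (use r in \<open>auto simp: \<tau>_def divide_right_mono\<close>)
      show "t < \<tau> j \<lfloor>t\<rfloor> (Suc (R j t))"
        by (subst (1) tz) (use r in \<open>auto simp: \<tau>_def divide_strict_right_mono simp del: of_nat_Suc\<close>)
    qed
    have mem_I: "t \<in> I j q r \<longleftrightarrow> (q, r) = (\<lfloor>t\<rfloor>, R j t)" for t j q r
    proof
      assume "t \<in> I j q r"
      then have r: "r < 2 ^ j" and t: "\<tau> j q r \<le> t" "t < \<tau> j q (Suc r)"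
        by (auto simp: I_def split: if_splits)
      have "real (Suc r) \<le> 2 ^ j" using r by (metis Suc_leI of_nat_le_iff of_nat_numeral of_nat_power)
      then have "real (Suc r) / 2 ^ j \<le> 1" by simp
      then have "real_of_int q \<le> t" "t < q + 1"
        using t by (auto simp: \<tau>_def simp del: of_nat_Suc intro: order_trans[rotated] order_less_le_trans)
      then have q: "\<lfloor>t\<rfloor> = q" by (simp add: floor_unique)
      have "real r \<le> 2 ^ j * (t - q)" "2 ^ j * (t - q) < real r + 1"
        using t by (auto simp: \<tau>_def field_simps)
      then have "\<lfloor>2 ^ j * (t - q)\<rfloor> = int r" by (intro floor_unique) auto
      then show "(q, r) = (\<lfloor>t\<rfloor>, R j t)" using q by (simp add: R_def)
    next
      assume "(q, r) = (\<lfloor>t\<rfloor>, R j t)"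
      then show "t \<in> I j q r" using R_less R_bounds[where t = t and j = j] by (auto simp: I_def)
    qed
    \<comment> \<open>The mesh halves at each level, so an increment is at most \<open>D 2\<^sup>-\<^sup>j\<close> times the decay on \<open>[q, q+1)\<close>.\<close>
    have \<Delta>_sq: "(norm (\<Delta> j q r s))\<^sup>2 \<le> 3 * D\<^sup>2 * (1/4) ^ j * ?v q" for j q r s
    proof (cases "r < 2 ^ j")
      case True
      let ?t = "\<tau> j q r"
      have n1: "norm (\<Delta> j q r s) \<le> D * (1/2) ^ j / sqrt (1 + ?t\<^sup>2)"
      proof (cases "j = 0")
        case False
        have "\<bar>?t - \<tau> j q (2 * (r div 2))\<bar> = (r mod 2) / 2 ^ j"
        proof -
          have "real r = 2 * real (r div 2) + real (r mod 2)"
            by (metis mult_div_mod_eq of_nat_add of_nat_mult of_nat_numeral)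
          then have "?t - \<tau> j q (2 * (r div 2)) = (r mod 2) / 2 ^ j"
            by (simp add: \<tau>_def diff_divide_distrib[symmetric])
          then show ?thesis by simp
        qed
        also have "\<dots> \<le> 1 / 2 ^ j" by (intro divide_right_mono) (auto simp: le_less_Suc_eq)
        finally have "D * \<bar>?t - \<tau> j q (2 * (r div 2))\<bar> \<le> D * (1/2) ^ j"
          using D by (intro mult_left_mono) (auto simp: power_one_over)
        then have "D * \<bar>?t - \<tau> j q (2 * (r div 2))\<bar> / sqrt (1 + ?t\<^sup>2) \<le> D * (1/2) ^ j / sqrt (1 + ?t\<^sup>2)"
          by (intro divide_right_mono) auto
        with lip[of s ?t "\<tau> j q (2 * (r div 2))"] show ?thesis
          using True False by (simp add: \<Delta>_def)
      qed (use True dec in \<open>auto simp: \<Delta>_def\<close>)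
      have "real r / 2 ^ j < 1" using True by (simp add: of_nat_less_numeral_power_cancel_iff)
      then have t: "real_of_int q \<le> ?t" "?t \<le> q + 1" by (auto simp: \<tau>_def)
      have "(1 + (real_of_int q)\<^sup>2) / 3 \<le> 1 + ?t\<^sup>2"
      proof (cases "q \<ge> 0")
        case True
        then have "(real_of_int q)\<^sup>2 \<le> ?t\<^sup>2" using t by (intro power_mono) auto
        moreover have "(1 + x) / 3 \<le> 1 + y" if "x \<le> y" "0 \<le> y" for x y :: real
          using that by simp
        ultimately show ?thesis using zero_le_power2[of ?t] by blast
      next
        case False
        then have "real_of_int q + 1 \<le> 0" by linarith
        then have "(real_of_int q + 1)\<^sup>2 \<le> ?t\<^sup>2"
          using t by (subst abs_le_square_iff[symmetric]) auto
        moreover have "(1 + (real_of_int q)\<^sup>2) / 3 \<le> 1 + (real_of_int q + 1)\<^sup>2"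
          using zero_le_power2[of "2 * real_of_int q + 3"] by (simp add: power2_eq_square field_simps)
        ultimately show ?thesis by linarith
      qed
      then have "1 / (1 + ?t\<^sup>2) \<le> 3 * ?v q"
        by (simp add: field_simps add_pos_nonneg)
      have "(norm (\<Delta> j q r s))\<^sup>2 \<le> (D * (1/2) ^ j / sqrt (1 + ?t\<^sup>2))\<^sup>2"
        by (intro power_mono n1) auto
      also have "\<dots> = D\<^sup>2 * (1/4) ^ j * (1 / (1 + ?t\<^sup>2))"
        by (simp add: power_divide power_mult_distrib power_one_over flip: power_mult)
          (simp add: power_mult mult.commute[of j])
      also have "\<dots> \<le> D\<^sup>2 * (1/4) ^ j * (3 * ?v q)"
        by (intro mult_left_mono) (use \<open>1 / (1 + ?t\<^sup>2) \<le> _\<close> in auto)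
      finally show ?thesis by (simp add: mult_ac)
    qed (auto simp: \<Delta>_def)
    have box: "\<exists>J Q K. finite Q \<and> F \<subseteq> {..<J} \<times> Q \<times> {..<K}" if "finite F" for F :: "(nat \<times> int \<times> nat) set"
    proof -
      have "finite (fst ` F)" "finite (fst ` snd ` F)" "finite (snd ` snd ` F)" using that by auto
      then obtain J K where "\<forall>j\<in>fst ` F. j < J" "\<forall>j\<in>snd ` snd ` F. j < K"
        by (meson finite_nat_set_iff_bounded)
      then have "F \<subseteq> {..<J} \<times> (fst ` snd ` F) \<times> {..<K}"
        by (auto simp: image_image) (auto intro!: rev_image_eqI)
      moreover have "finite (fst ` snd ` F)" using that by simp
      ultimately show ?thesis by (intro exI conjI)
    qed
    have A: "(\<Sum>i\<in>F. (norm (\<phi> i s))\<^sup>2) \<le> 12 * S * D\<^sup>2" if fin: "finite F" for F s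
    proof -
      obtain J Q K where Q: "finite Q" and F: "F \<subseteq> {..<J} \<times> Q \<times> {..<K}" using box[OF fin] by blast
      define c where "c j q = 3 * D\<^sup>2 * (3/8) ^ j * ?v q" for j :: nat and q
      have c0: "0 \<le> c j q" for j q by (simp add: c_def)
      have le: "(norm (\<phi> (j, q, r) s))\<^sup>2 \<le> (if r < 2 ^ j then c j q else 0)" for j q r
      proof (cases "r < 2 ^ j")
        case True
        have "(norm (\<phi> (j, q, r) s))\<^sup>2 = (3/2) ^ j * (norm (\<Delta> j q r s))\<^sup>2"
          using a_pos by (simp add: \<phi>_def norm_mult power_mult_distrib a_sq)
        also have "\<dots> \<le> (3/2) ^ j * (3 * D\<^sup>2 * (1/4) ^ j * ?v q)"
          by (intro mult_left_mono \<Delta>_sq) auto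
        also have "\<dots> = ((3/2) ^ j * (1/4) ^ j) * (3 * D\<^sup>2 * ?v q)"
          by (simp only: mult_ac)
        also have "(3/2) ^ j * (1/4) ^ j = (3/8 :: real) ^ j"
          by (subst power_mult_distrib[symmetric]) simp
        finally show ?thesis using True by (simp add: c_def mult_ac)
      qed (auto simp: \<phi>_def \<Delta>_def)
      have "(\<Sum>i\<in>F. (norm (\<phi> i s))\<^sup>2) \<le> (\<Sum>i\<in>{..<J} \<times> Q \<times> {..<K}. (norm (\<phi> i s))\<^sup>2)"
        by (rule sum_mono2) (use F Q in auto)
      also have "\<dots> = (\<Sum>j<J. \<Sum>q\<in>Q. \<Sum>r<K. (norm (\<phi> (j, q, r) s))\<^sup>2)"
        by (simp add: sum.cartesian_product case_prod_unfold)
      also have "\<dots> \<le> (\<Sum>j<J. \<Sum>q\<in>Q. 2 ^ j * c j q)"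
      proof (intro sum_mono)
        fix j q
        have "(\<Sum>r<K. (norm (\<phi> (j, q, r) s))\<^sup>2) \<le> (\<Sum>r<K. if r < 2 ^ j then c j q else 0)"
          by (intro sum_mono le)
        also have "\<dots> = (\<Sum>r\<in>{..<K} \<inter> {..<2 ^ j}. c j q)"
          by (subst sum.inter_restrict) auto
        also have "\<dots> = real (card ({..<K} \<inter> {..<2 ^ j})) * c j q" by simp
        also have "\<dots> \<le> 2 ^ j * c j q"
        proof (intro mult_right_mono c0)
          have "card ({..<K} \<inter> {..<2 ^ j}) \<le> card {..<2 ^ j :: nat}" by (rule card_mono) auto
          then show "real (card ({..<K} \<inter> {..<2 ^ j})) \<le> 2 ^ j"
            by (metis card_lessThan of_nat_le_iff of_nat_numeral of_nat_power)
        qed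
        finally show "(\<Sum>r<K. (norm (\<phi> (j, q, r) s))\<^sup>2) \<le> 2 ^ j * c j q" .
      qed
      also have "\<dots> = (\<Sum>j<J. 3 * D\<^sup>2 * (3/4) ^ j * (\<Sum>q\<in>Q. ?v q))"
      proof (intro sum.cong refl)
        fix j :: nat
        have "(2::real) ^ j * (3/8) ^ j = (3/4) ^ j" by (subst power_mult_distrib[symmetric]) simp
        then have "2 ^ j * c j q = 3 * D\<^sup>2 * (3/4) ^ j * ?v q" for q
          by (simp add: c_def mult_ac)
        then show "(\<Sum>q\<in>Q. 2 ^ j * c j q) = 3 * D\<^sup>2 * (3/4) ^ j * (\<Sum>q\<in>Q. ?v q)"
          by (simp add: sum_distrib_left)
      qed
      also have "\<dots> \<le> (\<Sum>j<J. 3 * D\<^sup>2 * (3/4) ^ j * S)"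
        by (intro sum_mono mult_left_mono S Q) auto
      also have "\<dots> = 3 * D\<^sup>2 * S * (\<Sum>j<J. (3/4) ^ j)" by (simp add: sum_distrib_left mult_ac)
      also have "\<dots> \<le> 3 * D\<^sup>2 * S * 4"
      proof (intro mult_left_mono)
        show "(\<Sum>j<J. (3/4 :: real) ^ j) \<le> 4"
          using sum_le_suminf[OF summable_geometric[of "3/4::real"], of "{..<J}"]
          by (simp add: suminf_geometric)
      qed (use S in auto)
      finally show ?thesis by (simp add: mult_ac)
    qed
    have B: "(\<Sum>i\<in>F. (norm (\<psi> i t))\<^sup>2) \<le> 3" if fin: "finite F" for F t
    proof -
      obtain J Q K where Q: "finite Q" and F: "F \<subseteq> {..<J} \<times> Q \<times> {..<K}" using box[OF fin] by blast
      have eq: "(norm (\<psi> (j, q, r) t))\<^sup>2 = (if r = R j t then if q = \<lfloor>t\<rfloor> then (2/3) ^ j else 0 else 0)" for j q r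
        by (auto simp: \<psi>_def mem_I indicator_def norm_divide power_divide a_sq)
      have "(\<Sum>i\<in>F. (norm (\<psi> i t))\<^sup>2) \<le> (\<Sum>i\<in>{..<J} \<times> Q \<times> {..<K}. (norm (\<psi> i t))\<^sup>2)"
        by (rule sum_mono2) (use F Q in auto)
      also have "\<dots> = (\<Sum>j<J. \<Sum>q\<in>Q. \<Sum>r<K. (norm (\<psi> (j, q, r) t))\<^sup>2)"
        by (simp add: sum.cartesian_product case_prod_unfold)
      also have "\<dots> \<le> (\<Sum>j<J. (2/3) ^ j)"
      proof (intro sum_mono)
        fix j
        have "(\<Sum>r<K. (norm (\<psi> (j, q, r) t))\<^sup>2) \<le> (if q = \<lfloor>t\<rfloor> then (2/3) ^ j else 0)" for q
          unfolding eq by (subst sum.delta) auto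
        then have "(\<Sum>q\<in>Q. \<Sum>r<K. (norm (\<psi> (j, q, r) t))\<^sup>2) \<le> (\<Sum>q\<in>Q. if q = \<lfloor>t\<rfloor> then (2/3) ^ j else 0)"
          by (intro sum_mono)
        also have "\<dots> \<le> (2/3) ^ j" using Q by (subst sum.delta) auto
        finally show "(\<Sum>q\<in>Q. \<Sum>r<K. (norm (\<psi> (j, q, r) t))\<^sup>2) \<le> (2/3) ^ j" .
      qed
      also have "\<dots> \<le> 3"
        using sum_le_suminf[OF summable_geometric[of "2/3::real"], of "{..<J}"]
        by (simp add: suminf_geometric)
      finally show ?thesis .
    qed
    have sum: "((\<lambda>i. \<phi> i s * \<psi> i t) has_sum H (s, t)) UNIV" for s t
    proof -
      define E where "E j = H (s, \<tau> j \<lfloor>t\<rfloor> (R j t))" for j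
      define G where "G j = (if j = 0 then 0 else E (j - 1))" for j
      have parent: "\<tau> (Suc j) \<lfloor>t\<rfloor> (2 * (R (Suc j) t div 2)) = \<tau> j \<lfloor>t\<rfloor> (R j t)" for j
      proof -
        have "\<lfloor>2 ^ Suc j * (t - \<lfloor>t\<rfloor>) / real_of_int 2\<rfloor> = \<lfloor>2 ^ Suc j * (t - \<lfloor>t\<rfloor>)\<rfloor> div 2"
          by (rule floor_divide_real_eq_div) simp
        then have "R (Suc j) t div 2 = R j t" by (simp add: R_def nat_div_distrib')
        then show ?thesis by (simp add: \<tau>_def)
      qed
      have \<Delta>_eq: "\<Delta> j \<lfloor>t\<rfloor> (R j t) s = G (Suc j) - G j" for j
        using R_less[of j t] parent[of "j - 1"] by (cases j) (auto simp: \<Delta>_def G_def E_def)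
      have inner: "((\<lambda>qr. \<phi> (j, qr) s * \<psi> (j, qr) t) has_sum (G (Suc j) - G j)) UNIV" for j
      proof (rule has_sum_finite_neutralI[where B = "{(\<lfloor>t\<rfloor>, R j t)}"])
        show "G (Suc j) - G j = (\<Sum>qr\<in>{(\<lfloor>t\<rfloor>, R j t)}. \<phi> (j, qr) s * \<psi> (j, qr) t)"
          using a_pos[of j] by (simp add: \<phi>_def \<psi>_def mem_I \<Delta>_eq)
        show "\<phi> (j, qr) s * \<psi> (j, qr) t = 0" if "qr \<in> UNIV - {(\<lfloor>t\<rfloor>, R j t)}" for qr
          using that mem_I[of t j "fst qr" "snd qr"] by (auto simp: \<psi>_def split: prod.splits)
      qed auto
      have "(\<lambda>j. \<tau> j \<lfloor>t\<rfloor> (R j t)) \<longlonglongrightarrow> t"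
      proof (rule tendsto_sandwich[OF _ _ _ tendsto_const])
        show "\<forall>\<^sub>F j in sequentially. t - (1/2) ^ j \<le> \<tau> j \<lfloor>t\<rfloor> (R j t)"
        proof (intro always_eventually allI)
          show "t - (1/2) ^ j \<le> \<tau> j \<lfloor>t\<rfloor> (R j t)" for j
            using R_bounds(2)[of t j] by (simp add: \<tau>_def add_divide_distrib power_one_over)
        qed
        show "\<forall>\<^sub>F j in sequentially. \<tau> j \<lfloor>t\<rfloor> (R j t) \<le> t" using R_bounds by auto
        show "(\<lambda>j. t - (1/2) ^ j) \<longlonglongrightarrow> t"
          by (rule tendsto_eq_intros LIMSEQ_power_zero | simp)+
      qed
      then have "(\<lambda>j. D * \<bar>t - \<tau> j \<lfloor>t\<rfloor> (R j t)\<bar> / sqrt (1 + t\<^sup>2)) \<longlonglongrightarrow> D * \<bar>t - t\<bar> / sqrt (1 + t\<^sup>2)"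
        by (intro tendsto_intros) (auto simp: add_pos_nonneg add_nonneg_eq_0_iff)
      then have "(\<lambda>j. D * \<bar>t - \<tau> j \<lfloor>t\<rfloor> (R j t)\<bar> / sqrt (1 + t\<^sup>2)) \<longlonglongrightarrow> 0" by simp
      then have "(\<lambda>j. H (s, t) - E j) \<longlonglongrightarrow> 0"
        by (rule Lim_null_comparison[rotated]) (use lip in \<open>auto simp: E_def intro!: always_eventually\<close>)
      then have "E \<longlonglongrightarrow> H (s, t)"
        using tendsto_diff[OF tendsto_const[of "H (s, t)"], of "\<lambda>j. H (s, t) - E j" 0] by simp
      then have "G \<longlonglongrightarrow> H (s, t)"
        by (subst filterlim_sequentially_Suc[symmetric]) (simp add: G_def)
      then have sums: "(\<lambda>j. G (Suc j) - G j) sums H (s, t)"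
        using telescope_sums by (fastforce simp: G_def)
      have abs: "(\<lambda>i. norm (\<phi> i s * \<psi> i t)) summable_on UNIV"
      proof (rule nonneg_bounded_partial_sums_imp_summable_on)
        show "\<forall>\<^sub>F X in finite_subsets_at_top UNIV. (\<Sum>i\<in>X. norm (\<phi> i s * \<psi> i t)) \<le> 12 * S * D\<^sup>2 + 3"
        proof (rule eventually_finite_subsets_at_top_weakI)
          fix X :: "(nat \<times> int \<times> nat) set" assume X: "finite X"
          have "(\<Sum>i\<in>X. norm (\<phi> i s * \<psi> i t)) \<le> (\<Sum>i\<in>X. (norm (\<phi> i s))\<^sup>2 + (norm (\<psi> i t))\<^sup>2)"
          proof (intro sum_mono)
            show "norm (\<phi> i s * \<psi> i t) \<le> (norm (\<phi> i s))\<^sup>2 + (norm (\<psi> i t))\<^sup>2" for i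
              unfolding norm_mult using sum_squares_bound[of "norm (\<phi> i s)" "norm (\<psi> i t)"]
                mult_nonneg_nonneg[OF norm_ge_zero norm_ge_zero, of "\<phi> i s" "\<psi> i t"] by linarith
          qed
          also have "\<dots> \<le> 12 * S * D\<^sup>2 + 3"
            using A[OF X] B[OF X] by (simp add: sum.distrib add_mono)
          finally show "(\<Sum>i\<in>X. norm (\<phi> i s * \<psi> i t)) \<le> 12 * S * D\<^sup>2 + 3" .
        qed
      qed auto
      then have sm: "(\<lambda>i. \<phi> i s * \<psi> i t) summable_on UNIV \<times> UNIV"
        using abs_summable_summable by auto
      then obtain Z where Z: "((\<lambda>i. \<phi> i s * \<psi> i t) has_sum Z) (UNIV \<times> UNIV)"
        by (auto simp: summable_on_def)
      have "((\<lambda>j. G (Suc j) - G j) has_sum Z) UNIV"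
        by (rule has_sum_SigmaD[OF Z]) (use inner in auto)
      then have "Z = H (s, t)" using has_sum_imp_sums sums sums_unique2 by blast
      with Z show ?thesis by simp
    qed
    have \<phi>_meas: "\<phi> i \<in> borel_measurable borel" for i
      by (cases i) (simp add: \<phi>_def \<Delta>_def)
    have \<psi>_meas: "\<psi> i \<in> borel_measurable borel" for i
    proof -
      have [measurable]: "I j q r \<in> sets borel" for j q r by (simp add: I_def)
      show ?thesis by (cases i) (simp add: \<psi>_def, measurable)
    qed
    have inf: "infinite (UNIV :: (nat \<times> int \<times> nat) set)"
      by (simp add: finite_prod)
    have "sqrt (12 * S * D\<^sup>2 * 3) = sqrt ((36 * S) * D\<^sup>2)" by (simp add: mult_ac)
    also have "\<dots> = sqrt (36 * S) * D" unfolding real_sqrt_mult using D by simp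
    finally have "sqrt (12 * S * D\<^sup>2 * 3) = sqrt (36 * S) * D" .
    then show "H \<in> haagerup \<and> haagerup_norm H \<le> sqrt (36 * S) * D"
      using haagerup_of_countable_family[of \<phi> \<psi> "12 * S * D\<^sup>2" 3 H, OF inf \<phi>_meas \<psi>_meas A B sum] by simp
  qed
qed

text \<open>
  The factor \<open>1 / (1 - i t)\<close> supplies the decay. Up to a unimodular constant its difference quotient is
  the product of its values at the two points, which yields the same decay for the Lipschitz bound.
\<close>

lemma haagerup_sharp_of_lipschitz:
  obtains C where "C > 0"
    and "\<And>g D. continuous_on UNIV g \<Longrightarrow> 0 \<le> D \<Longrightarrow> (\<And>x. norm (g x) \<le> D) \<Longrightarrow>
      (\<And>x y. norm (g x - g y) \<le> D * norm (x - y)) \<Longrightarrow>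
      sharp g \<in> haagerup \<and> haagerup_norm (sharp g) \<le> C * D"
proof -
  obtain C where C: "C > 0"
    and H: "\<And>H D. (\<And>t. (\<lambda>s. H (s, t)) \<in> borel_measurable borel) \<Longrightarrow> 0 \<le> D \<Longrightarrow>
      (\<And>s t. norm (H (s, t)) \<le> D / sqrt (1 + t\<^sup>2)) \<Longrightarrow>
      (\<And>s t t'. norm (H (s, t) - H (s, t')) \<le> D * \<bar>t - t'\<bar> / sqrt (1 + t\<^sup>2)) \<Longrightarrow>
      H \<in> haagerup \<and> haagerup_norm H \<le> C * D"
    using haagerup_of_decaying_lipschitz by blast
  have C2: "2 * C > 0" using C by simp
  show thesis
  proof (rule that[OF C2])
    fix g :: "real \<times> real \<Rightarrow> complex" and D :: real
    assume cont: "continuous_on UNIV g" and D: "0 \<le> D" and bd: "\<And>x. norm (g x) \<le> D"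
      and lip: "\<And>x y. norm (g x - g y) \<le> D * norm (x - y)"
    define m where "m t = inverse (1 - \<i> * complex_of_real t)" for t
    have nz: "1 - \<i> * complex_of_real t \<noteq> 0" for t
      by (auto simp: complex_eq_iff)
    have norm_m: "norm (m t) = 1 / sqrt (1 + t\<^sup>2)" for t
      unfolding m_def norm_inverse by (simp add: cmod_def inverse_eq_divide)
    have m_le: "norm (m t) \<le> 1" for t by (simp add: norm_m divide_le_eq add_pos_nonneg)
    have m_diff: "m t - m t' = m t * m t' * (\<i> * (t - t'))" for t t'
      using nz[of t] nz[of t'] by (simp add: m_def field_simps)
    have "sharp g \<in> haagerup \<and> haagerup_norm (sharp g) \<le> C * (2 * D)"
    proof (rule H)
      show "(\<lambda>s. sharp g (s, t)) \<in> borel_measurable borel" for t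
      proof (rule borel_measurable_continuous_onI)
        have "continuous_on UNIV (\<lambda>s. g (s, t))"
          by (rule continuous_on_compose2[OF cont]) (auto intro!: continuous_intros)
        then show "continuous_on UNIV (\<lambda>s. sharp g (s, t))"
          unfolding sharp_def by (auto intro!: continuous_intros)
      qed
      show "0 \<le> 2 * D" using D by simp
      fix s t t'
      have "norm (sharp g (s, t)) = norm (g (s, t)) / sqrt (1 + t\<^sup>2)"
        using norm_m[of t] by (simp add: sharp_def norm_mult m_def)
      also have "\<dots> \<le> 2 * D / sqrt (1 + t\<^sup>2)"
        using bd[of "(s, t)"] D by (intro divide_right_mono) auto
      finally show "norm (sharp g (s, t)) \<le> 2 * D / sqrt (1 + t\<^sup>2)" .
      have "sharp g (s, t) - sharp g (s, t') =
          m t * (g (s, t) - g (s, t')) + (m t - m t') * g (s, t')"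
        by (simp add: sharp_def m_def algebra_simps)
      also have "norm \<dots> \<le> norm (m t) * norm (g (s, t) - g (s, t')) + norm (m t - m t') * norm (g (s, t'))"
        by (rule order_trans[OF norm_triangle_ineq]) (simp add: norm_mult)
      also have "\<dots> \<le> norm (m t) * (D * \<bar>t - t'\<bar>) + norm (m t) * \<bar>t - t'\<bar> * D"
      proof (intro add_mono mult_mono mult_left_mono bd)
        show "norm (g (s, t) - g (s, t')) \<le> D * \<bar>t - t'\<bar>"
          using lip[of "(s, t)" "(s, t')"] by simp
        have "norm (m t - m t') = norm (m t) * norm (m t') * \<bar>t - t'\<bar>"
          unfolding m_diff by (simp add: norm_mult flip: of_real_diff)
        also have "\<dots> \<le> norm (m t) * 1 * \<bar>t - t'\<bar>"
          by (intro mult_mono m_le order_refl) auto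
        finally show "norm (m t - m t') \<le> norm (m t) * \<bar>t - t'\<bar>" by simp
      qed auto
      also have "\<dots> = 2 * D * \<bar>t - t'\<bar> / sqrt (1 + t\<^sup>2)" by (simp add: norm_m)
      finally show "norm (sharp g (s, t) - sharp g (s, t')) \<le> 2 * D * \<bar>t - t'\<bar> / sqrt (1 + t\<^sup>2)" .
    qed
    then show "sharp g \<in> haagerup \<and> haagerup_norm (sharp g) \<le> 2 * C * D" by (simp add: mult_ac)
  qed
qed

section \<open>The embedding\<close>

theorem theorem3p1:
  fixes w :: "real \<Rightarrow> real"
  assumes "lp_window w"
  shows "\<exists>C::real. C > 0 \<and>
    (\<forall>f \<in> besov w. \<exists>g. continuous_on UNIV g \<and> represents g f \<and>
       sharp g \<in> haagerup \<and>
       haagerup_norm (sharp g) \<le> C * enn2real (besov_norm w f))"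
proof -
  obtain C1 where C1: "0 < C1" and rep: "\<And>f B. f \<in> besov w \<Longrightarrow> 0 < B \<Longrightarrow> enn2real (besov_norm w f) \<le> B \<Longrightarrow>
      \<exists>g. represents g f \<and> (\<forall>x. norm (g x) \<le> C1 * B) \<and> (\<forall>x y. norm (g x - g y) \<le> C1 * B * norm (x - y))"
    by (rule lipschitz_representative[OF assms]) (rule that)
  obtain C2 where C2: "0 < C2" and sharp: "\<And>g D. continuous_on UNIV g \<Longrightarrow> 0 \<le> D \<Longrightarrow> (\<And>x. norm (g x) \<le> D) \<Longrightarrow>
      (\<And>x y. norm (g x - g y) \<le> D * norm (x - y)) \<Longrightarrow>
      sharp g \<in> haagerup \<and> haagerup_norm (sharp g) \<le> C2 * D"
    using haagerup_sharp_of_lipschitz by blast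
  show ?thesis
  proof (intro exI[of _ "C2 * C1"] conjI ballI)
    show "0 < C2 * C1" using C1 C2 by simp
    fix f assume f: "f \<in> besov w"
    define B where "B = enn2real (besov_norm w f)"
    have "\<exists>g. represents g f \<and> (\<forall>x. norm (g x) \<le> C1 * B) \<and> (\<forall>x y. norm (g x - g y) \<le> C1 * B * norm (x - y))"
    \<comment> \<open>For \<open>B = 0\<close> the functional vanishes on test functions: it has bounded representatives as small as desired.\<close>
    proof (cases "B = 0")
      case False
      then have "0 < B" by (simp add: B_def less_le)
      then show ?thesis by (intro rep f) (simp_all add: B_def)
    next
      case True
      have zero: "f \<phi> = 0" if \<phi>: "\<phi> \<in> schwartz" for \<phi>
      proof -
        have *: "norm (f \<phi>) \<le> e * (C1 * (LINT x|lborel. norm (\<phi> x)))" if e: "0 < e" for e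
        proof -
          have "enn2real (besov_norm w f) \<le> e" using True e by (simp add: B_def)
          from rep[OF f e this] obtain g where g: "represents g f" "\<forall>x. norm (g x) \<le> C1 * e" by (elim exE conjE)
          have "norm (f \<phi>) \<le> (LINT x|lborel. C1 * e * norm (\<phi> x))"
            unfolding representsD(2)[OF g(1) \<phi>]
          proof (rule Bochner_Integration.integral_norm_bound_integral[OF representsD(1)[OF g(1) \<phi>]])
            show "integrable lborel (\<lambda>x. C1 * e * norm (\<phi> x))"
              by (rule integrable_mult_right[OF integrable_norm[OF schwartz_integrable[OF \<phi>]]])
            show "norm (g x * \<phi> x) \<le> C1 * e * norm (\<phi> x)" for x
              unfolding norm_mult by (rule mult_right_mono[OF spec[OF g(2)] norm_ge_zero])
          qed
          then show ?thesis by (simp only: integral_mult_right_zero mult_ac)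
        qed
        have "norm (f \<phi>) \<le> 0 + e" if "0 < e" for e
        proof -
          define M where "M = C1 * (LINT x|lborel. norm (\<phi> x))"
          have M: "0 \<le> M" using C1 by (simp add: M_def)
          have "norm (f \<phi>) \<le> e / (M + 1) * M"
            unfolding M_def by (rule *) (use M that in \<open>simp add: M_def[symmetric]\<close>)
          also have "\<dots> \<le> e" using M that by (simp add: field_simps)
          finally show ?thesis by simp
        qed
        then have "norm (f \<phi>) \<le> 0" by (rule field_le_epsilon)
        then show ?thesis by simp
      qed
      have "represents (\<lambda>_. 0) f" by (simp add: represents_def zero)
      then show ?thesis by (intro exI[of _ "\<lambda>_. 0"]) (simp add: True)
    qed
    then obtain g where g: "represents g f" "\<forall>x. norm (g x) \<le> C1 * B" "\<forall>x y. norm (g x - g y) \<le> C1 * B * norm (x - y)"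
      by (elim exE conjE)
    have D: "0 \<le> C1 * B" using C1 by (simp add: B_def)
    have cont: "continuous_on UNIV g"
      by (rule continuous_on_of_lipschitz_bound[OF spec[OF spec[OF g(3)]] D])
    from sharp[OF cont D spec[OF g(2)] spec[OF spec[OF g(3)]]] cont g(1)
    show "\<exists>g. continuous_on UNIV g \<and> represents g f \<and> sharp g \<in> haagerup \<and>
        haagerup_norm (sharp g) \<le> C2 * C1 * enn2real (besov_norm w f)"
      unfolding B_def by (intro exI[of _ g] conjI) (simp_all only: mult.assoc)
  qed
qed

end
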